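(* Let $K\ge1$ be an integer. For (Lebesgue-)almost all real $\alpha>16K^{2}+8K-1$, the inequalities $$\sum_{1\le k\le 2K}(-1)^{k+1}\frac{x^k}{k!}\ \le\ \liminf_{N\to\infty}g\bigl(x,(n^\alpha),N\bigr)\ \le\ \limsup_{N\to\infty}g\bigl(x,(n^\alpha),N\bigr)\ \le\ \sum_{1\le k\le 2K-1}(-1)^{k+1}\frac{x^k}{k!}$$ hold for all $x\ge0$.
   Context: For a real sequence $(\vartheta_n)_{n\ge1}$ and $N\ge1$, let $\vartheta^N_{(1)}\le\vartheta^N_{(2)}\le\dots\le\vartheta^N_{(N)}\le\vartheta^N_{(N+1)}$ denote the first $N+1$ elements $\{\vartheta_1\},\dots,\{\vartheta_{N+1}\}$ of the sequence of fractional parts $(\{\vartheta_n\})_{n\ge1}$, arranged in increasing order (with multiplicity). Define $$g(x,(\vartheta_n),N)=\frac1N\#\left\{n\le N:\ N\bigl(\vartheta^N_{(n+1)}-\vartheta^N_{(n)}\bigr)\le x\right\}.$$ Here $\vartheta_n=n^\alpha$. *)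

theory Defs
  imports "HOL-Analysis.Analysis"
begin

text \<open>Sequences are indexed from 1; the value at index 0 is never used.
  The order statistic is meaningful for \<open>1 \<le> n \<le> N + 1\<close>; Isabelle lists count from 0,
  hence the shift in the list index.\<close>

definition frac_order_stat :: "(nat \<Rightarrow> real) \<Rightarrow> nat \<Rightarrow> nat \<Rightarrow> real" where
  "frac_order_stat \<theta> N n = sort (map (\<lambda>i. frac (\<theta> i)) [1..<N + 2]) ! (n - 1)"

definition gap_distribution :: "real \<Rightarrow> (nat \<Rightarrow> real) \<Rightarrow> nat \<Rightarrow> real" where
  "gap_distribution x \<theta> N =
     1 / real N *
     real (card {n \<in> {1..N}.
       real N * (frac_order_stat \<theta> N (n + 1) - frac_order_stat \<theta> N n) \<le> x})"

end

theory Submission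
  imports Defs
begin

text \<open>
  Let \<open>T\<close> be the number of \<open>m\<close>-tuples of distinct indices whose points \<open>n powr \<alpha>\<close> all lie, modulo 1,
  within \<open>x / N\<close> after the first one. If \<open>T / N\<close> tends to \<open>x ^ (m - 1)\<close> for every \<open>m \<le> 2 * K + 1\<close>,
  Bonferroni's inequalities for the number of points following a given one yield both bounds.
  Adding or deleting a point changes the number of short gaps by at most 2, so it suffices to treat
  the indices in \<open>(j ^ (B - 2), j ^ B]\<close> for a large fixed \<open>B\<close>.

  The almost sure limit of \<open>T / N\<close> follows from a second moment estimate over short intervals of \<open>\<alpha>\<close>.
  Disjoint pairs of \<open>m\<close>-tuples lead to integrals of \<open>cis\<close> of sums \<open>\<Sum>n. c n * n powr \<alpha>\<close> with at most \<open>2 * m\<close>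
  terms; killing the terms one by one with operators \<open>D - ln n\<close> shows that they are at most about
  \<open>\<mu> powr (- 1 / (2 * m))\<close>, where \<open>\<mu>\<close> is \<open>\<bar>c n0\<bar> * n0 powr \<alpha>\<close> times the product of the
  \<open>\<bar>n0 - n\<bar> / N\<close>. As \<open>1 / (2 * m) < 1\<close>, the losses from nearby indices average out. A typical
  coefficient has size \<open>N\<close>, which gives the saving \<open>N powr ((\<alpha> + 1) / (2 * m))\<close>; it beats the
  \<open>N ^ (2 * m - 2)\<close> needed exactly if \<open>\<alpha> > 4 * m\<^sup>2 - 4 * m - 1\<close>, and \<open>m = 2 * K + 1\<close> gives the threshold.
  Overlapping pairs are controlled by the first moment for \<open>2 * m - 1\<close> points.
\<close>

section \<open>Oscillatory integrals of exponential sums\<close>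

text \<open>Forests of depth one keep the phases nondegenerate. In a sum of terms
  \<open>u j * (z j powr \<alpha> - z (par j) powr \<alpha>)\<close> a child occurs only once, so
  its coefficient is \<open>u j\<close> itself, and every nonzero frequency vector leaves some
  exponential with a nonzero coefficient. Overlapping pairs destroy this, because frequencies at a
  shared point may cancel; hence they are counted instead of integrated. Ordinary derivatives of the
  phase would raise the question which of them is large, as the terms may cancel in each one. The
  operators \<open>D - ln n\<close> avoid it: once all exponents but one are killed, a single term
  is left and nothing can cancel. Three losses must cost no more than fixed powers of
  \<open>j\<close>, where \<open>N = j ^ B\<close>: the growth of \<open>n powr \<alpha>\<close>
  over the interval of \<alpha>, the smallness of \<open>n powr \<alpha>\<close> for small
  \<open>n\<close>, and the logarithms from coefficient sums. The first forces intervals of length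
  \<open>1 / B\<close>, the second the cut at \<open>j ^ (B - 2)\<close>. So \<open>B\<close> must
  grow as \<alpha> approaches the threshold, and the half-line beyond it is exhausted by countably
  many intervals.\<close>

lemma monotone_weight_integral_bound:
  fixes f h :: "real \<Rightarrow> real"
  assumes ab: "a \<le> b" and f: "continuous_on {a..b} f"
    and mon: "mono_on {a..b} h \<or> antimono_on {a..b} h"
    and h: "\<And>x. x \<in> {a..b} \<Longrightarrow> \<bar>h x\<bar> \<le> K"
    and M: "\<And>p q. a \<le> p \<Longrightarrow> p \<le> q \<Longrightarrow> q \<le> b \<Longrightarrow> \<bar>integral {p..q} f\<bar> \<le> M"
  shows "\<bar>integral {a..b} (\<lambda>x. h x * f x)\<bar> \<le> 2 * K * M"
proof -
  have fi: "f integrable_on {a..b}"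
    using f by (rule integrable_continuous_real)
  have *: "\<bar>integral {a..b} (\<lambda>x. g x * f x)\<bar> \<le> 2 * K * M"
    if g: "mono_on {a..b} g" and gK: "\<And>x. x \<in> {a..b} \<Longrightarrow> \<bar>g x\<bar> \<le> K" for g
  proof -
    \<comment> \<open>By the second mean value theorem only the two endpoint values of the weight
      survive, each multiplied by an integral of \<open>f\<close> over a subinterval; hence the
      factor 2.\<close>
    obtain c where c: "c \<in> {a..b}"
      "integral {a..b} (\<lambda>x. g x * f x) = g a * integral {a..c} f + g b * integral {c..b} f"
      using second_mean_value_theorem[OF fi ab, of g] g by (auto simp: mono_on_def)
    have "\<bar>g a * integral {a..c} f\<bar> \<le> K * M" "\<bar>g b * integral {c..b} f\<bar> \<le> K * M"
      using c gK[of a] gK[of b] ab M[of a c] M[of c b] unfolding abs_mult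
      by (auto intro!: mult_mono order_trans[OF abs_ge_zero])
    then show ?thesis unfolding c by linarith
  qed
  show ?thesis
  proof (cases "mono_on {a..b} h")
    case True
    then show ?thesis using * h by blast
  next
    case False
    then have "mono_on {a..b} (\<lambda>x. - h x)"
      using mon by (auto simp: monotone_on_def)
    from *[OF this] h show ?thesis by simp
  qed
qed

lemma nonvanishing_continuous_sign:
  fixes h :: "real \<Rightarrow> real"
  assumes "continuous_on {a..b} h" "\<And>x. x \<in> {a..b} \<Longrightarrow> h x \<noteq> 0"
  shows "(\<forall>x\<in>{a..b}. h x > 0) \<or> (\<forall>x\<in>{a..b}. h x < 0)"
proof (rule ccontr)
  assume "\<not> ?thesis"
  then obtain x y where xy: "x \<in> {a..b}" "y \<in> {a..b}" "h x < 0" "h y > 0"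
    using assms(2) by (metis linorder_neqE_linordered_idom)
  have "connected (h ` {a..b})" using assms(1) by (intro connected_continuous_image) auto
  then have "0 \<in> h ` {a..b}"
    using xy unfolding connected_iff_interval by (meson image_eqI less_imp_le)
  then show False using assms(2) by auto
qed

text \<open>Van der Corput's first derivative test, with \<open>g\<close> as derivative of the
  phase. Here not \<open>g\<close> but \<open>exp (- l * x) * g x\<close> is monotone, which is what
  one operator \<open>D - l\<close> yields. So the integrand is written as an exact derivative times
  two monotone weights, \<open>exp (- l * x)\<close> and the reciprocal of that product;
  \<open>E\<close> pays for the variation of the exponential.\<close>

lemma first_derivative_test:
  fixes \<phi> g :: "real \<Rightarrow> real"
  assumes ab: "a \<le> b" and l: "l \<ge> 0" and E: "exp (l * (b - a)) \<le> E" and lam: "\<mu> > 0"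
    and der: "\<And>x. x \<in> {a..b} \<Longrightarrow> (\<phi> has_real_derivative g x) (at x)"
    and g: "continuous_on {a..b} g"
    and mon: "mono_on {a..b} (\<lambda>x. exp (- l * x) * g x) \<or> antimono_on {a..b} (\<lambda>x. exp (- l * x) * g x)"
    and big: "\<And>x. x \<in> {a..b} \<Longrightarrow> \<mu> \<le> \<bar>g x\<bar>"
  shows "norm (integral {a..b} (\<lambda>x. cis (\<phi> x))) \<le> 16 * E / \<mu>"
proof -
  define \<psi> where "\<psi> = (\<lambda>x. exp (- l * x) * g x)"
  have cphi: "continuous_on {a..b} \<phi>"
    using der by (meson DERIV_isCont continuous_at_imp_continuous_on)
  have \<psi>0: "\<psi> x \<noteq> 0" if "x \<in> {a..b}" for x
    using big[OF that] lam by (auto simp: \<psi>_def)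
  have c\<psi>: "continuous_on {a..b} \<psi>" unfolding \<psi>_def by (intro continuous_intros g)
  have sgn: "(\<forall>x\<in>{a..b}. \<psi> x > 0) \<or> (\<forall>x\<in>{a..b}. \<psi> x < 0)"
    by (rule nonvanishing_continuous_sign[OF c\<psi> \<psi>0])
  have inv_mon: "mono_on {a..b} (\<lambda>x. 1 / \<psi> x) \<or> antimono_on {a..b} (\<lambda>x. 1 / \<psi> x)"
  proof -
    have le: "1 / \<psi> y \<le> 1 / \<psi> x" if "x \<in> {a..b}" "y \<in> {a..b}" "\<psi> x \<le> \<psi> y" for x y
    proof (cases "\<psi> x > 0")
      case True then show ?thesis using that by (auto intro: divide_left_mono)
    next
      case False
      then have "\<psi> x < 0" "\<psi> y < 0" using sgn that by blast+
      then show ?thesis using that by (auto simp: field_simps)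
    qed
    show ?thesis using mon unfolding \<psi>_def[symmetric]
      by (auto simp: monotone_on_def intro: le)
  qed
  have inv_le: "\<bar>1 / \<psi> x\<bar> \<le> exp (l * b) / \<mu>" if "x \<in> {a..b}" for x
  proof -
    have "exp (l * x) \<le> exp (l * b)" using that l by (auto intro!: mult_left_mono)
    then have "exp (l * x) / \<bar>g x\<bar> \<le> exp (l * b) / \<mu>"
      using big[OF that] lam by (intro frac_le) auto
    then show ?thesis by (simp add: \<psi>_def abs_mult exp_minus field_simps)
  qed
  \<comment> \<open>\<open>F\<close> is \<open>cos\<close> or \<open>sin\<close> and
    \<open>G\<close> a primitive. The 8 is the bound 2 for an increment of \<open>G\<close>, doubled
    by each of the two weights; real and imaginary part together give 16.\<close>
  have trig: "\<bar>integral {a..b} (\<lambda>x. F (\<phi> x))\<bar> \<le> 8 * E / \<mu>"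
    if F: "\<And>x. (G has_real_derivative F x) (at x)" "\<And>x. \<bar>G x\<bar> \<le> 1" "continuous_on UNIV F" for F G
  proof -
    have cF: "continuous_on {a..b} (\<lambda>x. F (\<phi> x))"
      using continuous_on_compose2[OF F(3) cphi] by auto
    have 1: "\<bar>integral {p..q} (\<lambda>x. F (\<phi> x) * g x)\<bar> \<le> 2" if "a \<le> p" "p \<le> q" "q \<le> b" for p q
    proof -
      have "((\<lambda>x. F (\<phi> x) * g x) has_integral G (\<phi> q) - G (\<phi> p)) {p..q}"
        using that
        by (intro fundamental_theorem_of_calculus)
          (auto simp flip: has_real_derivative_iff_has_vector_derivative
            intro!: DERIV_chain2[OF F(1)] has_field_derivative_at_within[OF der])
      then have "integral {p..q} (\<lambda>x. F (\<phi> x) * g x) = G (\<phi> q) - G (\<phi> p)" by blast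
      then show ?thesis using F(2)[of "\<phi> q"] F(2)[of "\<phi> p"] by simp
    qed
    have 2: "\<bar>integral {p..q} (\<lambda>x. exp (- l * x) * (F (\<phi> x) * g x))\<bar> \<le> 4 * exp (- l * a)"
      if "a \<le> p" "p \<le> q" "q \<le> b" for p q
    proof -
      have "\<bar>integral {p..q} (\<lambda>x. exp (- l * x) * (F (\<phi> x) * g x))\<bar> \<le> 2 * exp (- l * a) * 2"
      proof (rule monotone_weight_integral_bound[OF that(2)])
        have "continuous_on {a..b} (\<lambda>x. F (\<phi> x) * g x)" by (intro continuous_intros cF g)
        then show "continuous_on {p..q} (\<lambda>x. F (\<phi> x) * g x)"
          by (rule continuous_on_subset) (use that in auto)
      qed (use that l 1 in \<open>auto simp: monotone_on_def intro!: mult_left_mono\<close>)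
      then show ?thesis by simp
    qed
    have "\<bar>integral {a..b} (\<lambda>x. (1 / \<psi> x) * (exp (- l * x) * (F (\<phi> x) * g x)))\<bar>
      \<le> 2 * (exp (l * b) / \<mu>) * (4 * exp (- l * a))"
      by (intro monotone_weight_integral_bound inv_mon inv_le 2 ab)
        (auto intro!: continuous_intros cF g)
    also have "\<dots> = 8 * exp (l * (b - a)) / \<mu>"
      by (simp add: algebra_simps flip: exp_add)
    also have "\<dots> \<le> 8 * E / \<mu>" using E lam by (intro divide_right_mono) auto
    also have "integral {a..b} (\<lambda>x. (1 / \<psi> x) * (exp (- l * x) * (F (\<phi> x) * g x))) =
      integral {a..b} (\<lambda>x. F (\<phi> x))"
      using \<psi>0 by (intro integral_cong) (auto simp: \<psi>_def)
    finally show ?thesis .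
  qed
  have c: "\<bar>integral {a..b} (\<lambda>x. cos (\<phi> x))\<bar> \<le> 8 * E / \<mu>"
    by (rule trig[of sin]) (auto intro!: derivative_eq_intros continuous_intros)
  have s: "\<bar>integral {a..b} (\<lambda>x. sin (\<phi> x))\<bar> \<le> 8 * E / \<mu>"
    by (rule trig[of "\<lambda>x. - cos x"]) (auto intro!: derivative_eq_intros continuous_intros)
  have "(\<lambda>x. cis (\<phi> x)) integrable_on {a..b}"
    by (intro integrable_continuous_real continuous_intros cphi)
  then have "Re (integral {a..b} (\<lambda>x. cis (\<phi> x))) = integral {a..b} (\<lambda>x. cos (\<phi> x))"
    "Im (integral {a..b} (\<lambda>x. cis (\<phi> x))) = integral {a..b} (\<lambda>x. sin (\<phi> x))"
    using integral_component_eq[of "\<lambda>x. cis (\<phi> x)" "{a..b}"]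
      integral_linear[of "\<lambda>x. cis (\<phi> x)" "{a..b}" Re] integral_linear[of "\<lambda>x. cis (\<phi> x)" "{a..b}" Im]
    by (auto simp: o_def bounded_linear_Re bounded_linear_Im)
  then show ?thesis
    using cmod_le[of "integral {a..b} (\<lambda>x. cis (\<phi> x))"] c s by simp
qed

text \<open>The weight \<open>exp (- l * x)\<close> turns \<open>g' - l * g\<close> into a derivative, so that \<open>g\<close> has at most
  one zero and grows at least linearly away from it.\<close>

lemma twisted_derivative_lower_bound:
  fixes g h :: "real \<Rightarrow> real"
  assumes ab: "a \<le> b" and l: "l \<ge> 0" and E: "exp (l * (b - a)) \<le> E" and lam: "\<mu> > 0"
    and der: "\<And>x. x \<in> {a..b} \<Longrightarrow> (g has_real_derivative (l * g x + h x)) (at x)"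
    and h: "continuous_on {a..b} h"
    and big: "\<And>x. x \<in> {a..b} \<Longrightarrow> \<mu> \<le> \<bar>h x\<bar>"
  shows "(mono_on {a..b} (\<lambda>x. exp (- l * x) * g x) \<or> antimono_on {a..b} (\<lambda>x. exp (- l * x) * g x)) \<and>
    (\<exists>c\<in>{a..b}. \<forall>x\<in>{a..b}. \<mu> * \<bar>x - c\<bar> / E \<le> \<bar>g x\<bar>)"
proof -
  have *: "mono_on {a..b} (\<lambda>x. exp (- l * x) * g x) \<and>
    (\<exists>c\<in>{a..b}. \<forall>x\<in>{a..b}. \<mu> * \<bar>x - c\<bar> / E \<le> \<bar>g x\<bar>)"
    if der: "\<And>x. x \<in> {a..b} \<Longrightarrow> (g has_real_derivative (l * g x + h x)) (at x)"
      and big: "\<And>x. x \<in> {a..b} \<Longrightarrow> \<mu> \<le> h x" for g h :: "real \<Rightarrow> real"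
  proof -
    define \<psi> where "\<psi> = (\<lambda>x. exp (- l * x) * g x)"
    have d\<psi>: "(\<psi> has_real_derivative exp (- l * x) * h x) (at x)" if "x \<in> {a..b}" for x
      unfolding \<psi>_def by (rule derivative_eq_intros der[OF that] refl)+ (simp add: algebra_simps)
    have grow: "\<mu> * exp (- l * b) * (y - x) \<le> \<psi> y - \<psi> x" if xy: "a \<le> x" "x \<le> y" "y \<le> b" for x y
    proof (cases "x = y")
      case False
      then have "x < y" using xy by simp
      then obtain z where z: "z > x" "z < y" "\<psi> y - \<psi> x = (y - x) * (exp (- l * z) * h z)"
        using MVT2[of x y \<psi> "\<lambda>z. exp (- l * z) * h z"] d\<psi> xy by auto
      have "\<mu> * exp (- l * b) \<le> exp (- l * z) * h z"
        using big[of z] z xy l lam by (subst mult.commute, intro mult_mono) (auto intro!: mult_left_mono)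
      then show ?thesis unfolding z using xy by (simp add: mult_left_mono mult.commute)
    qed simp
    have mono: "mono_on {a..b} \<psi>"
    proof (rule mono_onI)
      fix x y assume "x \<in> {a..b}" "y \<in> {a..b}" "x \<le> y"
      then have "0 \<le> \<mu> * exp (- l * b) * (y - x)" "\<mu> * exp (- l * b) * (y - x) \<le> \<psi> y - \<psi> x"
        using grow[of x y] lam by auto
      then show "\<psi> x \<le> \<psi> y" by simp
    qed
    have c\<psi>: "continuous_on {a..b} \<psi>"
      using d\<psi> by (meson DERIV_isCont continuous_at_imp_continuous_on)
    have "\<exists>c\<in>{a..b}. \<forall>x\<in>{a..b}. \<mu> * exp (- l * b) * \<bar>x - c\<bar> \<le> \<bar>\<psi> x\<bar>"
    proof -
      \<comment> \<open>The point \<open>c\<close> is where the increasing function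
        \<open>\<psi>\<close> is smallest in absolute value: an endpoint if the sign is constant, a
        zero otherwise.\<close>
      consider "0 < \<psi> a" | "\<psi> b < 0" | "\<psi> a \<le> 0" "0 \<le> \<psi> b" by linarith
      then show ?thesis
      proof cases
        case 1
        have "\<mu> * exp (- l * b) * \<bar>x - a\<bar> \<le> \<bar>\<psi> x\<bar>" if "x \<in> {a..b}" for x
          using grow[of a x] that 1 by simp
        then show ?thesis using ab by (intro bexI[of _ a]) auto
      next
        case 2
        have "\<mu> * exp (- l * b) * \<bar>x - b\<bar> \<le> \<bar>\<psi> x\<bar>" if "x \<in> {a..b}" for x
          using grow[of x b] that 2 by (auto simp: abs_if)
        then show ?thesis using ab by (intro bexI[of _ b]) auto
      next
        case 3
        then obtain c where c: "c \<in> {a..b}" "\<psi> c = 0"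
          using IVT'[of \<psi> a 0 b] ab c\<psi> by auto
        have "\<mu> * exp (- l * b) * \<bar>x - c\<bar> \<le> \<bar>\<psi> x\<bar>" if "x \<in> {a..b}" for x
          using grow[of x c] grow[of c x] that c by (cases "x \<le> c") (auto simp: abs_if)
        then show ?thesis using c by (intro bexI[of _ c]) auto
      qed
    qed
    then obtain c where c: "c \<in> {a..b}" "\<And>x. x \<in> {a..b} \<Longrightarrow> \<mu> * exp (- l * b) * \<bar>x - c\<bar> \<le> \<bar>\<psi> x\<bar>"
      by blast
    have "\<mu> * \<bar>x - c\<bar> / E \<le> \<bar>g x\<bar>" if x: "x \<in> {a..b}" for x
    proof -
      have "E > 0" using E exp_gt_zero[of "l * (b - a)"] by linarith
      then have "1 / E \<le> 1 / exp (l * (b - a))" using E by (intro divide_left_mono mult_pos_pos) auto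
      also have "\<dots> = exp (l * a) * exp (- l * b)"
        by (simp add: exp_minus exp_diff field_simps flip: exp_add)
      also have "\<dots> \<le> exp (l * x) * exp (- l * b)"
        using x l by (auto intro!: mult_right_mono mult_left_mono)
      finally have "\<mu> * \<bar>x - c\<bar> * (1 / E) \<le> \<mu> * \<bar>x - c\<bar> * (exp (l * x) * exp (- l * b))"
        using lam by (intro mult_left_mono) auto
      also have "\<dots> = exp (l * x) * (\<mu> * exp (- l * b) * \<bar>x - c\<bar>)" by simp
      also have "\<dots> \<le> exp (l * x) * \<bar>\<psi> x\<bar>" using c(2)[OF x] by (intro mult_left_mono) auto
      also have "\<dots> = \<bar>g x\<bar>" by (simp add: \<psi>_def abs_mult exp_minus)
      finally show ?thesis by simp
    qed
    then show ?thesis using mono c(1) unfolding \<psi>_def by blast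
  qed
  have "(\<forall>x\<in>{a..b}. h x > 0) \<or> (\<forall>x\<in>{a..b}. h x < 0)"
  proof (rule nonvanishing_continuous_sign[OF h])
    show "h x \<noteq> 0" if "x \<in> {a..b}" for x using big[OF that] lam by auto
  qed
  then show ?thesis
  proof
    assume "\<forall>x\<in>{a..b}. h x > 0"
    then have "\<And>x. x \<in> {a..b} \<Longrightarrow> \<mu> \<le> h x" using big by fastforce
    from *[OF der this] show ?thesis by blast
  next
    assume "\<forall>x\<in>{a..b}. h x < 0"
    then have "\<And>x. x \<in> {a..b} \<Longrightarrow> \<mu> \<le> - h x" using big by fastforce
    moreover have "((\<lambda>x. - g x) has_real_derivative (l * (- g x) + (- h x))) (at x)" if "x \<in> {a..b}" for x
      using DERIV_minus[OF der[OF that]] by simp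
    ultimately show ?thesis using *[of "\<lambda>x. - g x" "\<lambda>x. - h x"] by (auto simp: monotone_on_def)
  qed
qed

section \<open>Removing the exponentials one at a time\<close>

lemma norm_integral_cis_le:
  assumes "a \<le> b" "continuous_on {a..b} \<phi>"
  shows "norm (integral {a..b} (\<lambda>x. cis (\<phi> x))) \<le> b - a"
  using integral_bound[of a b "\<lambda>x. cis (\<phi> x)" 1] assms by (auto intro!: continuous_intros)

lemma integral_split_around_point:
  fixes \<phi> :: "real \<Rightarrow> real"
  assumes ab: "a \<le> b" and d: "\<delta> > 0" and K: "K \<ge> 0" and \<phi>: "continuous_on {a..b} \<phi>"
    and far: "\<And>p q. a \<le> p \<Longrightarrow> p \<le> q \<Longrightarrow> q \<le> b \<Longrightarrow> (\<And>x. x \<in> {p..q} \<Longrightarrow> \<delta> \<le> \<bar>x - c\<bar>) \<Longrightarrow>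
      norm (integral {p..q} (\<lambda>x. cis (\<phi> x))) \<le> K"
  shows "norm (integral {a..b} (\<lambda>x. cis (\<phi> x))) \<le> 2 * \<delta> + 2 * K"
proof -
  let ?f = "\<lambda>x. cis (\<phi> x)"
  have int: "?f integrable_on {p..q}" if "a \<le> p" "q \<le> b" for p q
    using that by (intro integrable_continuous_real continuous_intros continuous_on_subset[OF \<phi>]) auto
  \<comment> \<open>Clamping to \<open>{a..b}\<close> treats alike the cases where the excised
    interval sticks out on one side or misses \<open>{a..b}\<close>; the corresponding outer piece
    then degenerates to a point.\<close>
  define p where "p = max a (min b (c - \<delta>))"
  define q where "q = max a (min b (c + \<delta>))"
  have pq: "a \<le> p" "p \<le> q" "q \<le> b" "q - p \<le> 2 * \<delta>" using ab d by (auto simp: p_def q_def)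
  have L: "norm (integral {a..p} ?f) \<le> K"
  proof (cases "p = a")
    case True then show ?thesis using K by simp
  next
    case False
    then have "p \<le> c - \<delta>" by (auto simp: p_def)
    then show ?thesis using pq d by (intro far) auto
  qed
  have R: "norm (integral {q..b} ?f) \<le> K"
  proof (cases "q = b")
    case True then show ?thesis using K by simp
  next
    case False
    then have "q \<ge> c + \<delta>" using ab by (auto simp: q_def)
    then show ?thesis using pq d by (intro far) auto
  qed
  have M: "norm (integral {p..q} ?f) \<le> 2 * \<delta>"
    using norm_integral_cis_le[of p q \<phi>] pq continuous_on_subset[OF \<phi>, of "{p..q}"] by auto
  have "integral {a..b} ?f = integral {a..q} ?f + integral {q..b} ?f"
    using pq ab by (intro Henstock_Kurzweil_Integration.integral_combine[symmetric] int) auto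
  also have "integral {a..q} ?f = integral {a..p} ?f + integral {p..q} ?f"
    using pq ab by (intro Henstock_Kurzweil_Integration.integral_combine[symmetric] int) auto
  finally have "norm (integral {a..b} ?f) \<le> norm (integral {a..p} ?f) + norm (integral {p..q} ?f) + norm (integral {q..b} ?f)"
    using norm_triangle_ineq[of "integral {a..p} ?f + integral {p..q} ?f" "integral {q..b} ?f"]
      norm_triangle_ineq[of "integral {a..p} ?f" "integral {p..q} ?f"] by simp
  then show ?thesis using L R M by linarith
qed

text \<open>The exponential sum with coefficients \<open>c\<close> and exponents \<open>\<nu>\<close>, hit by the product of the
  operators \<open>D - l\<close> for \<open>l\<close> in \<open>ls\<close>.\<close>

definition exp_sum_op :: "'a set \<Rightarrow> ('a \<Rightarrow> real) \<Rightarrow> ('a \<Rightarrow> real) \<Rightarrow> real list \<Rightarrow> real \<Rightarrow> real" where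
  "exp_sum_op Z c \<nu> ls x = (\<Sum>n\<in>Z. c n * (\<Prod>l\<leftarrow>ls. \<nu> n - l) * exp (\<nu> n * x))"

lemma continuous_on_exp_sum_op: "continuous_on S (exp_sum_op Z c \<nu> ls)"
  unfolding exp_sum_op_def by (intro continuous_intros)

text \<open>The splitting \<open>D = l + (D - l)\<close> brings the sum into the form
  \<open>g' = l * g + h\<close> that \<open>twisted_derivative_lower_bound\<close> works
  with.\<close>

lemma DERIV_exp_sum_op:
  "(exp_sum_op Z c \<nu> ls has_real_derivative
     (l * exp_sum_op Z c \<nu> ls x + exp_sum_op Z c \<nu> (l # ls) x)) (at x)"
proof -
  have "l * exp_sum_op Z c \<nu> ls x + exp_sum_op Z c \<nu> (l # ls) x =
    (\<Sum>n\<in>Z. c n * (\<Prod>l\<leftarrow>ls. \<nu> n - l) * (exp (\<nu> n * x) * \<nu> n))"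
    unfolding exp_sum_op_def sum_distrib_left sum.distrib[symmetric]
    by (intro sum.cong) (auto simp: algebra_simps)
  then show ?thesis unfolding exp_sum_op_def
    by (auto intro!: derivative_eq_intros sum.cong simp: ac_simps)
qed

text \<open>Induction on the list. Undoing one operator weakens the lower bound \<open>\<mu>\<close>
  to \<open>\<mu> * \<delta> / E\<close> away from one point; the interval of radius
  \<open>\<delta>\<close> around that point is estimated trivially, and two pieces remain, which
  explains the factor 4 per step. The list is nonempty because the last operator also supplies the
  monotonicity demanded by the first derivative test.\<close>

lemma exp_sum_phase_integral_aux:
  assumes E: "\<And>l. l \<in> set ls \<Longrightarrow> l \<ge> 0 \<and> exp (l * (B - A)) \<le> E" and E1: "E \<ge> 1" and d: "\<delta> > 0"
    and der: "\<And>x. x \<in> {A..B} \<Longrightarrow> (\<phi> has_real_derivative exp_sum_op Z c \<nu> [] x) (at x)"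
    and ls: "ls \<noteq> []" and ab: "A \<le> a" "a \<le> b" "b \<le> B" and lam: "\<mu> > 0"
    and big: "\<And>x. x \<in> {a..b} \<Longrightarrow> \<mu> \<le> \<bar>exp_sum_op Z c \<nu> ls x\<bar>"
  shows "norm (integral {a..b} (\<lambda>x. cis (\<phi> x))) \<le>
    4 ^ length ls * (\<delta> + 16 * E ^ (length ls + 1) / (\<mu> * \<delta> ^ length ls))"
  using E ls ab lam big
proof (induction ls arbitrary: a b \<mu>)
  case Nil
  then show ?case by simp
next
  case (Cons l ls)
  have c\<phi>: "continuous_on {a..b} \<phi>"
    using der Cons.prems by (intro continuous_at_imp_continuous_on ballI DERIV_isCont[OF der]) auto
  have l0: "l \<ge> 0" using Cons.prems by auto
  have El: "exp (l * (q - p)) \<le> E" if "A \<le> p" "q \<le> B" for p q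
  proof -
    have "l * (q - p) \<le> l * (B - A)" using that l0 by (intro mult_left_mono) auto
    then show ?thesis using Cons.prems(1)[of l] by (auto intro: order_trans)
  qed
  have tw: "(mono_on {a..b} (\<lambda>x. exp (- l * x) * exp_sum_op Z c \<nu> ls x) \<or>
      antimono_on {a..b} (\<lambda>x. exp (- l * x) * exp_sum_op Z c \<nu> ls x)) \<and>
    (\<exists>c'\<in>{a..b}. \<forall>x\<in>{a..b}. \<mu> * \<bar>x - c'\<bar> / E \<le> \<bar>exp_sum_op Z c \<nu> ls x\<bar>)"
    using Cons.prems l0 El
    by (intro twisted_derivative_lower_bound[where h = "exp_sum_op Z c \<nu> (l # ls)"] DERIV_exp_sum_op
        continuous_on_exp_sum_op) auto
  then obtain c' where c': "\<And>x. x \<in> {a..b} \<Longrightarrow> \<mu> * \<bar>x - c'\<bar> / E \<le> \<bar>exp_sum_op Z c \<nu> ls x\<bar>" by blast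
  have c'': "\<mu> * \<delta> / E \<le> \<bar>exp_sum_op Z c \<nu> ls x\<bar>" if "x \<in> {a..b}" "\<delta> \<le> \<bar>x - c'\<bar>" for x
  proof -
    have "\<mu> * \<delta> / E \<le> \<mu> * \<bar>x - c'\<bar> / E"
      using that Cons.prems E1 by (intro divide_right_mono mult_left_mono) auto
    then show ?thesis using c'[OF that(1)] by simp
  qed
  have lp: "\<mu> * \<delta> / E > 0" using Cons.prems d E1 by auto
  let ?n = "length ls"
  define K where "K = 4 ^ ?n * (\<delta> + 16 * E ^ (?n + 2) / (\<mu> * \<delta> ^ (?n + 1)))"
  have K0: "K \<ge> 0" using Cons.prems E1 d by (auto simp: K_def intro!: divide_nonneg_nonneg add_nonneg_nonneg)
  have dK: "\<delta> \<le> K"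
  proof -
    have "1 * \<delta> \<le> 4 ^ ?n * \<delta>" using d by (intro mult_right_mono) auto
    also have "\<dots> \<le> K" unfolding K_def using Cons.prems E1 d by (intro mult_left_mono) auto
    finally show ?thesis by simp
  qed
  have "norm (integral {a..b} (\<lambda>x. cis (\<phi> x))) \<le> 2 * \<delta> + 2 * K"
  proof (rule integral_split_around_point[OF Cons.prems(4) d K0 c\<phi>])
    fix p q assume pq: "a \<le> p" "p \<le> q" "q \<le> b" "\<And>x. x \<in> {p..q} \<Longrightarrow> \<delta> \<le> \<bar>x - c'\<bar>"
    have big': "\<mu> * \<delta> / E \<le> \<bar>exp_sum_op Z c \<nu> ls x\<bar>" if "x \<in> {p..q}" for x
      using c''[of x] pq that by auto
    show "norm (integral {p..q} (\<lambda>x. cis (\<phi> x))) \<le> K"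
    proof (cases "ls = []")
      case True
      have "norm (integral {p..q} (\<lambda>x. cis (\<phi> x))) \<le> 16 * E / (\<mu> * \<delta> / E)"
      proof (rule first_derivative_test[where l = l and g = "exp_sum_op Z c \<nu> []"])
        show "mono_on {p..q} (\<lambda>x. exp (- l * x) * exp_sum_op Z c \<nu> [] x) \<or>
          antimono_on {p..q} (\<lambda>x. exp (- l * x) * exp_sum_op Z c \<nu> [] x)"
          using tw pq unfolding True
          by (meson atLeastatMost_subset_iff monotone_on_subset)
      qed (use pq Cons.prems l0 El lp big' der True in \<open>auto intro!: continuous_on_exp_sum_op\<close>)
      also have "\<dots> \<le> K" using d E1 Cons.prems by (simp add: K_def True power2_eq_square)
      finally show ?thesis .
    next
      case False
      have "norm (integral {p..q} (\<lambda>x. cis (\<phi> x))) \<le>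
        4 ^ ?n * (\<delta> + 16 * E ^ (?n + 1) / (\<mu> * \<delta> / E * \<delta> ^ ?n))"
        by (rule Cons.IH) (use Cons.prems False pq lp big' in auto)
      also have "\<dots> = K" using d E1 Cons.prems by (simp add: K_def field_simps)
      finally show ?thesis .
    qed
  qed
  also have "\<dots> \<le> 4 * K" using dK by simp
  also have "\<dots> = 4 ^ length (l # ls) * (\<delta> + 16 * E ^ (length (l # ls) + 1) / (\<mu> * \<delta> ^ length (l # ls)))"
    by (simp add: K_def)
  finally show ?case .
qed

text \<open>Choosing \<open>ls\<close> to be all exponents but one leaves a single exponential, which cannot vanish.\<close>

lemma exp_sum_phase_integral:
  assumes Z: "finite Z" "card Z = k" "k \<ge> 2" "n0 \<in> Z" and AB: "A \<le> B"
    and E: "\<And>n. n \<in> Z \<Longrightarrow> \<nu> n \<ge> 0 \<and> exp (\<nu> n * (B - A)) \<le> E" and E1: "E \<ge> 1"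
    and der: "\<And>x. x \<in> {A..B} \<Longrightarrow> (\<phi> has_real_derivative (\<Sum>n\<in>Z. c n * exp (\<nu> n * x))) (at x)"
    and lam: "\<mu> > 0" and big: "\<mu> \<le> \<bar>c n0\<bar> * exp (\<nu> n0 * A) * (\<Prod>n\<in>Z - {n0}. \<bar>\<nu> n0 - \<nu> n\<bar>)"
  shows "norm (integral {A..B} (\<lambda>x. cis (\<phi> x))) \<le> 17 * 4 ^ k * E * \<mu> powr (- 1 / k)"
proof -
  obtain ns where ns: "set ns = Z - {n0}" "distinct ns"
    using finite_distinct_list[of "Z - {n0}"] Z by auto
  define ls where "ls = map \<nu> ns"
  have len: "length ls + 1 = k" using distinct_card[OF ns(2)] ns(1) Z by (auto simp: ls_def)
  have prod_ls: "(\<Prod>l\<leftarrow>ls. \<nu> n - l) = (\<Prod>m\<in>Z - {n0}. \<nu> n - \<nu> m)" for n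
    using ns by (simp add: ls_def o_def prod.distinct_set_conv_list[symmetric])
  have eq: "exp_sum_op Z c \<nu> ls x = c n0 * (\<Prod>m\<in>Z - {n0}. \<nu> n0 - \<nu> m) * exp (\<nu> n0 * x)" for x
  proof -
    have "exp_sum_op Z c \<nu> ls x = (\<Sum>n\<in>{n0}. c n * (\<Prod>m\<in>Z - {n0}. \<nu> n - \<nu> m) * exp (\<nu> n * x))"
      unfolding exp_sum_op_def prod_ls
    proof (rule sum.mono_neutral_right)
      show "\<forall>n\<in>Z - {n0}. c n * (\<Prod>m\<in>Z - {n0}. \<nu> n - \<nu> m) * exp (\<nu> n * x) = 0"
        using Z by (auto simp: prod_zero_iff)
    qed (use Z in auto)
    then show ?thesis by simp
  qed
  have big': "\<mu> \<le> \<bar>exp_sum_op Z c \<nu> ls x\<bar>" if "x \<in> {A..B}" for x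
  proof -
    have "\<nu> n0 * A \<le> \<nu> n0 * x" using E[OF Z(4)] that by (intro mult_left_mono) auto
    then have "\<bar>c n0\<bar> * (\<Prod>n\<in>Z - {n0}. \<bar>\<nu> n0 - \<nu> n\<bar>) * exp (\<nu> n0 * A) \<le>
      \<bar>c n0\<bar> * (\<Prod>n\<in>Z - {n0}. \<bar>\<nu> n0 - \<nu> n\<bar>) * exp (\<nu> n0 * x)"
      by (intro mult_left_mono mult_nonneg_nonneg prod_nonneg) auto
    then show ?thesis using big by (simp add: eq abs_mult abs_prod mult_ac)
  qed
  \<comment> \<open>This value balances the two summands of the bound:
    \<open>\<delta> ^ k = E ^ k / \<mu>\<close> makes the second one equal to
    \<open>16 * \<delta>\<close>.\<close>
  define \<delta> where "\<delta> = E * \<mu> powr (- 1 / k)"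
  have d: "\<delta> > 0" using lam E1 by (auto simp: \<delta>_def)
  have "norm (integral {A..B} (\<lambda>x. cis (\<phi> x))) \<le>
    4 ^ length ls * (\<delta> + 16 * E ^ (length ls + 1) / (\<mu> * \<delta> ^ length ls))"
  proof (rule exp_sum_phase_integral_aux[where B = B and A = A and Z = Z and c = c and \<nu> = \<nu>])
    show "\<And>l. l \<in> set ls \<Longrightarrow> 0 \<le> l \<and> exp (l * (B - A)) \<le> E" using E ns by (auto simp: ls_def)
    show "ls \<noteq> []" using len Z by auto
    show "\<And>x. x \<in> {A..B} \<Longrightarrow> (\<phi> has_real_derivative exp_sum_op Z c \<nu> [] x) (at x)"
      using der by (simp add: exp_sum_op_def)
  qed (use AB d E1 lam big' in auto)
  also have "16 * E ^ (length ls + 1) / (\<mu> * \<delta> ^ length ls) = 16 * \<delta>"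
  proof -
    have "\<delta> ^ k = E ^ k * (\<mu> powr (- 1 / k)) ^ k" by (simp add: \<delta>_def power_mult_distrib)
    also have "(\<mu> powr (- 1 / k)) ^ k = \<mu> powr (- 1)"
      using Z lam by (subst powr_realpow[symmetric]) (auto simp: powr_powr)
    finally have dk: "\<delta> ^ k = E ^ k / \<mu>" using lam by (simp add: powr_minus_divide)
    have "\<delta> ^ k = \<delta> * \<delta> ^ length ls" using len by (metis Suc_eq_plus1 power_Suc)
    then have "E ^ k = \<mu> * (\<delta> * \<delta> ^ length ls)" using dk lam by (simp add: field_simps)
    then show ?thesis using len lam d by simp
  qed
  also have "4 ^ length ls * (\<delta> + 16 * \<delta>) \<le> 4 ^ k * (17 * \<delta>)"
    using len d by (intro mult_mono power_increasing) auto
  finally show ?thesis by (simp add: \<delta>_def)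
qed

section \<open>Trigonometric windows\<close>

text \<open>Multiples of \<open>cos (pi * t) ^ (2 * H)\<close> form an approximate identity made of nonnegative
  trigonometric polynomials.\<close>

definition cos_kernel :: "nat \<Rightarrow> real \<Rightarrow> real" where
  "cos_kernel H t = 4 ^ H / real ((2 * H) choose H) * cos (pi * t) ^ (2 * H)"

text \<open>The convolution of the kernel with the indicator function of \<open>{a..b}\<close>: a
  smooth, 1-periodic substitute for the condition that \<open>y\<close> lies in
  \<open>{a..b}\<close> modulo 1.\<close>

definition window :: "nat \<Rightarrow> real \<Rightarrow> real \<Rightarrow> real \<Rightarrow> real" where
  "window H a b y = integral {a..b} (\<lambda>z. cos_kernel H (y - z))"

text \<open>The Fourier coefficient of \<open>window\<close> at frequency \<open>j\<close>, for
  \<open>j\<close> between \<open>- H\<close> and \<open>H\<close>; below \<open>- H\<close> the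
  truncation in \<open>nat\<close> would give the numerator 1 and not 0.\<close>

definition window_coeff :: "nat \<Rightarrow> real \<Rightarrow> real \<Rightarrow> int \<Rightarrow> complex" where
  "window_coeff H a b j = of_real (real ((2 * H) choose nat (int H + j)) / real ((2 * H) choose H)) *
     integral {a..b} (\<lambda>z. cis (- (2 * pi * of_int j * z)))"

text \<open>Binomial expansion of \<open>(cis (pi * t) + cis (- (pi * t))) ^ (2 * H)\<close>. The
  even exponent makes all frequencies integers, the half-integers \<open>k / 2\<close> and
  \<open>- (2 * H - k) / 2\<close> adding up to \<open>k - H\<close>.\<close>

lemma cos_kernel_expansion:
  "complex_of_real (cos_kernel H t) = (\<Sum>j\<in>{- int H..int H}.
     of_real (real ((2 * H) choose nat (int H + j)) / real ((2 * H) choose H)) * cis (2 * pi * of_int j * t))"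
proof -
  have c: "complex_of_real (2 * cos (pi * t)) = cis (pi * t) + cis (- (pi * t))"
    by (simp add: complex_eq_iff)
  have "complex_of_real (4 ^ H * cos (pi * t) ^ (2 * H)) = complex_of_real (2 * cos (pi * t)) ^ (2 * H)"
    by (simp add: power_mult power_mult_distrib)
  also have "\<dots> = (\<Sum>k\<le>2 * H. of_nat ((2 * H) choose k) * cis (pi * t) ^ k * cis (- (pi * t)) ^ (2 * H - k))"
    unfolding c binomial_ring ..
  also have "\<dots> = (\<Sum>k\<le>2 * H. of_nat ((2 * H) choose k) * cis (2 * pi * of_int (int k - int H) * t))"
  proof (intro sum.cong refl)
    fix k assume "k \<in> {..2 * H}"
    then have "real k * (pi * t) + real (2 * H - k) * (- (pi * t)) = 2 * pi * of_int (int k - int H) * t"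
      by (simp add: of_nat_diff algebra_simps)
    moreover have "cis (pi * t) ^ k * cis (- (pi * t)) ^ (2 * H - k) =
        cis (real k * (pi * t) + real (2 * H - k) * (- (pi * t)))"
      by (simp only: Complex.DeMoivre cis_mult)
    ultimately have "cis (pi * t) ^ k * cis (- (pi * t)) ^ (2 * H - k) = cis (2 * pi * of_int (int k - int H) * t)"
      by simp
    then show "of_nat ((2 * H) choose k) * cis (pi * t) ^ k * cis (- (pi * t)) ^ (2 * H - k) =
      of_nat ((2 * H) choose k) * cis (2 * pi * of_int (int k - int H) * t)"
      by (simp only: mult.assoc)
  qed
  also have "\<dots> = (\<Sum>j\<in>{- int H..int H}. of_nat ((2 * H) choose nat (int H + j)) * cis (2 * pi * of_int j * t))"
    by (rule sum.reindex_bij_witness[of _ "\<lambda>j. nat (int H + j)" "\<lambda>k. int k - int H"]) auto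
  finally have "complex_of_real (cos_kernel H t) = (\<Sum>j\<in>{- int H..int H}.
    of_nat ((2 * H) choose nat (int H + j)) * cis (2 * pi * of_int j * t)) / of_nat ((2 * H) choose H)"
    by (simp add: cos_kernel_def)
  then show ?thesis by (simp add: sum_divide_distrib)
qed

lemma cos_kernel_integrable: "(\<lambda>z. cos_kernel H (y - z)) integrable_on {a..b}"
  unfolding cos_kernel_def by (intro integrable_continuous_real continuous_intros)

lemma window_expansion:
  "complex_of_real (window H a b y) =
     (\<Sum>j\<in>{- int H..int H}. window_coeff H a b j * cis (2 * pi * of_int j * y))"
proof -
  have "complex_of_real (window H a b y) = integral {a..b} (\<lambda>z. complex_of_real (cos_kernel H (y - z)))"
    using integral_linear[OF cos_kernel_integrable bounded_linear_of_real[where 'a = complex]] by (simp add: window_def o_def)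
  also have "\<dots> = (\<Sum>j\<in>{- int H..int H}. integral {a..b} (\<lambda>z. of_real (real ((2 * H) choose nat (int H + j)) / real ((2 * H) choose H)) *
      cis (2 * pi * of_int j * (y - z))))"
    unfolding cos_kernel_expansion
    by (intro integral_sum integrable_continuous_real continuous_intros) auto
  also have "\<dots> = (\<Sum>j\<in>{- int H..int H}. window_coeff H a b j * cis (2 * pi * of_int j * y))"
  proof (intro sum.cong refl)
    fix j :: int
    have "cis (2 * pi * of_int j * (y - z)) = cis (- (2 * pi * of_int j * z)) * cis (2 * pi * of_int j * y)" for z
      by (simp add: cis_mult algebra_simps)
    then show "integral {a..b} (\<lambda>z. of_real (real ((2 * H) choose nat (int H + j)) / real ((2 * H) choose H)) *
      cis (2 * pi * of_int j * (y - z))) = window_coeff H a b j * cis (2 * pi * of_int j * y)"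
      by (simp add: window_coeff_def)
  qed
  finally show ?thesis .
qed

lemma window_coeff_0: "a \<le> b \<Longrightarrow> window_coeff H a b 0 = of_real (b - a)"
  by (simp add: window_coeff_def scaleR_conv_of_real)

lemma has_vector_derivative_cis_multiple:
  assumes "j \<noteq> 0"
  shows "((\<lambda>z. \<i> * cis (- (2 * pi * of_int j * z)) / (2 * pi * of_int j)) has_vector_derivative
    cis (- (2 * pi * of_int j * z))) (at z within S)"
  using assms unfolding has_vector_derivative_complex_iff
  by (auto intro!: derivative_eq_intros simp: field_simps)

lemma norm_window_coeff:
  assumes "a \<le> b"
  shows "norm (window_coeff H a b j) \<le> b - a"
    and "j \<noteq> 0 \<Longrightarrow> norm (window_coeff H a b j) \<le> 1 / \<bar>of_int j\<bar>"
proof -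
  let ?r = "real ((2 * H) choose nat (int H + j)) / real ((2 * H) choose H)"
  have r: "0 \<le> ?r" "?r \<le> 1" using binomial_maximum'[of H "nat (int H + j)"] by (auto simp: divide_le_eq_1)
  have n: "norm (window_coeff H a b j) \<le> K" if "norm (integral {a..b} (\<lambda>z. cis (- (2 * pi * of_int j * z)))) \<le> K" for K
  proof -
    have "norm (window_coeff H a b j) = ?r * norm (integral {a..b} (\<lambda>z. cis (- (2 * pi * of_int j * z))))"
      using r(1) by (simp only: window_coeff_def norm_mult norm_of_real abs_of_nonneg)
    also have "\<dots> \<le> 1 * K" using r that by (intro mult_mono) auto
    finally show ?thesis by simp
  qed
  show "norm (window_coeff H a b j) \<le> b - a"
    by (intro n norm_integral_cis_le continuous_intros assms)
  assume j: "j \<noteq> 0"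
  have "((\<lambda>z. cis (- (2 * pi * of_int j * z))) has_integral
    (\<i> * cis (- (2 * pi * of_int j * b)) / (2 * pi * of_int j) -
     \<i> * cis (- (2 * pi * of_int j * a)) / (2 * pi * of_int j))) {a..b}"
    by (intro fundamental_theorem_of_calculus assms has_vector_derivative_cis_multiple j)
  then have "norm (integral {a..b} (\<lambda>z. cis (- (2 * pi * of_int j * z)))) =
    norm (\<i> * cis (- (2 * pi * of_int j * b)) / (2 * pi * of_int j) -
     \<i> * cis (- (2 * pi * of_int j * a)) / (2 * pi * of_int j))"
    by (simp add: integral_unique)
  also have "\<dots> \<le> 1 / (2 * pi * \<bar>of_int j\<bar>) + 1 / (2 * pi * \<bar>of_int j\<bar>)"
    by (rule order_trans[OF norm_triangle_ineq4]) (simp add: norm_divide norm_mult)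
  also have "\<dots> = 1 / (pi * \<bar>of_int j\<bar>)" by (simp add: field_simps)
  also have "\<dots> \<le> 1 / (1 * \<bar>of_int j\<bar>)"
    using j pi_gt3 by (intro divide_left_mono mult_right_mono) auto
  finally show "norm (window_coeff H a b j) \<le> 1 / \<bar>of_int j\<bar>" by (intro n) simp
qed

lemma sum_inverse_abs_int: "(\<Sum>j\<in>{- int H..int H} - {0}. 1 / \<bar>real_of_int j\<bar>) = 2 * harm H"
proof -
  have "(\<Sum>j\<in>{- int H..int H} - {0}. 1 / \<bar>real_of_int j\<bar>) =
    (\<Sum>j\<in>{1..int H} \<union> {- int H..-1}. 1 / \<bar>real_of_int j\<bar>)"
    by (intro sum.cong) auto
  also have "\<dots> = (\<Sum>j\<in>{1..int H}. 1 / \<bar>real_of_int j\<bar>) + (\<Sum>j\<in>{- int H..-1}. 1 / \<bar>real_of_int j\<bar>)"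
    by (rule sum.union_disjoint) auto
  also have "(\<Sum>j\<in>{- int H..-1}. 1 / \<bar>real_of_int j\<bar>) = (\<Sum>j\<in>{1..int H}. 1 / \<bar>real_of_int j\<bar>)"
    by (rule sum.reindex_bij_witness[of _ uminus uminus]) auto
  also have "(\<Sum>j\<in>{1..int H}. 1 / \<bar>real_of_int j\<bar>) = harm H"
    unfolding harm_def by (rule sum.reindex_bij_witness[of _ int nat]) (auto simp: field_simps)
  finally show ?thesis by simp
qed

lemma sum_norm_window_coeff_le:
  assumes "a \<le> b" "b - a \<le> 1"
  shows "(\<Sum>j\<in>{- int H..int H}. norm (window_coeff H a b j)) \<le> 1 + 2 * harm H"
proof -
  have "(\<Sum>j\<in>{- int H..int H}. norm (window_coeff H a b j)) =
    norm (window_coeff H a b 0) + (\<Sum>j\<in>{- int H..int H} - {0}. norm (window_coeff H a b j))"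
    by (rule sum.remove) auto
  also have "\<dots> \<le> 1 + (\<Sum>j\<in>{- int H..int H} - {0}. 1 / \<bar>real_of_int j\<bar>)"
    using assms norm_window_coeff[OF assms(1)]
    by (intro add_mono sum_mono) (auto simp: window_coeff_0 simp flip: of_real_diff)
  finally show ?thesis by (simp add: sum_inverse_abs_int)
qed

text \<open>Interpolation between the two bounds of \<open>norm_window_coeff\<close>: the power
  \<theta> of the trivial one and the power \<open>1 - \<theta>\<close> of the decaying one. A decay
  in the frequency is thereby exchanged for a power of the window length, up to a logarithm. For
  windows of length about \<open>1 / N\<close> this is the saving that comes from coefficients of
  typical size \<open>N\<close>.\<close>

lemma sum_norm_window_coeff_weighted_le:
  assumes "a < b" "0 < \<theta>" "\<theta> \<le> 1"
  shows "(\<Sum>j\<in>{- int H..int H} - {0}. norm (window_coeff H a b j) * \<bar>of_int j\<bar> powr (- \<theta>)) \<le>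
    (b - a) powr \<theta> * (1 + 2 * harm H)"
proof -
  have "norm (window_coeff H a b j) * \<bar>of_int j\<bar> powr (- \<theta>) \<le> (b - a) powr \<theta> * (1 / \<bar>of_int j\<bar>)"
    if j: "j \<noteq> 0" for j :: int
  proof -
    let ?x = "norm (window_coeff H a b j)"
    have "?x = ?x powr \<theta> * ?x powr (1 - \<theta>)" by (cases "?x = 0") (auto simp flip: powr_add)
    also have "\<dots> \<le> (b - a) powr \<theta> * (1 / \<bar>of_int j\<bar>) powr (1 - \<theta>)"
      using norm_window_coeff[of a b] assms j by (intro mult_mono powr_mono2) auto
    finally have "?x * \<bar>of_int j\<bar> powr (- \<theta>) \<le>
      (b - a) powr \<theta> * (1 / \<bar>of_int j\<bar>) powr (1 - \<theta>) * \<bar>of_int j\<bar> powr (- \<theta>)"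
      by (intro mult_right_mono) auto
    also have "\<dots> = (b - a) powr \<theta> * (1 / \<bar>of_int j\<bar>)"
      using j by (simp add: powr_divide powr_diff powr_minus field_simps)
    finally show ?thesis .
  qed
  then have "(\<Sum>j\<in>{- int H..int H} - {0}. norm (window_coeff H a b j) * \<bar>of_int j\<bar> powr (- \<theta>)) \<le>
    (\<Sum>j\<in>{- int H..int H} - {0}. (b - a) powr \<theta> * (1 / \<bar>of_int j\<bar>))"
    by (intro sum_mono) auto
  also have "\<dots> = (b - a) powr \<theta> * (2 * harm H)"
    by (simp only: sum_distrib_left[symmetric] sum_inverse_abs_int)
  also have "\<dots> \<le> (b - a) powr \<theta> * (1 + 2 * harm H)" by (intro mult_left_mono) auto
  finally show ?thesis .
qed

section \<open>Windows as approximate indicator functions of arcs\<close>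

lemma cos_kernel_nonneg: "0 \<le> cos_kernel H t"
  by (simp add: cos_kernel_def zero_le_even_power)

lemma window_nonneg: "0 \<le> window H a b y"
  unfolding window_def by (intro integral_nonneg cos_kernel_integrable cos_kernel_nonneg)

text \<open>Over a full period all nonzero frequencies integrate to 0, and the kernel is normalized
  to have mean 1.\<close>

lemma window_period: "window H a (a + 1) y = 1"
proof -
  have "integral {a..a + 1} (\<lambda>z. cis (- (2 * pi * of_int j * z))) = 0" if j: "j \<noteq> 0" for j
  proof -
    have "cis (- (2 * pi * of_int j * (a + 1))) = cis (- (2 * pi * of_int j * a)) * cis (2 * pi * of_int (- j))"
      by (simp add: cis_mult algebra_simps)
    also have "cis (2 * pi * of_int (- j)) = 1" by (rule cis_multiple_2pi) auto
    finally have "cis (- (2 * pi * of_int j * (a + 1))) = cis (- (2 * pi * of_int j * a))" by simp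
    then have "((\<lambda>z. cis (- (2 * pi * of_int j * z))) has_integral 0) {a..a+1}"
      using fundamental_theorem_of_calculus[OF _ has_vector_derivative_cis_multiple[OF j], of a "a + 1"] by simp
    then show ?thesis by blast
  qed
  then have "window_coeff H a (a + 1) j = (if j = 0 then 1 else 0)" for j
    using window_coeff_0[of a "a + 1" H] by (auto simp: window_coeff_def)
  then have "complex_of_real (window H a (a + 1) y) = (\<Sum>j\<in>{- int H..int H}. if j = 0 then 1 else 0)"
    unfolding window_expansion by (intro sum.cong) auto
  also have "\<dots> = 1" by (simp add: sum.delta)
  finally show ?thesis by (metis of_real_eq_1_iff)
qed

lemma window_split:
  assumes "a \<le> b" "b \<le> c"
  shows "window H a b y + window H b c y = window H a c y"
  unfolding window_def
  by (rule Henstock_Kurzweil_Integration.integral_combine[OF assms cos_kernel_integrable])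

lemma window_le_1: "a \<le> b \<Longrightarrow> b \<le> a + 1 \<Longrightarrow> window H a b y \<le> 1"
  using window_split[of a b "a + 1" H y] window_nonneg[of H b "a + 1" y] by (simp add: window_period)

text \<open>Reduce to the distance \<open>x \<le> 1 / 2\<close> from the nearest integer. There
  \<open>u = pi * x\<close> is at most 2, so
  \<open>sin u \<ge> u - u ^ 3 / 6 \<ge> u / 3 \<ge> x\<close>, and the squared cosine is at most
  \<open>1 - \<delta> ^ 2\<close>.\<close>

lemma cos_pi_bound:
  assumes "\<delta> > 0" and far: "\<And>n::int. \<delta> \<le> \<bar>t - of_int n\<bar>"
  shows "(cos (pi * t))\<^sup>2 \<le> exp (- \<delta>\<^sup>2)"
proof -
  define n where "n = round t"
  define x where "x = \<bar>t - of_int n\<bar>"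
  have x: "\<delta> \<le> x" "x \<le> 1 / 2"
    using far[of n] of_int_round_abs_le[of t] by (auto simp: x_def n_def abs_minus_commute)
  have "pi * x \<le> pi * (1 / 2)" using x by (intro mult_left_mono) auto
  then have px2: "pi * x \<le> 2" using pi_less_4 by linarith
  have px: "0 \<le> pi * x" using x assms by simp
  have "pi * x - sin (pi * x) \<le> \<bar>sin (pi * x) - (\<Sum>m<3. sin_coeff m * (pi * x) ^ m)\<bar>"
    by (simp add: eval_nat_numeral sin_coeff_def)
  also have "\<dots> \<le> inverse (fact 3) * \<bar>pi * x\<bar> ^ 3" by (rule Maclaurin_sin_bound)
  also have "\<dots> = (pi * x) * ((pi * x) ^ 2 / 6)" using px by (simp add: eval_nat_numeral)
  also have "\<dots> \<le> (pi * x) * (2 ^ 2 / 6)" using px px2 by (intro mult_left_mono divide_right_mono power_mono) auto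
  finally have "pi * x / 3 \<le> sin (pi * x)" by simp
  moreover have "x * 3 \<le> pi * x" using mult_right_mono[of 3 pi x] x assms pi_gt3 by (simp add: mult.commute)
  ultimately have s: "\<delta> \<le> sin (pi * x)" using x by simp
  have "(sin (pi * t))\<^sup>2 = (sin (pi * x))\<^sup>2"
  proof -
    have "sin (pi * t) = sin (pi * (t - of_int n) + pi * of_int n)" by (simp add: algebra_simps)
    also have "\<dots> = sin (pi * (t - of_int n)) * cos (pi * of_int n)" by (simp add: sin_add)
    finally have "(sin (pi * t))\<^sup>2 = (sin (pi * (t - of_int n)))\<^sup>2 * (cos (pi * of_int n))\<^sup>2"
      by (simp add: power_mult_distrib)
    moreover have "(cos (pi * of_int n))\<^sup>2 = 1"
      using sin_cos_squared_add[of "pi * of_int n"] by simp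
    moreover have "(sin (pi * (t - of_int n)))\<^sup>2 = (sin (pi * x))\<^sup>2"
    proof (cases "t \<ge> of_int n")
      case False
      then have "pi * x = - (pi * (t - of_int n))" by (simp add: x_def algebra_simps)
      then show ?thesis by (simp only: sin_minus power2_minus)
    qed (simp add: x_def)
    ultimately show ?thesis by simp
  qed
  moreover have "\<delta>\<^sup>2 \<le> (sin (pi * x))\<^sup>2" using s assms by (intro power_mono) auto
  ultimately have "(cos (pi * t))\<^sup>2 \<le> 1 - \<delta>\<^sup>2" using sin_cos_squared_add[of "pi * t"] by linarith
  also have "\<dots> \<le> exp (- \<delta>\<^sup>2)" using exp_ge_add_one_self[of "- \<delta>\<^sup>2"] by simp
  finally show ?thesis .
qed

lemma cos_kernel_far:
  assumes "H > 0" "\<delta> > 0" and far: "\<And>n::int. \<delta> \<le> \<bar>t - of_int n\<bar>"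
  shows "cos_kernel H t \<le> 2 * real H * exp (- (H * \<delta>\<^sup>2))"
proof -
  have "4 ^ H \<le> 2 * real H * real ((2 * H) choose H)"
    using central_binomial_lower_bound[OF assms(1)] assms(1) by (simp add: field_simps)
  then have "4 ^ H / real ((2 * H) choose H) \<le> 2 * real H"
    by (simp add: divide_le_eq zero_less_binomial_iff)
  moreover have "cos (pi * t) ^ (2 * H) \<le> exp (- (H * \<delta>\<^sup>2))"
  proof -
    have "cos (pi * t) ^ (2 * H) \<le> exp (- \<delta>\<^sup>2) ^ H"
      unfolding power_mult by (intro power_mono cos_pi_bound assms) auto
    then show ?thesis by (simp add: exp_of_nat_mult[symmetric])
  qed
  ultimately show ?thesis unfolding cos_kernel_def
    by (intro mult_mono) (auto simp: zero_le_even_power)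
qed

lemma window_far:
  assumes "H > 0" "\<delta> > 0" "a \<le> b" "b \<le> a + 1"
    and far: "\<And>z n::int. z \<in> {a..b} \<Longrightarrow> \<delta> \<le> \<bar>y - z - of_int n\<bar>"
  shows "window H a b y \<le> 2 * real H * exp (- (H * \<delta>\<^sup>2))"
proof -
  have "window H a b y \<le> integral {a..b} (\<lambda>z. 2 * real H * exp (- (H * \<delta>\<^sup>2)))"
    unfolding window_def
    by (intro integral_le cos_kernel_integrable cos_kernel_far assms) auto
  also have "\<dots> \<le> 1 * (2 * real H * exp (- (H * \<delta>\<^sup>2)))"
    using assms by (simp add: mult_left_le_one_le mult_right_le_one_le)
  finally show ?thesis by simp
qed

text \<open>The complementary arc from \<open>b\<close> to \<open>a + 1\<close> is far from
  \<open>y\<close>, and the two windows add up to 1.\<close>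

lemma window_near:
  assumes "H > 0" "\<delta> > 0" "a \<le> b" "b \<le> a + 1" and n: "a + \<delta> \<le> y - of_int n" "y - of_int n \<le> b - \<delta>"
  shows "1 - 2 * real H * exp (- (H * \<delta>\<^sup>2)) \<le> window H a b y"
proof -
  have "window H b (a + 1) y \<le> 2 * real H * exp (- (H * \<delta>\<^sup>2))"
  proof (rule window_far)
    fix z :: real and k :: int assume z: "z \<in> {b..a + 1}"
    consider "k \<ge> n" | "k \<le> n - 1" by linarith
    then show "\<delta> \<le> \<bar>y - z - of_int k\<bar>"
    proof cases
      case 1
      then have "real_of_int n \<le> of_int k" by simp
      then show ?thesis using z n by auto
    next
      case 2
      then have "real_of_int k \<le> of_int n - 1" by linarith
      then show ?thesis using z n by auto
    qed
  qed (use assms in auto)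
  then show ?thesis using window_split[of a b "a + 1" H y] assms by (simp add: window_period)
qed

lemma continuous_on_window: "continuous_on S (window H a b)"
proof -
  have "window H a b = (\<lambda>y. Re (\<Sum>j\<in>{- int H..int H}. window_coeff H a b j * cis (2 * pi * of_int j * y)))"
    unfolding window_expansion[symmetric] by simp
  then show ?thesis by (auto intro!: continuous_intros)
qed

section \<open>Mean values of products over forests of differences\<close>

text \<open>Each \<open>i\<close> in \<open>Q\<close> is a child compared with its parent
  \<open>par i\<close>. In the mean value lemmas parents lie outside \<open>Q\<close>, so the forest
  is a disjoint union of stars.\<close>

definition forest_prod :: "(real \<Rightarrow> real) \<Rightarrow> nat set \<Rightarrow> (nat \<Rightarrow> nat) \<Rightarrow> (nat \<Rightarrow> nat) \<Rightarrow> real \<Rightarrow> real" where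
  "forest_prod w Q par z \<alpha> = (\<Prod>i\<in>Q. w (real (z i) powr \<alpha> - real (z (par i)) powr \<alpha>))"

lemma ln_diff_lower_bound:
  assumes "0 < x" "0 < y" "x \<le> N" "y \<le> (N::real)"
  shows "\<bar>x - y\<bar> / N \<le> \<bar>ln x - ln y\<bar>"
proof -
  have *: "(x - y) / N \<le> ln x - ln y" if "0 < y" "y \<le> x" "x \<le> N" for x y
  proof -
    have "(x - y) / N \<le> (x - y) / x" using that by (intro divide_left_mono) auto
    also have "\<dots> = 1 - y / x" using that by (simp add: field_simps)
    also have "\<dots> \<le> - ln (y / x)" using ln_le_minus_one[of "y / x"] that by simp
    also have "\<dots> = ln x - ln y" using that by (simp add: ln_div)
    finally show ?thesis .
  qed
  show ?thesis using *[of x y] *[of y x] assms by (cases "y \<le> x") (auto simp: abs_if)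
qed

text \<open>The point \<open>z j\<close> carries the exponential with exponent
  \<open>ln (z j)\<close>. As parents lie outside \<open>Q\<close>, the coefficient at the child
  \<open>i\<close> is \<open>u i\<close> alone, so singling out this exponential gives an explicit
  \<open>\<mu>\<close>. Its power \<open>- 1 / k\<close> splits into the factors of the
  bound.\<close>

lemma power_phase_integral:
  fixes z :: "nat \<Rightarrow> nat" and u :: "nat \<Rightarrow> int"
  assumes k: "k \<ge> 2" and z: "inj_on z {..<k}" "\<And>i. i < k \<Longrightarrow> z i \<in> S"
    and S: "\<And>n. n \<in> S \<Longrightarrow> 3 \<le> n \<and> N1 \<le> real n \<and> real n \<le> N" and N1: "N1 \<ge> 1"
    and A: "0 \<le> A" "A \<le> B" and E: "N powr (B - A) \<le> E"
    and Q: "Q \<subseteq> {..<k}" "\<And>i. i \<in> Q \<Longrightarrow> par i < k \<and> par i \<notin> Q"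
    and i: "i \<in> Q" "u i \<noteq> 0"
  shows "norm (integral {A..B} (\<lambda>\<alpha>. cis (2 * pi * (\<Sum>j\<in>Q. of_int (u j) * (real (z j) powr \<alpha> - real (z (par j)) powr \<alpha>)))))
    \<le> 17 * 4 ^ k * E * N1 powr (- A / k) * \<bar>of_int (u i)\<bar> powr (- 1 / k) *
       (\<Prod>q\<in>{..<k} - {i}. (N / \<bar>real (z i) - real (z q)\<bar>) powr (1 / k))"
proof -
  define \<nu> where "\<nu> = (\<lambda>j. ln (real (z j)))"
  \<comment> \<open>The phase regrouped by points: \<open>\<gamma> n\<close> gathers what
    \<open>n\<close> receives as a child and as a parent.\<close>
  define \<gamma> where "\<gamma> = (\<lambda>n. \<Sum>j\<in>Q. of_int (u j) * ((if n = j then 1 else 0) - (if n = par j then 1 else (0::real))))"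
  have fQ: "finite Q" using Q finite_subset by blast
  have ik: "i < k" using i Q by auto
  have zS: "3 \<le> z j" "N1 \<le> real (z j)" "real (z j) \<le> N" if "j < k" for j
    using S[OF z(2)[OF that]] by auto
  have pw: "real (z j) powr \<alpha> = exp (\<nu> j * \<alpha>)" if "j < k" for j \<alpha>
    using zS[OF that] by (simp add: powr_def \<nu>_def mult.commute)
  have N: "N \<ge> 3" using zS[OF ik] by linarith
  have nu1: "1 \<le> \<nu> j" if "j < k" for j
  proof -
    have "exp 1 \<le> real (z j)" using zS(1)[OF that] exp_le by linarith
    then show ?thesis using zS(1)[OF that] by (simp add: \<nu>_def ln_ge_iff)
  qed
  have \<gamma>i: "\<gamma> i = of_int (u i)"
  proof -
    have "\<gamma> i = (\<Sum>j\<in>Q. if i = j then of_int (u j) else 0)"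
      unfolding \<gamma>_def using Q i by (intro sum.cong) auto
    then show ?thesis using i fQ by simp
  qed
  have sw: "(\<Sum>n<k. \<gamma> n * X n) = (\<Sum>j\<in>Q. of_int (u j) * (X j - X (par j)))" for X
  proof -
    have "(\<Sum>n<k. \<gamma> n * X n) = (\<Sum>n<k. \<Sum>j\<in>Q. of_int (u j) * ((if n = j then X n else 0) - (if n = par j then X n else 0)))"
      unfolding \<gamma>_def sum_distrib_right by (intro sum.cong) auto
    also have "\<dots> = (\<Sum>j\<in>Q. \<Sum>n<k. of_int (u j) * ((if n = j then X n else 0) - (if n = par j then X n else 0)))"
      by (rule sum.swap)
    also have "\<dots> = (\<Sum>j\<in>Q. of_int (u j) * (X j - X (par j)))"
      unfolding sum_distrib_left[symmetric] sum_subtractf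
      using Q by (intro sum.cong refl) (auto simp: sum.delta')
    finally show ?thesis .
  qed
  \<comment> \<open>The surviving term at the left end of the interval, with each difference of
    logarithms replaced by the smaller \<open>\<bar>z i - z q\<bar> / N\<close>.\<close>
  define \<mu> where "\<mu> = \<bar>of_int (u i)\<bar> * N1 powr A * (\<Prod>q\<in>{..<k} - {i}. \<bar>real (z i) - real (z q)\<bar> / N)"
  have zne: "real (z i) \<noteq> real (z q)" if "q \<in> {..<k} - {i}" for q
    using z(1) that ik by (auto simp: inj_on_def)
  have mu: "\<mu> > 0" unfolding \<mu>_def using i N1 N zne by (intro mult_pos_pos prod_pos) auto
  have "norm (integral {A..B} (\<lambda>\<alpha>. cis (2 * pi * (\<Sum>n<k. \<gamma> n * exp (\<nu> n * \<alpha>)))))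
    \<le> 17 * 4 ^ k * E * \<mu> powr (- 1 / k)"
  proof (rule exp_sum_phase_integral[where Z = "{..<k}" and \<nu> = \<nu> and c = "\<lambda>n. 2 * pi * \<gamma> n * \<nu> n"])
    show "0 \<le> \<nu> n \<and> exp (\<nu> n * (B - A)) \<le> E" if "n \<in> {..<k}" for n
    proof -
      have "real (z n) powr (B - A) \<le> N powr (B - A)" using zS[of n] that A by (intro powr_mono2) auto
      then show ?thesis using nu1[of n] pw[of n "B - A"] that E by auto
    qed
    have "1 \<le> N powr (B - A)" using N A by (intro ge_one_powr_ge_zero) auto
    then show "1 \<le> E" using E by linarith
    show "((\<lambda>\<alpha>. 2 * pi * (\<Sum>n<k. \<gamma> n * exp (\<nu> n * \<alpha>))) has_real_derivative
      (\<Sum>n<k. 2 * pi * \<gamma> n * \<nu> n * exp (\<nu> n * x))) (at x)" for x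
      by (auto intro!: derivative_eq_intros simp: sum_distrib_left mult_ac)
    show "\<mu> \<le> \<bar>2 * pi * \<gamma> i * \<nu> i\<bar> * exp (\<nu> i * A) * (\<Prod>n\<in>{..<k} - {i}. \<bar>\<nu> i - \<nu> n\<bar>)"
      unfolding \<mu>_def
    proof (intro mult_mono prod_mono conjI)
      have "\<bar>of_int (u i)\<bar> * 1 \<le> \<bar>\<gamma> i\<bar> * (2 * pi * \<nu> i)"
        unfolding \<gamma>i using nu1[OF ik] pi_gt3 mult_mono[of 1 "2 * pi" 1 "\<nu> i"] by (intro mult_left_mono) auto
      then show "\<bar>of_int (u i)\<bar> \<le> \<bar>2 * pi * \<gamma> i * \<nu> i\<bar>"
        using nu1[OF ik] by (simp add: abs_mult mult_ac)
      show "N1 powr A \<le> exp (\<nu> i * A)"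
        unfolding pw[OF ik, symmetric] using N1 A zS[OF ik] by (intro powr_mono2) auto
      fix q assume "q \<in> {..<k} - {i}"
      then have "q < k" by auto
      then show "\<bar>real (z i) - real (z q)\<bar> / N \<le> \<bar>\<nu> i - \<nu> q\<bar>"
        unfolding \<nu>_def using zS[OF ik] zS[of q] by (intro ln_diff_lower_bound) auto
    qed (use N in \<open>auto intro!: prod_nonneg\<close>)
  qed (use k A ik mu in auto)
  moreover have "(\<Sum>j\<in>Q. of_int (u j) * (real (z j) powr \<alpha> - real (z (par j)) powr \<alpha>)) = (\<Sum>n<k. \<gamma> n * exp (\<nu> n * \<alpha>))" for \<alpha>
    unfolding sw using Q by (intro sum.cong) (auto simp: pw)
  moreover have "\<mu> powr (- 1 / k) = N1 powr (- A / k) * \<bar>of_int (u i)\<bar> powr (- 1 / k) *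
       (\<Prod>q\<in>{..<k} - {i}. (N / \<bar>real (z i) - real (z q)\<bar>) powr (1 / k))"
  proof -
    have "(\<Prod>q\<in>{..<k} - {i}. \<bar>real (z i) - real (z q)\<bar> / N) powr (- 1 / k) =
      (\<Prod>q\<in>{..<k} - {i}. (\<bar>real (z i) - real (z q)\<bar> / N) powr (- 1 / k))"
      by (rule prod_powr_distrib)
    also have "\<dots> = (\<Prod>q\<in>{..<k} - {i}. (N / \<bar>real (z i) - real (z q)\<bar>) powr (1 / k))"
    proof (intro prod.cong refl)
      fix q assume q: "q \<in> {..<k} - {i}"
      have "(\<bar>real (z i) - real (z q)\<bar> / N) powr (- (1 / k)) = (N / \<bar>real (z i) - real (z q)\<bar>) powr (1 / k)"
        using N by (simp add: powr_minus powr_divide)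
      then show "(\<bar>real (z i) - real (z q)\<bar> / N) powr (- 1 / k) = (N / \<bar>real (z i) - real (z q)\<bar>) powr (1 / k)"
        by simp
    qed
    finally show ?thesis using N1 N unfolding \<mu>_def
      by (simp add: powr_mult powr_powr prod_nonneg)
  qed
  ultimately show ?thesis by (simp add: mult_ac)
qed

lemma forest_prod_expansion:
  assumes "finite Q"
  shows "complex_of_real (forest_prod (window H a b) Q par z \<alpha>) =
    (\<Sum>u\<in>Q \<rightarrow>\<^sub>E {- int H..int H}. (\<Prod>i\<in>Q. window_coeff H a b (u i)) *
      cis (2 * pi * (\<Sum>j\<in>Q. of_int (u j) * (real (z j) powr \<alpha> - real (z (par j)) powr \<alpha>))))"
proof -
  have "complex_of_real (forest_prod (window H a b) Q par z \<alpha>) =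
    (\<Prod>i\<in>Q. \<Sum>j\<in>{- int H..int H}. window_coeff H a b j * cis (2 * pi * of_int j * (real (z i) powr \<alpha> - real (z (par i)) powr \<alpha>)))"
    unfolding forest_prod_def of_real_prod window_expansion ..
  also have "\<dots> = (\<Sum>u\<in>Q \<rightarrow>\<^sub>E {- int H..int H}. \<Prod>i\<in>Q. window_coeff H a b (u i) *
      cis (2 * pi * of_int (u i) * (real (z i) powr \<alpha> - real (z (par i)) powr \<alpha>)))"
    by (rule prod_sum_PiE) (use assms in auto)
  also have "\<dots> = (\<Sum>u\<in>Q \<rightarrow>\<^sub>E {- int H..int H}. (\<Prod>i\<in>Q. window_coeff H a b (u i)) *
      cis (2 * pi * (\<Sum>j\<in>Q. of_int (u j) * (real (z j) powr \<alpha> - real (z (par j)) powr \<alpha>))))"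
  proof (intro sum.cong refl)
    fix u :: "nat \<Rightarrow> int"
    have "(\<Prod>i\<in>Q. cis (t i)) = cis (\<Sum>i\<in>Q. t i)" for t
      using assms by induction (auto simp: cis_mult)
    then show "(\<Prod>i\<in>Q. window_coeff H a b (u i) *
      cis (2 * pi * of_int (u i) * (real (z i) powr \<alpha> - real (z (par i)) powr \<alpha>))) =
      (\<Prod>i\<in>Q. window_coeff H a b (u i)) *
      cis (2 * pi * (\<Sum>j\<in>Q. of_int (u j) * (real (z j) powr \<alpha> - real (z (par j)) powr \<alpha>)))"
      by (simp add: prod.distrib sum_distrib_left mult_ac)
  qed
  finally show ?thesis .
qed

text \<open>The zero frequency vector gives the main term. Every other one is nonzero at some child
  \<open>i\<close>, and the decay in \<open>u i\<close> is exchanged for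
  \<open>(b - a) powr (1 / k)\<close>; the remaining coordinates contribute logarithmic sums of
  coefficient norms.\<close>

lemma forest_prod_integral:
  fixes z :: "nat \<Rightarrow> nat"
  assumes k: "k \<ge> 2" and z: "inj_on z {..<k}" "\<And>i. i < k \<Longrightarrow> z i \<in> S"
    and S: "\<And>n. n \<in> S \<Longrightarrow> 3 \<le> n \<and> N1 \<le> real n \<and> real n \<le> N" and N1: "N1 \<ge> 1"
    and A: "0 \<le> A" "A \<le> B" and E: "N powr (B - A) \<le> E"
    and Q: "Q \<subseteq> {..<k}" "\<And>i. i \<in> Q \<Longrightarrow> par i < k \<and> par i \<notin> Q"
    and ab: "a < b" "b - a \<le> 1"
  shows "\<bar>integral {A..B} (forest_prod (window H a b) Q par z) - (B - A) * (b - a) ^ card Q\<bar> \<le>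
    17 * 4 ^ k * E * N1 powr (- A / k) * (b - a) powr (1 / k) * (1 + 2 * harm H) ^ k *
      (\<Sum>i<k. \<Prod>q\<in>{..<k} - {i}. (N / \<bar>real (z i) - real (z q)\<bar>) powr (1 / k))"
proof -
  have fQ: "finite Q" using Q finite_subset by blast
  define U where "U = Q \<rightarrow>\<^sub>E {- int H..int H}"
  have fU: "finite U" unfolding U_def using fQ by (intro finite_PiE) auto
  define \<Phi> where "\<Phi> = (\<lambda>u \<alpha>. cis (2 * pi * (\<Sum>j\<in>Q. of_int (u j) * (real (z j) powr \<alpha> - real (z (par j)) powr \<alpha>))))"
  define u0 where "u0 = (\<lambda>i\<in>Q. 0::int)"
  have u0: "u0 \<in> U" by (auto simp: u0_def U_def)
  have zpos: "z j > 0" if "j < k" for j using S[OF z(2)[OF that]] by auto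
  have c\<Phi>: "\<Phi> u integrable_on {A..B}" for u
    unfolding \<Phi>_def using zpos Q by (intro integrable_continuous_real continuous_intros) auto
  define W where "W = 17 * 4 ^ k * E * N1 powr (- A / k)"
  define P where "P = (\<lambda>i. \<Prod>q\<in>{..<k} - {i}. (N / \<bar>real (z i) - real (z q)\<bar>) powr (1 / k))"
  have "1 < k" using k by simp
  have N: "N \<ge> 3" using S[OF z(2)[OF \<open>1 < k\<close>]] by linarith
  have E0: "E \<ge> 0" using E powr_ge_zero[of N "B - A"] by linarith
  have W0: "W \<ge> 0" using E0 by (simp add: W_def)
  have P0: "P i \<ge> 0" for i unfolding P_def by (intro prod_nonneg) auto
  define L :: real where "L = 1 + 2 * harm H"
  have L1: "L \<ge> 1" by (simp add: L_def harm_nonneg)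
  let ?b = "\<lambda>j. window_coeff H a b j"
  have cont: "continuous_on {A..B} (forest_prod (window H a b) Q par z)"
    unfolding forest_prod_def using zpos Q
    by (intro continuous_on_prod continuous_on_compose2[OF continuous_on_window[of UNIV]] continuous_intros) auto
  have "complex_of_real (integral {A..B} (forest_prod (window H a b) Q par z)) =
    integral {A..B} (\<lambda>\<alpha>. complex_of_real (forest_prod (window H a b) Q par z \<alpha>))"
    using integral_linear[OF integrable_continuous_real[OF cont] bounded_linear_of_real[where 'a = complex]]
    by (simp add: o_def)
  also have "\<dots> = integral {A..B} (\<lambda>\<alpha>. \<Sum>u\<in>U. (\<Prod>i\<in>Q. ?b (u i)) * \<Phi> u \<alpha>)"
    unfolding forest_prod_expansion[OF fQ] U_def \<Phi>_def ..
  also have "\<dots> = (\<Sum>u\<in>U. (\<Prod>i\<in>Q. ?b (u i)) * integral {A..B} (\<Phi> u))"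
    using fU c\<Phi> by (subst integral_sum) (auto intro: integrable_on_mult_right)
  also have "\<dots> = (\<Prod>i\<in>Q. ?b (u0 i)) * integral {A..B} (\<Phi> u0) + (\<Sum>u\<in>U - {u0}. (\<Prod>i\<in>Q. ?b (u i)) * integral {A..B} (\<Phi> u))"
    by (rule sum.remove[OF fU u0])
  also have "(\<Prod>i\<in>Q. ?b (u0 i)) * integral {A..B} (\<Phi> u0) = of_real ((B - A) * (b - a) ^ card Q)"
  proof -
    have "(\<Prod>i\<in>Q. ?b (u0 i)) = (\<Prod>i\<in>Q. of_real (b - a))"
      using ab by (intro prod.cong) (auto simp: u0_def window_coeff_0)
    moreover have "\<Phi> u0 = (\<lambda>\<alpha>. 1)" by (simp add: \<Phi>_def u0_def fun_eq_iff)
    ultimately show ?thesis using A by (simp add: scaleR_conv_of_real)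
  qed
  finally have "of_real (integral {A..B} (forest_prod (window H a b) Q par z) - (B - A) * (b - a) ^ card Q) =
    (\<Sum>u\<in>U - {u0}. (\<Prod>i\<in>Q. ?b (u i)) * integral {A..B} (\<Phi> u))" by simp
  then have "\<bar>integral {A..B} (forest_prod (window H a b) Q par z) - (B - A) * (b - a) ^ card Q\<bar> =
    norm (\<Sum>u\<in>U - {u0}. (\<Prod>i\<in>Q. ?b (u i)) * integral {A..B} (\<Phi> u))"
    by (metis norm_of_real real_norm_def)
  also have "\<dots> \<le> (\<Sum>u\<in>U - {u0}. (\<Prod>i\<in>Q. norm (?b (u i))) * norm (integral {A..B} (\<Phi> u)))"
    by (rule sum_norm_le) (simp add: norm_mult prod_norm)
  \<comment> \<open>Which coordinate is nonzero depends on \<open>u\<close>; summing over all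
    \<open>i\<close> removes the choice.\<close>
  also have "\<dots> \<le> (\<Sum>u\<in>U - {u0}. \<Sum>i\<in>Q. (\<Prod>i\<in>Q. norm (?b (u i))) * (W * P i * \<bar>of_int (u i)\<bar> powr (- 1 / k)))"
  proof (rule sum_mono)
    fix u assume u: "u \<in> U - {u0}"
    then obtain i where i: "i \<in> Q" "u i \<noteq> 0"
      unfolding U_def u0_def by (metis DiffE PiE_ext insertI1 restrict_PiE_iff restrict_apply' u0 u0_def U_def)
    have "norm (integral {A..B} (\<Phi> u)) \<le> W * P i * \<bar>of_int (u i)\<bar> powr (- 1 / k)"
      using power_phase_integral[of k z S N1 N A B E Q par i u, OF k z S N1 A E Q i]
      unfolding \<Phi>_def W_def P_def by (simp add: mult_ac)
    also have "\<dots> \<le> (\<Sum>i\<in>Q. W * P i * \<bar>of_int (u i)\<bar> powr (- 1 / k))"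
      using i(1) fQ W0 P0 by (intro member_le_sum) auto
    finally show "(\<Prod>i\<in>Q. norm (?b (u i))) * norm (integral {A..B} (\<Phi> u)) \<le>
      (\<Sum>i\<in>Q. (\<Prod>i\<in>Q. norm (?b (u i))) * (W * P i * \<bar>of_int (u i)\<bar> powr (- 1 / k)))"
      unfolding sum_distrib_left[symmetric] by (intro mult_left_mono prod_nonneg) auto
  qed
  also have "\<dots> \<le> (\<Sum>u\<in>U. \<Sum>i\<in>Q. (\<Prod>i\<in>Q. norm (?b (u i))) * (W * P i * \<bar>of_int (u i)\<bar> powr (- 1 / k)))"
    using fU W0 P0 by (intro sum_mono2 sum_nonneg mult_nonneg_nonneg prod_nonneg) auto
  also have "\<dots> = (\<Sum>i\<in>Q. W * P i * (\<Sum>u\<in>U. (\<Prod>i\<in>Q. norm (?b (u i))) * \<bar>of_int (u i)\<bar> powr (- 1 / k)))"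
    unfolding sum_distrib_left by (subst sum.swap) (simp add: mult_ac)
  also have "\<dots> \<le> (\<Sum>i\<in>Q. W * P i * ((b - a) powr (1 / k) * L ^ k))"
  proof (intro sum_mono mult_left_mono)
    fix i assume i: "i \<in> Q"
    \<comment> \<open>The decay factor is attached to coordinate \<open>i\<close> only, so the sum
      over frequency vectors becomes a product of one-dimensional sums.\<close>
    define f where "f = (\<lambda>j v. norm (?b v) * (if j = i then \<bar>of_int v\<bar> powr (- 1 / k) else 1))"
    have "(\<Sum>u\<in>U. (\<Prod>i\<in>Q. norm (?b (u i))) * \<bar>of_int (u i)\<bar> powr (- 1 / k)) = (\<Sum>u\<in>U. \<Prod>j\<in>Q. f j (u j))"
    proof (intro sum.cong refl)
      fix u :: "nat \<Rightarrow> int"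
      have "(\<Prod>j\<in>Q. if j = i then \<bar>of_int (u j)\<bar> powr (- 1 / k) else 1) = \<bar>of_int (u i)\<bar> powr (- 1 / real k)"
        using i fQ by simp
      then show "(\<Prod>i\<in>Q. norm (?b (u i))) * \<bar>of_int (u i)\<bar> powr (- 1 / k) = (\<Prod>j\<in>Q. f j (u j))"
        unfolding f_def prod.distrib by simp
    qed
    also have "\<dots> = (\<Prod>j\<in>Q. \<Sum>v\<in>{- int H..int H}. f j v)"
      unfolding U_def using fQ by (intro prod_sum_PiE[symmetric]) auto
    also have "\<dots> = (\<Sum>v\<in>{- int H..int H}. f i v) * (\<Prod>j\<in>Q - {i}. \<Sum>v\<in>{- int H..int H}. f j v)"
      using i fQ by (intro prod.remove)
    also have "\<dots> \<le> ((b - a) powr (1 / k) * L) * (\<Prod>j\<in>Q - {i}. L)"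
    proof (intro mult_mono prod_mono conjI)
      \<comment> \<open>Since \<open>0 powr s = 0\<close>, the frequency \<open>v = 0\<close>
        contributes nothing; for the same reason the vectors with \<open>u i = 0\<close> have weight
        0 in the sum over all \<open>i\<close>.\<close>
      have "(\<Sum>v\<in>{- int H..int H}. f i v) = (\<Sum>v\<in>{- int H..int H} - {0}. norm (?b v) * \<bar>of_int v\<bar> powr (- (1 / k)))"
        unfolding f_def by (intro sum.mono_neutral_cong_right) auto
      also have "\<dots> \<le> (b - a) powr (1 / k) * L"
        unfolding L_def using ab k by (intro sum_norm_window_coeff_weighted_le) auto
      finally show "(\<Sum>v\<in>{- int H..int H}. f i v) \<le> (b - a) powr (1 / k) * L" .
      fix j assume "j \<in> Q - {i}"
      then show "(\<Sum>v\<in>{- int H..int H}. f j v) \<le> L"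
        unfolding L_def f_def using sum_norm_window_coeff_le[of a b H] ab by simp
    qed (use L1 in \<open>auto simp: f_def intro!: prod_nonneg sum_nonneg mult_nonneg_nonneg zero_le_power\<close>)
    also have "\<dots> = (b - a) powr (1 / k) * L ^ card Q"
      using i fQ by (auto simp add: card_gt_0_iff power_eq_if[of L "card Q"])
    also have "\<dots> \<le> (b - a) powr (1 / k) * L ^ k"
      using L1 card_mono[OF _ Q(1)] by (intro mult_left_mono power_increasing) auto
    finally show "(\<Sum>u\<in>U. (\<Prod>i\<in>Q. norm (?b (u i))) * \<bar>of_int (u i)\<bar> powr (- 1 / k)) \<le> (b - a) powr (1 / k) * L ^ k" .
  qed (use W0 P0 in auto)
  also have "\<dots> \<le> (\<Sum>i<k. W * P i * ((b - a) powr (1 / k) * L ^ k))"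
    using Q W0 P0 L1 by (intro sum_mono2) auto
  also have "\<dots> = W * (b - a) powr (1 / k) * L ^ k * (\<Sum>i<k. P i)"
    by (simp add: sum_distrib_left sum_distrib_right mult_ac)
  finally show ?thesis unfolding W_def P_def L_def .
qed

section \<open>Averaging the losses from nearby indices over tuples\<close>

lemma sum_inverse_sqrt_le: "(\<Sum>d=1..n. 1 / sqrt (real d)) \<le> 2 * sqrt (real n)"
proof (induction n)
  case (Suc n)
  have "1 / sqrt (real (Suc n)) \<le> 2 * (sqrt (real (Suc n)) - sqrt (real n))"
  proof -
    have "1 = (sqrt (real (Suc n)) - sqrt (real n)) * (sqrt (real (Suc n)) + sqrt (real n))"
      by (simp add: algebra_simps flip: power2_eq_square)
    also have "\<dots> \<le> (sqrt (real (Suc n)) - sqrt (real n)) * (2 * sqrt (real (Suc n)))"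
      by (intro mult_left_mono) auto
    finally show ?thesis by (simp add: field_simps)
  qed
  then show ?case using Suc by simp
qed simp

text \<open>With \<open>k \<ge> 2\<close> the exponent is at most \<open>1 / 2\<close>, so all cases
  are dominated by the summable singularity \<open>sqrt (N / d)\<close>, taken once on either side
  of \<open>p\<close>.\<close>

lemma sum_inverse_distance_le:
  assumes S: "S \<subseteq> {1..N}" and p: "p \<in> S" and k: "k \<ge> 2"
  shows "(\<Sum>q\<in>S. (real N / \<bar>real p - real q\<bar>) powr (1 / real k)) \<le> 4 * real N"
proof -
  have fS: "finite S" using S finite_subset by blast
  have pN: "1 \<le> p" "p \<le> N" using p S by auto
  have tle: "(real N / real d) powr (1 / real k) \<le> sqrt N * (1 / sqrt d)" if "1 \<le> d" "d \<le> N" for d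
  proof -
    have "(real N / real d) powr (1 / real k) \<le> (real N / real d) powr (1 / 2)"
      using that k by (intro powr_mono) (auto simp: field_simps)
    then show ?thesis by (simp add: powr_half_sqrt real_sqrt_divide)
  qed
  have "(\<Sum>q\<in>S. (real N / \<bar>real p - real q\<bar>) powr (1 / real k)) \<le>
    (\<Sum>q\<in>{1..N}. (real N / \<bar>real p - real q\<bar>) powr (1 / real k))"
    using S by (intro sum_mono2) auto
  \<comment> \<open>The diagonal term \<open>q = p\<close> is \<open>(N / 0) powr (1 / k)\<close>,
    which is 0 by the conventions for division and \<open>powr\<close>.\<close>
  also have "\<dots> = (\<Sum>q\<in>{1..<p} \<union> {p<..N}. (real N / \<bar>real p - real q\<bar>) powr (1 / real k))"
    using pN by (intro sum.mono_neutral_right) auto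
  also have "\<dots> = (\<Sum>q\<in>{1..<p}. (real N / \<bar>real p - real q\<bar>) powr (1 / real k)) +
      (\<Sum>q\<in>{p<..N}. (real N / \<bar>real p - real q\<bar>) powr (1 / real k))"
    by (intro sum.union_disjoint) auto
  also have "(\<Sum>q\<in>{1..<p}. (real N / \<bar>real p - real q\<bar>) powr (1 / real k)) =
    (\<Sum>d\<in>{1..p-1}. (real N / real d) powr (1 / real k))"
    by (rule sum.reindex_bij_witness[of _ "\<lambda>d. p - d" "\<lambda>q. p - q"]) (auto simp: of_nat_diff)
  also have "(\<Sum>q\<in>{p<..N}. (real N / \<bar>real p - real q\<bar>) powr (1 / real k)) =
    (\<Sum>d\<in>{1..N-p}. (real N / real d) powr (1 / real k))"
    by (rule sum.reindex_bij_witness[of _ "\<lambda>d. p + d" "\<lambda>q. q - p"]) (auto simp: of_nat_diff)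
  also have "(\<Sum>d\<in>{1..p-1}. (real N / real d) powr (1 / real k)) +
    (\<Sum>d\<in>{1..N-p}. (real N / real d) powr (1 / real k)) \<le>
    (\<Sum>d=1..N. sqrt N * (1 / sqrt d)) + (\<Sum>d=1..N. sqrt N * (1 / sqrt d))"
    using pN by (intro add_mono order_trans[OF sum_mono sum_mono2] tle) auto
  also have "\<dots> = 2 * (sqrt N * (\<Sum>d=1..N. 1 / sqrt d))" by (simp add: sum_distrib_left)
  also have "\<dots> \<le> 2 * (sqrt N * (2 * sqrt N))"
    by (intro mult_left_mono sum_inverse_sqrt_le) auto
  finally show ?thesis by simp
qed

text \<open>All weights share the centre \<open>z i\<close>. Once its value \<open>p\<close> is
  fixed, the other coordinates are independent and contribute at most \<open>C\<close> each; the
  choice of \<open>p\<close> is the last factor \<open>C\<close>.\<close>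

lemma sum_PiE_star_le:
  fixes w :: "nat \<Rightarrow> nat \<Rightarrow> real"
  assumes S: "finite S" and i: "i < k" and w0: "\<And>p q. w p q \<ge> 0" and w: "\<And>p. p \<in> S \<Longrightarrow> (\<Sum>q\<in>S. w p q) \<le> C"
    and cS: "real (card S) \<le> C"
  shows "(\<Sum>z\<in>{..<k} \<rightarrow>\<^sub>E S. \<Prod>q\<in>{..<k} - {i}. w (z i) (z q)) \<le> C ^ k"
proof -
  have C0: "C \<ge> 0" using cS by linarith
  have "(\<Sum>z\<in>{..<k} \<rightarrow>\<^sub>E S. \<Prod>q\<in>{..<k} - {i}. w (z i) (z q)) =
    (\<Sum>z\<in>{..<k} \<rightarrow>\<^sub>E S. \<Sum>p\<in>S. \<Prod>q\<in>{..<k}. if q = i then (if z q = p then 1 else 0) else w p (z q))"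
  proof (intro sum.cong refl)
    fix z assume z: "z \<in> {..<k} \<rightarrow>\<^sub>E S"
    have "(\<Sum>p\<in>S. \<Prod>q\<in>{..<k}. if q = i then (if z q = p then 1 else 0) else w p (z q)) =
      (\<Sum>p\<in>S. if z i = p then \<Prod>q\<in>{..<k} - {i}. w p (z q) else 0)"
    proof (intro sum.cong refl)
      fix p
      have "(\<Prod>q\<in>{..<k}. if q = i then (if z q = p then 1 else 0) else w p (z q)) =
        (if z i = p then 1 else 0) * (\<Prod>q\<in>{..<k} - {i}. if q = i then (if z q = p then 1 else 0) else w p (z q))"
        using i by (subst prod.remove[of _ i]) auto
      also have "(\<Prod>q\<in>{..<k} - {i}. if q = i then (if z q = p then 1 else 0) else w p (z q)) = (\<Prod>q\<in>{..<k} - {i}. w p (z q))"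
        by (intro prod.cong) auto
      finally show "(\<Prod>q\<in>{..<k}. if q = i then (if z q = p then 1 else 0) else w p (z q)) =
        (if z i = p then \<Prod>q\<in>{..<k} - {i}. w p (z q) else 0)" by simp
    qed
    also have "\<dots> = (\<Prod>q\<in>{..<k} - {i}. w (z i) (z q))"
      using z i S by (auto simp: PiE_iff)
    finally show "(\<Prod>q\<in>{..<k} - {i}. w (z i) (z q)) =
      (\<Sum>p\<in>S. \<Prod>q\<in>{..<k}. if q = i then (if z q = p then 1 else 0) else w p (z q))" ..
  qed
  also have "\<dots> = (\<Sum>p\<in>S. \<Sum>z\<in>{..<k} \<rightarrow>\<^sub>E S. \<Prod>q\<in>{..<k}. if q = i then (if z q = p then 1 else 0) else w p (z q))"
    by (rule sum.swap)
  also have "\<dots> = (\<Sum>p\<in>S. \<Prod>q\<in>{..<k}. \<Sum>t\<in>S. if q = i then (if t = p then 1 else 0) else w p t)"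
    using S by (intro sum.cong refl prod_sum_PiE[symmetric]) auto
  also have "\<dots> \<le> (\<Sum>p\<in>S. C ^ (k - 1))"
  proof (rule sum_mono)
    fix p assume p: "p \<in> S"
    have "(\<Prod>q\<in>{..<k}. \<Sum>t\<in>S. if q = i then (if t = p then 1 else 0) else w p t) =
      (\<Sum>t\<in>S. if t = p then 1 else 0) * (\<Prod>q\<in>{..<k} - {i}. \<Sum>t\<in>S. if q = i then (if t = p then 1 else 0) else w p t)"
      using i by (subst prod.remove[of _ i]) auto
    also have "\<dots> = (\<Prod>q\<in>{..<k} - {i}. \<Sum>t\<in>S. if q = i then (if t = p then 1 else 0) else w p t)"
      using p S by simp
    also have "\<dots> \<le> (\<Prod>q\<in>{..<k} - {i}. C)"
      using w[OF p] w0 by (intro prod_mono) (auto intro!: sum_nonneg)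
    finally show "(\<Prod>q\<in>{..<k}. \<Sum>t\<in>S. if q = i then (if t = p then 1 else 0) else w p t) \<le> C ^ (k - 1)"
      using i by simp
  qed
  also have "\<dots> \<le> C * C ^ (k - 1)" using cS C0 by (simp add: mult_right_mono)
  also have "\<dots> = C ^ k" using i by (simp add: power_eq_if)
  finally show ?thesis .
qed

definition inj_tuples :: "nat \<Rightarrow> nat set \<Rightarrow> (nat \<Rightarrow> nat) set" where
  "inj_tuples k S = {z \<in> {..<k} \<rightarrow>\<^sub>E S. inj_on z {..<k}}"

lemma finite_inj_tuples [simp]: "finite S \<Longrightarrow> finite (inj_tuples k S)"
  unfolding inj_tuples_def by (intro finite_subset[OF _ finite_PiE[of "{..<k}" "\<lambda>_. S"]]) auto

lemma sum_forest_prod_integral: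
  assumes k: "k \<ge> 2"
    and S: "\<And>n. n \<in> S \<Longrightarrow> 3 \<le> n \<and> N1 \<le> real n \<and> n \<le> N" and N1: "N1 \<ge> 1"
    and A: "0 \<le> A" "A \<le> B" and E: "real N powr (B - A) \<le> E"
    and Q: "Q \<subseteq> {..<k}" "\<And>i. i \<in> Q \<Longrightarrow> par i < k \<and> par i \<notin> Q"
    and ab: "a < b" "b - a \<le> 1"
  shows "(\<Sum>z\<in>inj_tuples k S. \<bar>integral {A..B} (forest_prod (window H a b) Q par z) - (B - A) * (b - a) ^ card Q\<bar>) \<le>
    17 * 4 ^ k * E * N1 powr (- A / k) * (b - a) powr (1 / k) * (1 + 2 * harm H) ^ k * (real k * (4 * real N) ^ k)"
proof -
  define W where "W = 17 * 4 ^ k * E * N1 powr (- A / k) * (b - a) powr (1 / k) * (1 + 2 * harm H :: real) ^ k"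
  have E0: "E \<ge> 0" using E powr_ge_zero[of "real N" "B - A"] by linarith
  have W0: "W \<ge> 0" unfolding W_def using E0
    by (intro mult_nonneg_nonneg zero_le_power add_nonneg_nonneg) (auto simp: harm_nonneg)
  have SN: "S \<subseteq> {1..N}" using S by force
  then have fS: "finite S" using finite_subset by blast
  let ?P = "\<lambda>z i. \<Prod>q\<in>{..<k} - {i}. (real N / \<bar>real (z i) - real (z q)\<bar>) powr (1 / real k)"
  have "(\<Sum>z\<in>inj_tuples k S. \<bar>integral {A..B} (forest_prod (window H a b) Q par z) - (B - A) * (b - a) ^ card Q\<bar>) \<le>
    (\<Sum>z\<in>inj_tuples k S. W * (\<Sum>i<k. ?P z i))"
  proof (rule sum_mono)
    fix z assume z: "z \<in> inj_tuples k S"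
    show "\<bar>integral {A..B} (forest_prod (window H a b) Q par z) - (B - A) * (b - a) ^ card Q\<bar> \<le> W * (\<Sum>i<k. ?P z i)"
      unfolding W_def using z S N1
      by (intro forest_prod_integral[where S = S] k A E Q ab) (auto simp: inj_tuples_def)
  qed
  also have "\<dots> \<le> (\<Sum>z\<in>{..<k} \<rightarrow>\<^sub>E S. W * (\<Sum>i<k. ?P z i))"
    using fS W0 by (intro sum_mono2 finite_PiE mult_nonneg_nonneg sum_nonneg prod_nonneg) (auto simp: inj_tuples_def)
  also have "\<dots> = W * (\<Sum>i<k. \<Sum>z\<in>{..<k} \<rightarrow>\<^sub>E S. ?P z i)"
    unfolding sum_distrib_left[symmetric] by (subst sum.swap) simp
  also have "\<dots> \<le> W * (\<Sum>i<k. (4 * real N) ^ k)"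
  proof (intro mult_left_mono sum_mono W0)
    fix i assume "i \<in> {..<k}"
    have "card S \<le> N" using card_mono[OF _ SN] by simp
    then show "(\<Sum>z\<in>{..<k} \<rightarrow>\<^sub>E S. ?P z i) \<le> (4 * real N) ^ k"
      using \<open>i \<in> {..<k}\<close> fS sum_inverse_distance_le[OF SN _ k]
      by (intro sum_PiE_star_le[where w = "\<lambda>p q. (real N / \<bar>real p - real q\<bar>) powr (1 / real k)"]) auto
  qed
  finally show ?thesis by (simp add: W_def)
qed

section \<open>The second moment of correlation sums\<close>

abbreviation star_prod :: "(real \<Rightarrow> real) \<Rightarrow> nat \<Rightarrow> (nat \<Rightarrow> nat) \<Rightarrow> real \<Rightarrow> real" where
  "star_prod w m \<equiv> forest_prod w {1..<m} (\<lambda>_. 0)"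

definition correlation_sum :: "(real \<Rightarrow> real) \<Rightarrow> nat \<Rightarrow> nat set \<Rightarrow> real \<Rightarrow> real" where
  "correlation_sum w m S \<alpha> = (\<Sum>x\<in>inj_tuples m S. star_prod w m x \<alpha>)"

definition near_int :: "real \<Rightarrow> real \<Rightarrow> bool" where
  "near_int \<epsilon> t \<longleftrightarrow> (\<exists>n::int. \<bar>t - of_int n\<bar> \<le> \<epsilon>)"

lemma near_int_add: "near_int \<epsilon> s \<Longrightarrow> near_int \<epsilon>' t \<Longrightarrow> near_int (\<epsilon> + \<epsilon>') (s + t)"
  unfolding near_int_def
proof (elim exE)
  fix n n' :: int
  assume "\<bar>s - of_int n\<bar> \<le> \<epsilon>" "\<bar>t - of_int n'\<bar> \<le> \<epsilon>'"
  then show "\<exists>n::int. \<bar>s + t - of_int n\<bar> \<le> \<epsilon> + \<epsilon>'" by (intro exI[of _ "n + n'"]) auto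
qed

lemma near_int_minus: "near_int \<epsilon> t \<Longrightarrow> near_int \<epsilon> (- t)"
  unfolding near_int_def
proof (elim exE)
  fix n :: int
  assume "\<bar>t - of_int n\<bar> \<le> \<epsilon>"
  then show "\<exists>n::int. \<bar>- t - of_int n\<bar> \<le> \<epsilon>" by (intro exI[of _ "- n"]) auto
qed

lemma near_int_mono: "near_int \<epsilon> t \<Longrightarrow> \<epsilon> \<le> \<epsilon>' \<Longrightarrow> near_int \<epsilon>' t"
  unfolding near_int_def by (meson order_trans)

lemma near_int_0: "\<epsilon> \<ge> 0 \<Longrightarrow> near_int \<epsilon> 0"
  unfolding near_int_def by (intro exI[of _ 0]) auto

lemma forest_prod_nonneg: "(\<And>t. w t \<ge> 0) \<Longrightarrow> forest_prod w Q par z \<alpha> \<ge> 0"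
  unfolding forest_prod_def by (intro prod_nonneg) auto

lemma forest_prod_le_1: "(\<And>t. w t \<ge> 0) \<Longrightarrow> (\<And>t. w t \<le> 1) \<Longrightarrow> forest_prod w Q par z \<alpha> \<le> 1"
  unfolding forest_prod_def by (intro prod_le_1) auto

lemma forest_prod_le_member:
  assumes "\<And>t. w t \<ge> 0" "\<And>t. w t \<le> 1" "finite Q" "i \<in> Q"
  shows "forest_prod w Q par z \<alpha> \<le> w (real (z i) powr \<alpha> - real (z (par i)) powr \<alpha>)"
proof -
  have "forest_prod w Q par z \<alpha> = w (real (z i) powr \<alpha> - real (z (par i)) powr \<alpha>) * forest_prod w (Q - {i}) par z \<alpha>"
    unfolding forest_prod_def by (rule prod.remove[OF assms(3,4)])
  also have "\<dots> \<le> w (real (z i) powr \<alpha> - real (z (par i)) powr \<alpha>) * 1"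
    by (intro mult_left_mono forest_prod_le_1 assms)
  finally show ?thesis by simp
qed

lemma continuous_on_forest_prod:
  assumes "continuous_on UNIV w" "\<And>i. i \<in> Q \<Longrightarrow> z i > 0 \<and> z (par i) > 0"
  shows "continuous_on T (forest_prod w Q par z)"
  unfolding forest_prod_def using assms(2)
  by (intro continuous_on_prod continuous_on_compose2[OF assms(1)] continuous_intros) auto

text \<open>The root is fixed and the other \<open>d\<close> entries form an injection into
  \<open>B\<close>. Truncated subtraction gives the right value when \<open>card B < d\<close>,
  since then one factor is 0.\<close>

lemma card_inj_tuples_root:
  assumes S: "finite S" and p: "p \<in> S" and B: "B \<subseteq> S - {p}"
  shows "card {z \<in> inj_tuples (Suc d) S. z 0 = p \<and> (\<forall>i\<in>{1..<Suc d}. z i \<in> B)} = (\<Prod>i=0..<d. card B - i)"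
proof -
  have fB: "finite B" using S B finite_subset by blast
  have "bij_betw (\<lambda>f i. if i = 0 then p else f i) {f \<in> {1..<Suc d} \<rightarrow>\<^sub>E B. inj_on f {1..<Suc d}}
    {z \<in> inj_tuples (Suc d) S. z 0 = p \<and> (\<forall>i\<in>{1..<Suc d}. z i \<in> B)}"
  proof (rule bij_betw_byWitness[where f' = "\<lambda>z. restrict z {1..<Suc d}"])
    show "\<forall>f\<in>{f \<in> {1..<Suc d} \<rightarrow>\<^sub>E B. inj_on f {1..<Suc d}}. restrict (\<lambda>i. if i = 0 then p else f i) {1..<Suc d} = f"
      by (auto simp: fun_eq_iff PiE_iff extensional_def)
    show "\<forall>z\<in>{z \<in> inj_tuples (Suc d) S. z 0 = p \<and> (\<forall>i\<in>{1..<Suc d}. z i \<in> B)}.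
      (\<lambda>i. if i = 0 then p else restrict z {1..<Suc d} i) = z"
      by (auto simp: fun_eq_iff inj_tuples_def PiE_iff extensional_def)
    show "(\<lambda>f i. if i = 0 then p else f i) ` {f \<in> {1..<Suc d} \<rightarrow>\<^sub>E B. inj_on f {1..<Suc d}}
      \<subseteq> {z \<in> inj_tuples (Suc d) S. z 0 = p \<and> (\<forall>i\<in>{1..<Suc d}. z i \<in> B)}"
    proof clarify
      fix f assume f: "f \<in> {1..<Suc d} \<rightarrow>\<^sub>E B" "inj_on f {1..<Suc d}"
      have fm: "f i \<in> B" if "0 < i" "i < Suc d" for i using f(1) that by (auto simp: PiE_iff)
      have "inj_on (\<lambda>i. if i = 0 then p else f i) {..<Suc d}"
      proof (rule inj_onI)
        fix i j assume ij: "i \<in> {..<Suc d}" "j \<in> {..<Suc d}" "(if i = 0 then p else f i) = (if j = 0 then p else f j)"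
        then show "i = j"
          using fm[of i] fm[of j] B inj_onD[OF f(2), of i j] by (auto split: if_splits)
      qed
      moreover have "(\<lambda>i. if i = 0 then p else f i) \<in> {..<Suc d} \<rightarrow>\<^sub>E S"
        using f fm B p by (auto simp: PiE_iff extensional_def)
      ultimately show "(\<lambda>i. if i = 0 then p else f i) \<in> inj_tuples (Suc d) S \<and> (if 0 = 0 then p else f 0) = p \<and>
        (\<forall>i\<in>{1..<Suc d}. (if i = 0 then p else f i) \<in> B)"
        using fm by (auto simp: inj_tuples_def)
    qed
    show "(\<lambda>z. restrict z {1..<Suc d}) ` {z \<in> inj_tuples (Suc d) S. z 0 = p \<and> (\<forall>i\<in>{1..<Suc d}. z i \<in> B)}
      \<subseteq> {f \<in> {1..<Suc d} \<rightarrow>\<^sub>E B. inj_on f {1..<Suc d}}"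
    proof clarify
      fix z assume z: "z \<in> inj_tuples (Suc d) S" "p = z 0" "\<forall>i\<in>{1..<Suc d}. z i \<in> B"
      then have "inj_on z {1..<Suc d}" unfolding inj_tuples_def by (auto elim: inj_on_subset)
      then show "restrict z {1..<Suc d} \<in> {1..<Suc d} \<rightarrow>\<^sub>E B \<and> inj_on (restrict z {1..<Suc d}) {1..<Suc d}"
        using z by (auto simp: inj_on_restrict_eq)
    qed
  qed
  from bij_betw_same_card[OF this] show ?thesis
    using card_inj_on_subset_funcset[of "{1..<Suc d}" B "{1..<Suc d}"] fB by simp
qed

text \<open>For \<open>n > 2 * d + 2\<close> each factor is at least \<open>n / 2\<close>. For
  smaller \<open>n\<close> the product may vanish, and the summand 1 takes over.\<close>

lemma power_le_falling_prod:
  assumes "n \<ge> 1"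
  shows "real n ^ d \<le> (2 * real d + 2) ^ d * (1 + real (\<Prod>i=0..<d. (n - 1) - i))"
proof (cases "n \<le> 2 * d + 2")
  case True
  then have "real n \<le> 2 * real d + 2" by linarith
  then have "real n ^ d \<le> (2 * real d + 2) ^ d * 1"
    by (auto intro!: power_mono)
  also have "\<dots> \<le> (2 * real d + 2) ^ d * (1 + real (\<Prod>i=0..<d. (n - 1) - i))"
    by (intro mult_left_mono) (auto intro: prod_nonneg)
  finally show ?thesis .
next
  case False
  have "(real n / 2) ^ d = (\<Prod>i=0..<d. real n / 2)" by simp
  also have "\<dots> \<le> (\<Prod>i=0..<d. real (n - 1 - i))" using False by (intro prod_mono) auto
  finally have 1: "(real n / 2) ^ d \<le> real (\<Prod>i=0..<d. (n - 1) - i)" by simp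
  have "real n ^ d = 2 ^ d * (real n / 2) ^ d" by (simp add: power_divide)
  also have "\<dots> \<le> (2 * real d + 2) ^ d * (1 + real (\<Prod>i=0..<d. (n - 1) - i))"
    using 1 by (intro mult_mono power_mono) auto
  finally show ?thesis .
qed

section \<open>Squaring a correlation sum: disjoint and overlapping pairs of tuples\<close>

definition tuple_join :: "nat \<Rightarrow> (nat \<Rightarrow> nat) \<Rightarrow> (nat \<Rightarrow> nat) \<Rightarrow> nat \<Rightarrow> nat" where
  "tuple_join m x y = (\<lambda>i\<in>{..<2 * m}. if i < m then x i else y (i - m))"

definition overlapping :: "nat \<Rightarrow> nat set \<Rightarrow> ((nat \<Rightarrow> nat) \<times> (nat \<Rightarrow> nat)) set" where
  "overlapping m S = {(x, y) \<in> inj_tuples m S \<times> inj_tuples m S. x ` {..<m} \<inter> y ` {..<m} \<noteq> {}}"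

lemma tuple_join_bij:
  "bij_betw (\<lambda>(x, y). tuple_join m x y) (inj_tuples m S \<times> inj_tuples m S - overlapping m S) (inj_tuples (2 * m) S)"
proof (rule bij_betw_byWitness[where f' = "\<lambda>z. (restrict z {..<m}, \<lambda>i\<in>{..<m}. z (i + m))"])
  show "\<forall>p\<in>inj_tuples m S \<times> inj_tuples m S - overlapping m S.
    (restrict (case p of (x, y) \<Rightarrow> tuple_join m x y) {..<m}, \<lambda>i\<in>{..<m}. (case p of (x, y) \<Rightarrow> tuple_join m x y) (i + m)) = p"
    by (auto simp: tuple_join_def inj_tuples_def PiE_iff extensional_def fun_eq_iff)
  show "\<forall>z\<in>inj_tuples (2 * m) S. (case (restrict z {..<m}, \<lambda>i\<in>{..<m}. z (i + m)) of (x, y) \<Rightarrow> tuple_join m x y) = z"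
    by (auto simp: tuple_join_def inj_tuples_def PiE_iff extensional_def fun_eq_iff)
  show "(\<lambda>(x, y). tuple_join m x y) ` (inj_tuples m S \<times> inj_tuples m S - overlapping m S) \<subseteq> inj_tuples (2 * m) S"
  proof clarify
    fix x y assume xy: "x \<in> inj_tuples m S" "y \<in> inj_tuples m S" "(x, y) \<notin> overlapping m S"
    have ne: "x i \<noteq> y j" if "i < m" "j < m" for i j
    proof
      assume "x i = y j"
      then have "x i \<in> x ` {..<m} \<inter> y ` {..<m}" using that by (metis IntI imageI lessThan_iff)
      then show False using xy by (auto simp: overlapping_def)
    qed
    have "inj_on (tuple_join m x y) {..<2 * m}"
    proof (rule inj_onI)
      fix i j assume ij: "i \<in> {..<2 * m}" "j \<in> {..<2 * m}" "tuple_join m x y i = tuple_join m x y j"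
      have xi: "inj_on x {..<m}" "inj_on y {..<m}" using xy by (auto simp: inj_tuples_def)
      show "i = j"
      proof (cases "i < m"; cases "j < m")
        assume "i < m" "j < m"
        then show ?thesis using ij inj_onD[OF xi(1), of i j] by (simp add: tuple_join_def)
      next
        assume "i < m" "\<not> j < m"
        then show ?thesis using ij ne[of i "j - m"] by (simp add: tuple_join_def)
      next
        assume "\<not> i < m" "j < m"
        moreover from this have "i - m < m" using ij(1) unfolding lessThan_iff by arith
        ultimately show ?thesis using ij ne[of j "i - m"] by (auto simp: tuple_join_def)
      next
        assume "\<not> i < m" "\<not> j < m"
        moreover from this have "i - m < m" "j - m < m" using ij(1,2) unfolding lessThan_iff by arith+
        ultimately show ?thesis using ij inj_onD[OF xi(2), of "i - m" "j - m"] by (simp add: tuple_join_def)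
      qed
    qed
    moreover have "tuple_join m x y \<in> {..<2 * m} \<rightarrow>\<^sub>E S"
      using xy by (auto simp: tuple_join_def inj_tuples_def PiE_iff)
    ultimately show "tuple_join m x y \<in> inj_tuples (2 * m) S" by (simp add: inj_tuples_def)
  qed
  show "(\<lambda>z. (restrict z {..<m}, \<lambda>i\<in>{..<m}. z (i + m))) ` inj_tuples (2 * m) S
    \<subseteq> inj_tuples m S \<times> inj_tuples m S - overlapping m S"
  proof clarify
    fix z assume z: "z \<in> inj_tuples (2 * m) S"
    then have zi: "inj_on z {..<2 * m}" by (simp add: inj_tuples_def)
    have "z i \<noteq> z (j + m)" if "i < m" "j < m" for i j
      using inj_onD[OF zi, of i "j + m"] that by auto
    then have "restrict z {..<m} ` {..<m} \<inter> (\<lambda>i\<in>{..<m}. z (i + m)) ` {..<m} = {}" by auto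
    moreover have "inj_on (\<lambda>i\<in>{..<m}. z (i + m)) {..<m}"
      by (intro inj_onI) (use inj_onD[OF zi] in fastforce)
    moreover have "inj_on (restrict z {..<m}) {..<m}"
      by (intro inj_onI) (use inj_onD[OF zi] in fastforce)
    ultimately show "(restrict z {..<m}, \<lambda>i\<in>{..<m}. z (i + m)) \<in> inj_tuples m S \<times> inj_tuples m S - overlapping m S"
      using z by (auto simp: inj_tuples_def overlapping_def PiE_iff)
  qed
qed

text \<open>Two stars, rooted at \<open>0\<close> and at \<open>m\<close>.\<close>

definition pair_par :: "nat \<Rightarrow> nat \<Rightarrow> nat" where "pair_par m i = (if i < m then 0 else m)"

abbreviation pair_prod :: "(real \<Rightarrow> real) \<Rightarrow> nat \<Rightarrow> (nat \<Rightarrow> nat) \<Rightarrow> real \<Rightarrow> real" where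
  "pair_prod w m \<equiv> forest_prod w ({1..<m} \<union> {m+1..<2*m}) (pair_par m)"

lemma forest_prod_join:
  assumes "m \<ge> 1"
  shows "star_prod w m x \<alpha> * star_prod w m y \<alpha> =
    pair_prod w m (tuple_join m x y) \<alpha>"
proof -
  have "pair_prod w m (tuple_join m x y) \<alpha> =
    forest_prod w {1..<m} (pair_par m) (tuple_join m x y) \<alpha> * forest_prod w {m+1..<2*m} (pair_par m) (tuple_join m x y) \<alpha>"
    unfolding forest_prod_def by (rule prod.union_disjoint) auto
  also have "forest_prod w {1..<m} (pair_par m) (tuple_join m x y) \<alpha> = star_prod w m x \<alpha>"
    unfolding forest_prod_def using assms by (intro prod.cong) (auto simp: pair_par_def tuple_join_def)
  also have "forest_prod w {m+1..<2*m} (pair_par m) (tuple_join m x y) \<alpha> = star_prod w m y \<alpha>"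
    unfolding forest_prod_def using assms
    by (intro prod.reindex_bij_witness[of _ "\<lambda>i. i + m" "\<lambda>i. i - m"]) (auto simp: pair_par_def tuple_join_def)
  finally show ?thesis by simp
qed

lemma finite_overlapping: "finite S \<Longrightarrow> finite (overlapping m S)"
  unfolding overlapping_def by (rule finite_subset[of _ "inj_tuples m S \<times> inj_tuples m S"]) auto

text \<open>Pairs without a common point are injective tuples of length \<open>2 * m\<close>, and
  the product of their stars is again a forest product; so the first sum is within reach of the mean
  value bounds.\<close>

lemma correlation_sum_square:
  assumes "m \<ge> 1" "finite S"
  shows "(correlation_sum w m S \<alpha>)\<^sup>2 =
    (\<Sum>z\<in>inj_tuples (2 * m) S. pair_prod w m z \<alpha>) +
    (\<Sum>(x, y)\<in>overlapping m S. star_prod w m x \<alpha> * star_prod w m y \<alpha>)"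
proof -
  let ?F = "\<lambda>(x, y). star_prod w m x \<alpha> * star_prod w m y \<alpha>"
  have "(correlation_sum w m S \<alpha>)\<^sup>2 = sum ?F (inj_tuples m S \<times> inj_tuples m S)"
    unfolding correlation_sum_def power2_eq_square sum_product sum.cartesian_product by simp
  also have "\<dots> = sum ?F (inj_tuples m S \<times> inj_tuples m S - overlapping m S) + sum ?F (overlapping m S)"
    using assms by (intro sum.subset_diff) (auto simp: overlapping_def)
  also have "sum ?F (inj_tuples m S \<times> inj_tuples m S - overlapping m S) =
    (\<Sum>p\<in>inj_tuples m S \<times> inj_tuples m S - overlapping m S.
      pair_prod w m ((\<lambda>(x, y). tuple_join m x y) p) \<alpha>)"
    using forest_prod_join[OF assms(1)] by (intro sum.cong) auto
  also have "\<dots> = (\<Sum>z\<in>inj_tuples (2 * m) S. pair_prod w m z \<alpha>)"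
    by (rule sum.reindex_bij_betw[OF tuple_join_bij])
  finally show ?thesis .
qed

text \<open>Among the \<open>2 * m\<close> entries \<open>x 0\<close> is prescribed and
  \<open>y b\<close> is determined by \<open>x a\<close>; at most \<open>2 * m - 2\<close> are
  free.\<close>

lemma card_rooted_overlap:
  assumes B: "finite B" "p \<in> B" and m: "m \<ge> 1" and a: "a < m" and b: "b < m"
  shows "card {(x, y). x \<in> {..<m} \<rightarrow>\<^sub>E B \<and> y \<in> {..<m} \<rightarrow>\<^sub>E B \<and> x 0 = p \<and> x a = y b} \<le> card B ^ (2 * m - 2)"
proof -
  let ?X = "PiE {..<m} (\<lambda>i. if i = 0 then {p} else B)"
  let ?Y = "\<lambda>x. PiE {..<m} (\<lambda>i. if i = b then {x a} else B)"
  have cardP: "card (PiE {..<m} (\<lambda>i. if i = c then {t} else B)) = card B ^ (m - 1)" if "c < m" for c t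
    using that B by (simp add: card_PiE prod.remove[of "{..<m}" c])
  have fX: "finite ?X" using B by (intro finite_PiE) auto
  have fY: "finite (?Y x)" for x using B by (intro finite_PiE) auto
  have "card {(x, y). x \<in> {..<m} \<rightarrow>\<^sub>E B \<and> y \<in> {..<m} \<rightarrow>\<^sub>E B \<and> x 0 = p \<and> x a = y b} \<le> card (SIGMA x:?X. ?Y x)"
    using fX fY by (intro card_mono finite_SigmaI) (auto simp: PiE_iff extensional_def)
  also have "\<dots> = (\<Sum>x\<in>?X. card (?Y x))"
    using fX fY by (intro card_SigmaI) auto
  also have "\<dots> = card B ^ (m - 1) * card B ^ (m - 1)"
    using m b by (simp add: cardP)
  also have "\<dots> = card B ^ (2 * m - 2)" using m by (simp add: power_add[symmetric] mult_2 numeral_2_eq_2)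
  finally show ?thesis .
qed

text \<open>A pair in which some difference to the root is far from the integers contributes at most
  \<open>\<eta>\<close>. In all other pairs the shared point links both stars, so every point lies
  within \<open>3 * \<epsilon>\<close> of \<open>x 0\<close> modulo 1. The number of these pairs is
  governed by a power of the number of such points, and that power by rooted tuples of
  \<open>2 * m - 1\<close> distinct points, hence by a first moment with the wider window
  \<open>W\<close>.\<close>

lemma overlap_sum_le:
  assumes m: "m \<ge> 2" and S: "finite S" and w: "\<And>t. w t \<ge> 0" "\<And>t. w t \<le> 1"
    and far: "\<And>t. \<not> near_int \<epsilon> t \<Longrightarrow> w t \<le> \<eta>" and eps: "\<epsilon> \<ge> 0" and eta: "\<eta> \<ge> 0"
    and W: "\<And>t. W t \<ge> 0" "\<And>t. near_int (3 * \<epsilon>) t \<Longrightarrow> 1 / 2 \<le> W t"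
  shows "(\<Sum>(x, y)\<in>overlapping m S. star_prod w m x \<alpha> * star_prod w m y \<alpha>) \<le>
    \<eta> * real (card S) ^ (2 * m) +
    real m ^ 2 * (4 * real m) ^ (2 * m) * (real (card S) + 2 ^ (2 * m) * correlation_sum W (2 * m - 1) S \<alpha>)"
proof -
  define g where "g = (\<lambda>q::nat. real q powr \<alpha>)"
  define F where "F = (\<lambda>x. star_prod w m x \<alpha>)"
  have F0: "F x \<ge> 0" "F x \<le> 1" for x
    unfolding F_def using w by (auto intro: forest_prod_nonneg forest_prod_le_1)
  define Near where "Near = (\<lambda>x::nat \<Rightarrow> nat. \<forall>i\<in>{1..<m}. near_int \<epsilon> (g (x i) - g (x 0)))"
  define Bp where "Bp = (\<lambda>p. {q \<in> S. near_int (3 * \<epsilon>) (g q - g p)})"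
  have fBp: "finite (Bp p)" for p using S by (simp add: Bp_def)
  have Ffar: "F x \<le> \<eta>" if "\<not> Near x" for x
  proof -
    obtain i where i: "i \<in> {1..<m}" "\<not> near_int \<epsilon> (g (x i) - g (x 0))" using \<open>\<not> Near x\<close> by (auto simp: Near_def)
    have "F x \<le> w (g (x i) - g (x 0))"
      unfolding F_def g_def using i(1) w by (intro forest_prod_le_member) auto
    then show ?thesis using far[OF i(2)] by linarith
  qed
  define O' where "O' = {(x, y) \<in> overlapping m S. Near x \<and> Near y}"
  have fO: "finite (overlapping m S)" by (rule finite_overlapping[OF S])
  \<comment> \<open>Both factors are at most 1, so one far tuple already bounds the product by
    \<open>\<eta>\<close>, and pairs of near tuples are simply counted.\<close>
  have "(\<Sum>(x, y)\<in>overlapping m S. F x * F y) \<le> (\<Sum>(x, y)\<in>overlapping m S. \<eta> + (if Near x \<and> Near y then 1 else 0))"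
  proof (rule sum_mono, clarify)
    fix x y
    have "F x * F y \<le> 1" using F0 by (meson mult_le_one)
    moreover have "F x * F y \<le> F x" "F x * F y \<le> F y"
      using F0 by (auto simp: mult_left_le mult_left_le_one_le)
    ultimately show "F x * F y \<le> \<eta> + (if Near x \<and> Near y then 1 else 0)"
      using Ffar[of x] Ffar[of y] eta by auto
  qed
  also have "\<dots> = \<eta> * card (overlapping m S) + card O'"
    using fO by (simp add: case_prod_beta sum.distrib O'_def sum.If_cases Int_def case_prod_unfold)
  also have "\<dots> \<le> \<eta> * real (card S) ^ (2 * m) + card O'"
  proof -
    have "card (overlapping m S) \<le> card (({..<m} \<rightarrow>\<^sub>E S) \<times> ({..<m} \<rightarrow>\<^sub>E S))"
      using S by (intro card_mono finite_cartesian_product finite_PiE) (auto simp: overlapping_def inj_tuples_def)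
    also have "\<dots> = card S ^ (2 * m)"
      by (simp add: card_cartesian_product card_funcsetE mult_2 power_add)
    finally show ?thesis using eta by (simp add: mult_left_mono flip: of_nat_power)
  qed
  also have "real (card O') \<le> (\<Sum>p\<in>S. real m ^ 2 * real (card (Bp p)) ^ (2 * m - 2))"
  proof -
    define R where "R = (\<lambda>p a b. {(x, y). x \<in> {..<m} \<rightarrow>\<^sub>E Bp p \<and> y \<in> {..<m} \<rightarrow>\<^sub>E Bp p \<and> x 0 = p \<and> x a = y b})"
    have fR: "finite (R p a b)" for p a b
      unfolding R_def using fBp[of p]
      by (intro finite_subset[OF _ finite_cartesian_product[OF finite_PiE finite_PiE], of _ "{..<m}" "\<lambda>_. Bp p" "{..<m}" "\<lambda>_. Bp p"]) auto
    have "O' \<subseteq> (\<Union>p\<in>S. \<Union>a\<in>{..<m}. \<Union>b\<in>{..<m}. R p a b)"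
    proof clarify
      fix x y assume "(x, y) \<in> O'"
      then have xy: "x \<in> inj_tuples m S" "y \<in> inj_tuples m S" "Near x" "Near y" "x ` {..<m} \<inter> y ` {..<m} \<noteq> {}"
        by (auto simp: O'_def overlapping_def)
      then obtain a b where ab: "a < m" "b < m" "x a = y b" by auto
      have nx: "near_int \<epsilon> (g (x i) - g (x 0))" if "i < m" for i
        using xy(3) that near_int_0[OF eps] by (cases "i = 0") (auto simp: Near_def)
      have ny: "near_int \<epsilon> (g (y i) - g (y 0))" if "i < m" for i
        using xy(4) that near_int_0[OF eps] by (cases "i = 0") (auto simp: Near_def)
      have xB: "x i \<in> Bp (x 0)" if "i < m" for i
        using near_int_mono[OF nx[OF that], of "3 * \<epsilon>"] eps xy(1) that by (auto simp: Bp_def inj_tuples_def PiE_iff)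
      have yB: "y i \<in> Bp (x 0)" if "i < m" for i
      proof -
        \<comment> \<open>The path from \<open>y i\<close> over \<open>y 0\<close> and
          \<open>y b = x a\<close> to \<open>x 0\<close> has three edges; this is the origin of
          \<open>3 * \<epsilon>\<close>.\<close>
        have "near_int (\<epsilon> + \<epsilon> + \<epsilon>) ((g (y i) - g (y 0)) + - (g (y b) - g (y 0)) + (g (x a) - g (x 0)))"
          by (intro near_int_add near_int_minus nx ny that ab)
        then have "near_int (3 * \<epsilon>) (g (y i) - g (x 0))" using ab by simp
        then show ?thesis using xy(2) that by (auto simp: Bp_def inj_tuples_def PiE_iff)
      qed
      have "x 0 \<in> S" using xy(1) m by (auto simp: inj_tuples_def PiE_iff)
      moreover have "(x, y) \<in> R (x 0) a b"
        using xy(1,2) xB yB ab by (auto simp: R_def inj_tuples_def PiE_iff)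
      ultimately show "(x, y) \<in> (\<Union>p\<in>S. \<Union>a\<in>{..<m}. \<Union>b\<in>{..<m}. R p a b)" using ab by blast
    qed
    then have "card O' \<le> card (\<Union>p\<in>S. \<Union>a\<in>{..<m}. \<Union>b\<in>{..<m}. R p a b)"
      using S fR by (intro card_mono) auto
    also have "\<dots> \<le> (\<Sum>p\<in>S. card (\<Union>a\<in>{..<m}. \<Union>b\<in>{..<m}. R p a b))" by (rule card_UN_le[OF S])
    also have "\<dots> \<le> (\<Sum>p\<in>S. \<Sum>a<m. card (\<Union>b\<in>{..<m}. R p a b))" by (intro sum_mono card_UN_le) auto
    also have "\<dots> \<le> (\<Sum>p\<in>S. \<Sum>a<m. \<Sum>b<m. card (R p a b))" by (intro sum_mono card_UN_le) auto
    also have "\<dots> \<le> (\<Sum>p\<in>S. \<Sum>a<m. \<Sum>b<m. card (Bp p) ^ (2 * m - 2))"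
    proof (intro sum_mono)
      fix p a b assume "p \<in> S" "a \<in> {..<m}" "b \<in> {..<m}"
      moreover have "p \<in> Bp p" using \<open>p \<in> S\<close> eps near_int_0[of "3 * \<epsilon>"] by (simp add: Bp_def)
      ultimately show "card (R p a b) \<le> card (Bp p) ^ (2 * m - 2)"
        unfolding R_def using fBp m by (intro card_rooted_overlap) auto
    qed
    also have "\<dots> = (\<Sum>p\<in>S. m ^ 2 * card (Bp p) ^ (2 * m - 2))" by (simp add: power2_eq_square mult.assoc)
    finally have "real (card O') \<le> real (\<Sum>p\<in>S. m ^ 2 * card (Bp p) ^ (2 * m - 2))" by (rule of_nat_mono)
    then show ?thesis by simp
  qed
  \<comment> \<open>Roots with few neighbours account for the summand \<open>card S\<close>. The
    power of 2 compensates the factors \<open>1 / 2\<close> guaranteed by \<open>W\<close> at the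
    \<open>2 * m - 2\<close> edges.\<close>
  also have "(\<Sum>p\<in>S. real m ^ 2 * real (card (Bp p)) ^ (2 * m - 2)) \<le>
    real m ^ 2 * (4 * real m) ^ (2 * m) * (real (card S) + 2 ^ (2 * m) * correlation_sum W (2 * m - 1) S \<alpha>)"
  proof -
    define d where "d = 2 * m - 2"
    have dm: "2 * m - 1 = Suc d" "d \<le> 2 * m" "2 * real d + 2 \<le> 4 * real m" using m by (auto simp: d_def)
    define Z where "Z = (\<lambda>p. {z \<in> inj_tuples (Suc d) S. z 0 = p \<and> (\<forall>i\<in>{1..<Suc d}. z i \<in> Bp p - {p})})"
    have 1: "real (card (Bp p)) ^ d \<le> (4 * real m) ^ (2 * m) * (1 + real (card (Z p)))" if p: "p \<in> S" for p
    proof -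
      have pB: "p \<in> Bp p" using p eps near_int_0[of "3 * \<epsilon>"] by (simp add: Bp_def)
      then have c1: "card (Bp p) \<ge> 1" using fBp[of p] by (simp add: Suc_le_eq card_gt_0_iff) blast
      have "card (Z p) = (\<Prod>i=0..<d. card (Bp p - {p}) - i)"
        unfolding Z_def using p by (intro card_inj_tuples_root S) (auto simp: Bp_def)
      also have "card (Bp p - {p}) = card (Bp p) - 1" using fBp pB by simp
      finally have "real (card (Bp p)) ^ d \<le> (2 * real d + 2) ^ d * (1 + real (card (Z p)))"
        using power_le_falling_prod[OF c1, of d] by simp
      also have "\<dots> \<le> (4 * real m) ^ (2 * m) * (1 + real (card (Z p)))"
      proof (intro mult_right_mono)
        have "(2 * real d + 2) ^ d \<le> (4 * real m) ^ d" using dm by (intro power_mono) auto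
        also have "\<dots> \<le> (4 * real m) ^ (2 * m)" using dm m by (intro power_increasing) auto
        finally show "(2 * real d + 2) ^ d \<le> (4 * real m) ^ (2 * m)" .
      qed auto
      finally show ?thesis .
    qed
    have 2: "(\<Sum>p\<in>S. real (card (Z p))) \<le> 2 ^ (2 * m) * correlation_sum W (2 * m - 1) S \<alpha>"
    proof -
      have fZ: "finite (Z p)" for p unfolding Z_def using S by simp
      have "(\<Sum>p\<in>S. real (card (Z p))) = real (card (\<Union>p\<in>S. Z p))"
        using S fZ by (subst card_UN_disjoint) (auto simp: Z_def)
      also have "\<dots> = (\<Sum>z\<in>(\<Union>p\<in>S. Z p). 1)" by simp
      also have "\<dots> \<le> (\<Sum>z\<in>(\<Union>p\<in>S. Z p). 2 ^ (2 * m) * star_prod W (Suc d) z \<alpha>)"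
      proof (rule sum_mono)
        fix z assume "z \<in> (\<Union>p\<in>S. Z p)"
        then have z: "\<And>i. i \<in> {1..<Suc d} \<Longrightarrow> near_int (3 * \<epsilon>) (g (z i) - g (z 0))"
          by (auto simp: Z_def Bp_def)
        have "(1 / 2) ^ d = (\<Prod>i\<in>{1..<Suc d}. (1 / 2 :: real))" by simp
        also have "\<dots> \<le> star_prod W (Suc d) z \<alpha>"
          unfolding forest_prod_def using W(2)[OF z] by (intro prod_mono) (auto simp: g_def)
        finally have "2 ^ d * (1 / 2) ^ d \<le> 2 ^ d * star_prod W (Suc d) z \<alpha>"
          by (intro mult_left_mono) auto
        then have "1 \<le> 2 ^ d * star_prod W (Suc d) z \<alpha>" by (simp add: power_mult_distrib[symmetric])
        also have "\<dots> \<le> 2 ^ (2 * m) * star_prod W (Suc d) z \<alpha>"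
          using dm W by (intro mult_right_mono power_increasing forest_prod_nonneg) auto
        finally show "1 \<le> 2 ^ (2 * m) * star_prod W (Suc d) z \<alpha>" .
      qed
      also have "\<dots> \<le> (\<Sum>z\<in>inj_tuples (Suc d) S. 2 ^ (2 * m) * star_prod W (Suc d) z \<alpha>)"
        using S W by (intro sum_mono2) (auto simp: Z_def intro!: forest_prod_nonneg mult_nonneg_nonneg)
      finally show ?thesis unfolding correlation_sum_def dm(1) sum_distrib_left .
    qed
    have "(\<Sum>p\<in>S. real m ^ 2 * real (card (Bp p)) ^ d) \<le>
      (\<Sum>p\<in>S. real m ^ 2 * ((4 * real m) ^ (2 * m) * (1 + real (card (Z p)))))"
      by (intro sum_mono mult_left_mono 1) auto
    also have "\<dots> = real m ^ 2 * (4 * real m) ^ (2 * m) * (real (card S) + (\<Sum>p\<in>S. real (card (Z p))))"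
      by (simp add: sum_distrib_left[symmetric] sum.distrib mult.assoc)
    also have "\<dots> \<le> real m ^ 2 * (4 * real m) ^ (2 * m) * (real (card S) + 2 ^ (2 * m) * correlation_sum W (2 * m - 1) S \<alpha>)"
      using 2 by (intro mult_left_mono add_left_mono) auto
    finally show ?thesis by (simp add: d_def)
  qed
  finally show ?thesis by (simp add: F_def)
qed

section \<open>Integrating the squared deviation\<close>

lemma card_inj_tuples_le: "finite S \<Longrightarrow> card (inj_tuples k S) \<le> card S ^ k"
  using card_mono[of "{..<k} \<rightarrow>\<^sub>E S" "inj_tuples k S"]
  by (auto simp: inj_tuples_def card_funcsetE finite_PiE)

lemma sum_integral_close:
  fixes F :: "'a \<Rightarrow> real \<Rightarrow> real"
  assumes "finite I" and cont: "\<And>i. i \<in> I \<Longrightarrow> continuous_on {A..B} (F i)"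
    and e: "(\<Sum>i\<in>I. \<bar>integral {A..B} (F i) - c\<bar>) \<le> e"
  shows "\<bar>integral {A..B} (\<lambda>x. \<Sum>i\<in>I. F i x) - real (card I) * c\<bar> \<le> e"
proof -
  have "integral {A..B} (\<lambda>x. \<Sum>i\<in>I. F i x) - real (card I) * c = (\<Sum>i\<in>I. integral {A..B} (F i) - c)"
    using assms(1) cont by (subst integral_sum) (auto simp: sum_subtractf intro: integrable_continuous_real)
  then show ?thesis using sum_abs[of "\<lambda>i. integral {A..B} (F i) - c" I] e by linarith
qed

text \<open>Disjoint pairs reproduce the squared mean up to \<open>e1\<close>, and the cross term
  subtracts it twice up to \<open>e2\<close>. The main terms therefore cancel except for the share
  \<open>1 - card / N ^ m\<close> of tuples that are missing. For \<sigma> and \<tau> of order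
  \<open>1 / N\<close> the overlap is of order \<open>1 / N\<close>, apart from \<open>e3\<close>
  and \<open>\<eta>\<close>.\<close>

lemma second_moment_bound:
  assumes m: "m \<ge> 2" and S: "S \<subseteq> {1..N}" and w: "\<And>t. w t \<ge> 0" "\<And>t. w t \<le> 1"
    and far: "\<And>t. \<not> near_int \<epsilon> t \<Longrightarrow> w t \<le> \<eta>" and eps: "\<epsilon> \<ge> 0" and eta: "\<eta> \<ge> 0"
    and W: "\<And>t. W t \<ge> 0" "\<And>t. near_int (3 * \<epsilon>) t \<Longrightarrow> 1 / 2 \<le> W t"
    and cont: "continuous_on UNIV w" "continuous_on UNIV W"
    and AB: "A \<le> B" "B - A \<le> 1" and N: "N > 0" and sig: "\<sigma> \<ge> 0" "\<tau> \<ge> 0"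
    and e1: "(\<Sum>z\<in>inj_tuples (2 * m) S. \<bar>integral {A..B} (pair_prod w m z) -
        (B - A) * \<sigma> ^ (2 * m - 2)\<bar>) \<le> e1"
    and e2: "(\<Sum>x\<in>inj_tuples m S. \<bar>integral {A..B} (star_prod w m x) - (B - A) * \<sigma> ^ (m - 1)\<bar>) \<le> e2"
    and e3: "(\<Sum>x\<in>inj_tuples (2 * m - 1) S. \<bar>integral {A..B} (star_prod W (2 * m - 1) x) -
        (B - A) * \<tau> ^ (2 * m - 2)\<bar>) \<le> e3"
  shows "integral {A..B} (\<lambda>\<alpha>. (correlation_sum w m S \<alpha> / N - (N * \<sigma>) ^ (m - 1))\<^sup>2) \<le>
    2 * ((N * \<sigma>) ^ (m - 1))\<^sup>2 * (1 - card (inj_tuples m S) / real N ^ m) + e1 / real N ^ 2 +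
    2 * (N * \<sigma>) ^ (m - 1) * e2 / N + \<eta> * real N ^ (2 * m) +
    real m ^ 2 * (4 * real m) ^ (2 * m) * (N + 2 ^ (2 * m) * (real N ^ (2 * m - 1) * \<tau> ^ (2 * m - 2) + e3)) / real N ^ 2"
proof -
  have fS: "finite S" using S finite_subset by blast
  have cS: "card S \<le> N" using card_mono[OF _ S] by simp
  define \<mu> where "\<mu> = (N * \<sigma>) ^ (m - 1)"
  have mu0: "\<mu> \<ge> 0" using sig by (simp add: \<mu>_def)
  have pos: "z i > 0" if "z \<in> inj_tuples k S" "i < k" for z k i
    using that S by (fastforce simp: inj_tuples_def PiE_iff subset_iff Suc_le_eq)
  have c1: "continuous_on {A..B} (pair_prod w m z)" if "z \<in> inj_tuples (2 * m) S" for z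
    using m by (intro continuous_on_forest_prod cont) (auto intro!: pos[OF that] simp: pair_par_def)
  have c2: "continuous_on {A..B} (star_prod w m z)" if "z \<in> inj_tuples m S" for z
    using m by (intro continuous_on_forest_prod cont) (auto intro!: pos[OF that])
  have c3: "continuous_on {A..B} (star_prod W (2 * m - 1) z)" if "z \<in> inj_tuples (2 * m - 1) S" for z
    using m by (intro continuous_on_forest_prod cont) (auto intro!: pos[OF that])
  have cw: "continuous_on {A..B} (correlation_sum w m S)"
    unfolding correlation_sum_def by (intro continuous_on_sum c2)
  have cW: "continuous_on {A..B} (correlation_sum W (2 * m - 1) S)"
    unfolding correlation_sum_def by (intro continuous_on_sum c3)
  define G where "G = (\<lambda>\<alpha>. \<Sum>z\<in>inj_tuples (2 * m) S. pair_prod w m z \<alpha>)"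
  have cG: "continuous_on {A..B} G" unfolding G_def by (intro continuous_on_sum c1)
  have iG: "integral {A..B} G \<le> real N ^ (2 * m) * ((B - A) * \<sigma> ^ (2 * m - 2)) + e1"
  proof -
    have "\<bar>integral {A..B} G - real (card (inj_tuples (2 * m) S)) * ((B - A) * \<sigma> ^ (2 * m - 2))\<bar> \<le> e1"
      unfolding G_def using fS by (intro sum_integral_close c1 e1) auto
    moreover have "real (card (inj_tuples (2 * m) S)) * ((B - A) * \<sigma> ^ (2 * m - 2)) \<le> real N ^ (2 * m) * ((B - A) * \<sigma> ^ (2 * m - 2))"
    proof (intro mult_right_mono)
      have "card (inj_tuples (2 * m) S) \<le> N ^ (2 * m)"
        using card_inj_tuples_le[OF fS, of "2 * m"] power_mono[OF cS, of "2 * m"] by simp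
      then show "real (card (inj_tuples (2 * m) S)) \<le> real N ^ (2 * m)" by (simp flip: of_nat_power)
    qed (use AB sig in auto)
    ultimately show ?thesis by linarith
  qed
  have iW: "integral {A..B} (correlation_sum W (2 * m - 1) S) \<le> real N ^ (2 * m - 1) * \<tau> ^ (2 * m - 2) + e3"
  proof -
    have "\<bar>integral {A..B} (correlation_sum W (2 * m - 1) S) - real (card (inj_tuples (2 * m - 1) S)) * ((B - A) * \<tau> ^ (2 * m - 2))\<bar> \<le> e3"
      unfolding correlation_sum_def using fS by (intro sum_integral_close c3 e3) auto
    moreover have "real (card (inj_tuples (2 * m - 1) S)) * ((B - A) * \<tau> ^ (2 * m - 2)) \<le> real N ^ (2 * m - 1) * (1 * \<tau> ^ (2 * m - 2))"
    proof (intro mult_mono)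
      have "card (inj_tuples (2 * m - 1) S) \<le> N ^ (2 * m - 1)"
        using card_inj_tuples_le[OF fS, of "2 * m - 1"] power_mono[OF cS, of "2 * m - 1"] by simp
      then show "real (card (inj_tuples (2 * m - 1) S)) \<le> real N ^ (2 * m - 1)" by (simp flip: of_nat_power)
    qed (use AB sig in auto)
    ultimately show ?thesis by linarith
  qed
  have iw: "integral {A..B} (correlation_sum w m S) \<ge> card (inj_tuples m S) * ((B - A) * \<sigma> ^ (m - 1)) - e2"
  proof -
    have "\<bar>integral {A..B} (correlation_sum w m S) - real (card (inj_tuples m S)) * ((B - A) * \<sigma> ^ (m - 1))\<bar> \<le> e2"
      unfolding correlation_sum_def using fS by (intro sum_integral_close c2 e2) auto
    then show ?thesis by linarith
  qed
  define C where "C = real m ^ 2 * (4 * real m) ^ (2 * m)"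
  have C0: "C \<ge> 0" by (simp add: C_def)
  \<comment> \<open>The overlap estimate is pointwise in \<alpha>, so all pieces are assembled
    before integrating. The plain correlation sum enters with a minus sign, which is why the lower
    bound \<open>iw\<close> is needed for it.\<close>
  have pt: "(correlation_sum w m S \<alpha> / N - \<mu>)\<^sup>2 \<le>
    G \<alpha> / real N ^ 2 + (\<eta> * real N ^ (2 * m) + C * N / real N ^ 2 + \<mu>\<^sup>2) + C * 2 ^ (2 * m) / real N ^ 2 * correlation_sum W (2 * m - 1) S \<alpha>
     - 2 * \<mu> / N * correlation_sum w m S \<alpha>" (is "_ \<le> ?R \<alpha>") for \<alpha>
  proof -
    have "(\<Sum>(x, y)\<in>overlapping m S. star_prod w m x \<alpha> * star_prod w m y \<alpha>) \<le>
      \<eta> * real (card S) ^ (2 * m) + C * (real (card S) + 2 ^ (2 * m) * correlation_sum W (2 * m - 1) S \<alpha>)"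
      unfolding C_def by (rule overlap_sum_le[OF m fS w far eps eta W])
    also have "\<dots> \<le> \<eta> * real N ^ (2 * m) + C * (real N + 2 ^ (2 * m) * correlation_sum W (2 * m - 1) S \<alpha>)"
      using cS eta C0 by (intro add_mono mult_left_mono power_mono) auto
    finally have "(correlation_sum w m S \<alpha>)\<^sup>2 \<le> G \<alpha> + (\<eta> * real N ^ (2 * m) + C * (real N + 2 ^ (2 * m) * correlation_sum W (2 * m - 1) S \<alpha>))"
      using correlation_sum_square[of m S w \<alpha>] fS m unfolding G_def by simp
    then have h1: "(correlation_sum w m S \<alpha>)\<^sup>2 / real N ^ 2 \<le> (G \<alpha> + (\<eta> * real N ^ (2 * m) + C * (real N + 2 ^ (2 * m) * correlation_sum W (2 * m - 1) S \<alpha>))) / real N ^ 2"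
      by (intro divide_right_mono) auto
    have h2: "\<eta> * real N ^ (2 * m) / real N ^ 2 \<le> \<eta> * real N ^ (2 * m)"
    proof -
      have "\<eta> * real N ^ (2 * m) * 1 \<le> \<eta> * real N ^ (2 * m) * real N ^ 2"
        using N eta by (intro mult_left_mono one_le_power) auto
      then show ?thesis using N by (simp add: divide_le_eq)
    qed
    have h3: "(correlation_sum w m S \<alpha> / N - \<mu>)\<^sup>2 = (correlation_sum w m S \<alpha>)\<^sup>2 / real N ^ 2 + \<mu>\<^sup>2 - 2 * \<mu> / N * correlation_sum w m S \<alpha>"
      by (simp add: power2_diff power_divide)
    have h4: "(G \<alpha> + (\<eta> * real N ^ (2 * m) + C * (real N + 2 ^ (2 * m) * correlation_sum W (2 * m - 1) S \<alpha>))) / real N ^ 2 =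
      G \<alpha> / real N ^ 2 + \<eta> * real N ^ (2 * m) / real N ^ 2 + C * real N / real N ^ 2 +
      C * 2 ^ (2 * m) / real N ^ 2 * correlation_sum W (2 * m - 1) S \<alpha>"
      by (simp only: add_divide_distrib distrib_left times_divide_eq_left mult.assoc add.assoc)
    have "p + u - q \<le> g + (t' + cn + u) + cw - q"
      if "p \<le> r" "t \<le> t'" "r = g + t + cn + cw" for p u q r t t' g cn cw :: real using that by simp
    from this[OF h1 h2 h4] show ?thesis unfolding h3 .
  qed
  have "integral {A..B} (\<lambda>\<alpha>. (correlation_sum w m S \<alpha> / N - \<mu>)\<^sup>2) \<le> integral {A..B} ?R"
  proof (rule integral_le)
    show "(\<lambda>\<alpha>. (correlation_sum w m S \<alpha> / N - \<mu>)\<^sup>2) integrable_on {A..B}"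
      using N by (intro integrable_continuous_real continuous_intros cw) auto
    show "?R integrable_on {A..B}"
      using N by (intro integrable_continuous_real continuous_intros cw cW cG) auto
  qed (rule pt)
  also have "integral {A..B} ?R =
    integral {A..B} G / real N ^ 2 + (B - A) * (\<eta> * real N ^ (2 * m) + C * N / real N ^ 2 + \<mu>\<^sup>2) +
    C * 2 ^ (2 * m) / real N ^ 2 * integral {A..B} (correlation_sum W (2 * m - 1) S) - 2 * \<mu> / N * integral {A..B} (correlation_sum w m S)"
  proof -
    have i: "G integrable_on {A..B}" "correlation_sum W (2 * m - 1) S integrable_on {A..B}" "correlation_sum w m S integrable_on {A..B}"
      using cG cW cw by (auto intro: integrable_continuous_real)
    have "(?R has_integral (integral {A..B} G / real N ^ 2 + (B - A) *\<^sub>R (\<eta> * real N ^ (2 * m) + C * N / real N ^ 2 + \<mu>\<^sup>2) +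
      C * 2 ^ (2 * m) / real N ^ 2 * integral {A..B} (correlation_sum W (2 * m - 1) S) - 2 * \<mu> / N * integral {A..B} (correlation_sum w m S))) {A..B}"
      using AB has_integral_const_real[of "\<eta> * real N ^ (2 * m) + C * N / real N ^ 2 + \<mu>\<^sup>2" A B]
      by (intro has_integral_add has_integral_diff has_integral_divide has_integral_mult_right integrable_integral i) simp
    then show ?thesis by (simp add: integral_unique)
  qed
  also have "\<dots> \<le> (real N ^ (2 * m) * ((B - A) * \<sigma> ^ (2 * m - 2)) + e1) / real N ^ 2 +
    ((\<eta> * real N ^ (2 * m) + C * N / real N ^ 2) + (B - A) * \<mu>\<^sup>2) +
    C * 2 ^ (2 * m) / real N ^ 2 * (real N ^ (2 * m - 1) * \<tau> ^ (2 * m - 2) + e3) -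
    2 * \<mu> / N * (card (inj_tuples m S) * ((B - A) * \<sigma> ^ (m - 1)) - e2)"
  proof (intro add_mono diff_mono divide_right_mono iG mult_left_mono iW iw)
    have "(B - A) * (\<eta> * real N ^ (2 * m) + C * N / real N ^ 2) \<le> 1 * (\<eta> * real N ^ (2 * m) + C * N / real N ^ 2)"
      using AB eta C0 by (intro mult_right_mono) auto
    then show "(B - A) * (\<eta> * real N ^ (2 * m) + C * N / real N ^ 2 + \<mu>\<^sup>2) \<le> \<eta> * real N ^ (2 * m) + C * N / real N ^ 2 + (B - A) * \<mu>\<^sup>2"
      by (simp add: distrib_left)
  qed (use C0 mu0 in auto)
  also have "real N ^ (2 * m) * ((B - A) * \<sigma> ^ (2 * m - 2)) = (B - A) * \<mu>\<^sup>2 * real N ^ 2"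
  proof -
    have "\<mu>\<^sup>2 = real N ^ (2 * m - 2) * \<sigma> ^ (2 * m - 2)"
    proof -
      have "2 * m - 2 = (m - 1) * 2" using m by simp
      then show ?thesis unfolding \<mu>_def by (simp only: power_mult power_mult_distrib)
    qed
    moreover have "real N ^ (2 * m) = real N ^ (2 * m - 2) * real N ^ 2"
    proof -
      have "2 * m = (2 * m - 2) + 2" using m by simp
      then show ?thesis by (metis power_add)
    qed
    ultimately show ?thesis by simp
  qed
  also have "card (inj_tuples m S) * ((B - A) * \<sigma> ^ (m - 1)) = (B - A) * \<mu> * (card (inj_tuples m S) / real N ^ m * N)"
  proof -
    have "real N ^ m = real N ^ (m - 1) * N" using m by (simp add: power_eq_if[of _ m])
    then show ?thesis using N by (simp add: \<mu>_def power_mult_distrib field_simps)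
  qed
  finally have fin: "integral {A..B} (\<lambda>\<alpha>. (correlation_sum w m S \<alpha> / N - \<mu>)\<^sup>2) \<le>
    ((B - A) * \<mu>\<^sup>2 * real N ^ 2 + e1) / real N ^ 2 +
    ((\<eta> * real N ^ (2 * m) + C * N / real N ^ 2) + (B - A) * \<mu>\<^sup>2) +
    C * 2 ^ (2 * m) / real N ^ 2 * (real N ^ (2 * m - 1) * \<tau> ^ (2 * m - 2) + e3) -
    2 * \<mu> / N * ((B - A) * \<mu> * (card (inj_tuples m S) / real N ^ m * N) - e2)" .
  \<comment> \<open>Here \<open>\<mu>\<^sup>2 + \<mu>\<^sup>2\<close> from the square meets the
    cross term, leaving only the share of missing tuples.\<close>
  also have "\<dots> = (B - A) * (2 * \<mu>\<^sup>2 * (1 - card (inj_tuples m S) / real N ^ m)) + e1 / real N ^ 2 + 2 * \<mu> * e2 / N + \<eta> * real N ^ (2 * m) +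
    C * (N + 2 ^ (2 * m) * (real N ^ (2 * m - 1) * \<tau> ^ (2 * m - 2) + e3)) / real N ^ 2"
    using N by (simp add: field_simps power2_eq_square)
  also have "(B - A) * (2 * \<mu>\<^sup>2 * (1 - card (inj_tuples m S) / real N ^ m)) \<le> 1 * (2 * \<mu>\<^sup>2 * (1 - card (inj_tuples m S) / real N ^ m))"
  proof (intro mult_right_mono mult_nonneg_nonneg)
    have "card (inj_tuples m S) \<le> N ^ m"
      using card_inj_tuples_le[OF fS, of m] power_mono[OF cS, of m] by simp
    then have "real (card (inj_tuples m S)) \<le> real N ^ m" by (simp flip: of_nat_power)
    then show "0 \<le> 1 - card (inj_tuples m S) / real N ^ m" using N by (simp add: divide_le_eq)
  qed (use AB in auto)
  finally show ?thesis by (simp add: \<mu>_def C_def)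
qed

section \<open>Almost sure convergence along a polynomial subsequence\<close>

text \<open>For \<open>N = j ^ B\<close> the numbers \<open>N powr (1 / B) = j\<close> and \<open>j\<^sup>2\<close> are small powers of \<open>N\<close>, losses by which
  are harmless, while \<open>1 / j\<^sup>2\<close> is summable and consecutive values of \<open>N\<close> have ratio tending to 1.\<close>

definition block :: "nat \<Rightarrow> nat \<Rightarrow> nat set" where
  "block B j = {j ^ (B - 2)<..j ^ B}"

text \<open>Endpoints are measured in units of the mean spacing \<open>1 / N\<close>,
  \<open>N = j ^ B\<close>. The degree \<open>N ^ 3\<close> is large enough to resolve a margin
  \<open>r / N\<close>, the tail exponent being \<open>N ^ 3 * (r / N) ^ 2 = N * r ^ 2\<close>,
  while it enters coefficient sums only through a logarithm.\<close>

definition scaled_window :: "nat \<Rightarrow> nat \<Rightarrow> real \<Rightarrow> real \<Rightarrow> real \<Rightarrow> real" where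
  "scaled_window B j a b = window (j ^ (3 * B)) (a / real (j ^ B)) (b / real (j ^ B))"

text \<open>The right-hand side of \<open>sum_forest_prod_integral\<close> for windows of length
  \<open>c / N\<close> with \<open>N = j ^ B\<close>, \<open>E = j\<close> and lower index bound
  \<open>j ^ (B - 2)\<close>.\<close>

definition oscillation_error :: "nat \<Rightarrow> real \<Rightarrow> nat \<Rightarrow> real \<Rightarrow> nat \<Rightarrow> real" where
  "oscillation_error B A k c j = 17 * 4 ^ k * real j * real (j ^ (B - 2)) powr (- A / k) *
     (c / real (j ^ B)) powr (1 / k) * (1 + 2 * harm (j ^ (3 * B))) ^ k * (real k * (4 * real (j ^ B)) ^ k)"

lemma sum_oscillation_error:
  assumes k: "k \<ge> 2" and B: "B \<ge> 3" and j: "j \<ge> 3" and A: "0 \<le> A"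
    and Q: "Q \<subseteq> {..<k}" "\<And>i. i \<in> Q \<Longrightarrow> par i < k \<and> par i \<notin> Q"
    and ab: "a < b" "b - a \<le> real (j ^ B)"
  shows "(\<Sum>z\<in>inj_tuples k (block B j). \<bar>integral {A..A + 1 / B} (forest_prod (scaled_window B j a b) Q par z) -
      (A + 1 / B - A) * ((b - a) / real (j ^ B)) ^ card Q\<bar>) \<le> oscillation_error B A k (b - a) j"
proof -
  have N: "real (j ^ B) > 0" using j by simp
  have "(\<Sum>z\<in>inj_tuples k (block B j). \<bar>integral {A..A + 1 / B} (forest_prod (scaled_window B j a b) Q par z) -
      (A + 1 / B - A) * (b / real (j ^ B) - a / real (j ^ B)) ^ card Q\<bar>) \<le>
    17 * 4 ^ k * real j * real (j ^ (B - 2)) powr (- A / k) *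
     (b / real (j ^ B) - a / real (j ^ B)) powr (1 / k) * (1 + 2 * harm (j ^ (3 * B))) ^ k * (real k * (4 * real (j ^ B)) ^ k)"
    unfolding scaled_window_def
  proof (rule sum_forest_prod_integral[OF k])
    fix n assume n: "n \<in> block B j"
    have "j ^ 1 \<le> j ^ (B - 2)" using B j by (intro power_increasing) auto
    then have "3 \<le> n" "j ^ (B - 2) \<le> n" "n \<le> j ^ B" using n j by (auto simp: block_def)
    then show "3 \<le> n \<and> real (j ^ (B - 2)) \<le> real n \<and> n \<le> j ^ B" by linarith
  next
    have "1 \<le> j ^ (B - 2)" using j by (intro one_le_power) auto
    then show "1 \<le> real (j ^ (B - 2))" by linarith
  next
    \<comment> \<open>An interval of length \<open>1 / B\<close> lets the exponentials grow by a
      factor \<open>N powr (1 / B) = j\<close> at most.\<close>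
    have "real (j ^ B) powr (A + 1 / B - A) = (real j powr real B) powr (1 / B)"
      using j by (simp add: powr_realpow)
    also have "\<dots> = real j" using j B by (simp add: powr_powr)
    finally show "real (j ^ B) powr (A + 1 / B - A) \<le> real j" by simp
  qed (use A Q ab N in \<open>auto simp: divide_strict_right_mono divide_le_eq simp flip: diff_divide_distrib\<close>)
  then show ?thesis unfolding oscillation_error_def diff_divide_distrib .
qed

lemma harm_le_ln_plus_1:
  assumes "n > 0"
  shows "harm n \<le> ln (real n) + 1"
proof -
  have "harm (Suc (n - 1)) - ln (real (Suc (n - 1))) \<le> harm (Suc 0) - ln (real (Suc 0))"
    using decseq_harm_diff_ln unfolding decseq_def by blast
  then show ?thesis using assms by (simp add: harm_Suc harm_expand)
qed

text \<open>A count of powers of \<open>j\<close>, multiplied by \<open>k\<close>. In the exponent,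
  1 comes from \<open>E\<close>, \<open>k\<close> from the logarithms and \<open>B * k\<close> from
  the \<open>N ^ k\<close> tuples; \<open>(B - 2) * A / k\<close> is gained from the size of the
  points and \<open>B / k\<close> from the window length.\<close>

lemma oscillation_error_bound:
  assumes k: "k \<ge> 1" and B: "B \<ge> 3" and c: "c > 0"
    and e: "real k * (1 + k + B * k) - ((real B - 2) * A + B) \<le> real k * s"
  shows "\<exists>C\<ge>0. \<forall>j\<ge>3. oscillation_error B A k c j \<le> C * real j powr s"
proof -
  define C where "C = 17 * 4 ^ k * c powr (1 / k) * (9 * real B) ^ k * (real k * 4 ^ k)"
  have "oscillation_error B A k c j \<le> C * real j powr s" if j: "j \<ge> 3" for j
  proof -
    have j1: "real j \<ge> 1" "real j > 0" using j by auto
    \<comment> \<open>Bounding the logarithm by a multiple of \<open>j\<close> is crude but costs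
      only the fixed power \<open>j ^ k\<close>.\<close>
    have L: "1 + 2 * harm (j ^ (3 * B)) \<le> 9 * real B * real j"
    proof -
      have "harm (j ^ (3 * B)) \<le> ln (real (j ^ (3 * B))) + (1::real)"
        using j by (intro harm_le_ln_plus_1) simp
      also have "ln (real (j ^ (3 * B))) = 3 * real B * ln (real j)"
        using j by (simp add: ln_realpow)
      also have "\<dots> \<le> 3 * real B * (real j - 1)"
        using j1 by (intro mult_left_mono ln_le_minus_one) auto
      finally have "1 + 2 * harm (j ^ (3 * B)) \<le> 6 * real B * real j + (3 - 6 * real B)"
        by (simp add: algebra_simps)
      also have "\<dots> \<le> 6 * real B * real j + 3 * (real B * real j)"
      proof -
        have "3 - 6 * real B \<le> 0" "0 \<le> real B * real j" using B by auto
        then show ?thesis by linarith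
      qed
      also have "\<dots> = 9 * real B * real j" by simp
      finally show ?thesis .
    qed
    have "oscillation_error B A k c j \<le> 17 * 4 ^ k * real j * real (j ^ (B - 2)) powr (- A / k) *
     (c / real (j ^ B)) powr (1 / k) * (9 * real B * real j) ^ k * (real k * (4 * real (j ^ B)) ^ k)"
      unfolding oscillation_error_def
      by (intro mult_right_mono mult_left_mono power_mono L) (auto simp: harm_nonneg)
    also have "\<dots> = C * (real j * real (j ^ (B - 2)) powr (- A / k) * (1 / real (j ^ B)) powr (1 / k) * real j ^ k * real (j ^ B) ^ k)"
      using c by (simp add: C_def power_mult_distrib powr_divide)
    also have "real j * real (j ^ (B - 2)) powr (- A / k) * (1 / real (j ^ B)) powr (1 / k) * real j ^ k * real (j ^ B) ^ k =
      real j powr (1 + (real B - 2) * (- A / k) + (- real B * (1 / k)) + k + B * k)"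
    proof -
      have 1: "real (j ^ (B - 2)) powr (- A / k) = real j powr ((real B - 2) * (- A / k))"
        using j1 B by (simp add: powr_realpow[symmetric] powr_powr of_nat_diff)
      have 2: "(1 / real (j ^ B)) powr (1 / k) = real j powr (- real B * (1 / k))"
        using j1 by (simp add: powr_realpow[symmetric] powr_divide powr_powr powr_minus_divide)
      have 3: "real (j ^ B) ^ k = real j powr (real B * k)"
        using j1 by (simp add: powr_realpow[symmetric] powr_powr)
      have 4: "real j ^ k = real j powr real k" "real j = real j powr 1" using j1 by (auto simp: powr_realpow)
      show ?thesis unfolding 1 2 3 4(1) powr_add using j1 by simp
    qed
    also have "C * \<dots> \<le> C * real j powr s"
    proof (intro mult_left_mono powr_mono)
      have "real k * (1 + (real B - 2) * (- A / k) + (- real B * (1 / k)) + k + B * k) =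
        real k * (1 + k + B * k) - ((real B - 2) * A + B)"
        using k by (simp add: field_simps)
      then have "real k * (1 + (real B - 2) * (- A / k) + (- real B * (1 / k)) + k + B * k) \<le> real k * s"
        using e by simp
      then show "1 + (real B - 2) * (- A / k) + (- real B * (1 / k)) + k + B * k \<le> s"
        using k by simp
    qed (use j1 c in \<open>auto simp: C_def\<close>)
    finally show ?thesis .
  qed
  moreover have "C \<ge> 0" using c by (simp add: C_def)
  ultimately show ?thesis by blast
qed

lemma exp_minus_le_fact:
  fixes x :: real
  assumes "x > 0"
  shows "exp (- x) \<le> fact n / x ^ n"
proof -
  have "x ^ n / fact n \<le> exp x"
  proof -
    have "(\<Sum>i\<in>{n}. x ^ i /\<^sub>R fact i) \<le> (\<Sum>i. x ^ i /\<^sub>R fact i)"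
      using assms by (intro sum_le_suminf summable_exp_generic) auto
    then show ?thesis by (simp add: exp_def divide_inverse mult.commute)
  qed
  then show ?thesis using assms by (simp add: exp_minus field_simps)
qed

lemma scaled_window_props:
  assumes ab: "a < b" "b - a \<le> real (j ^ B)" and j: "j \<ge> 1"
  shows "scaled_window B j a b t \<ge> 0" "scaled_window B j a b t \<le> 1" "continuous_on UNIV (scaled_window B j a b)"
    and "\<bar>a\<bar> \<le> X \<Longrightarrow> \<bar>b\<bar> \<le> X \<Longrightarrow> r > 0 \<Longrightarrow> \<not> near_int ((X + r) / real (j ^ B)) t \<Longrightarrow>
      scaled_window B j a b t \<le> 2 * real (j ^ B) ^ 3 * exp (- (real (j ^ B) * r\<^sup>2))"
    and "r > 0 \<Longrightarrow> (a + r) / real (j ^ B) \<le> t - of_int n \<Longrightarrow> t - of_int n \<le> (b - r) / real (j ^ B) \<Longrightarrow>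
      1 - 2 * real (j ^ B) ^ 3 * exp (- (real (j ^ B) * r\<^sup>2)) \<le> scaled_window B j a b t"
proof -
  define N where "N = real (j ^ B)"
  have N: "N > 0" using j by (simp add: N_def)
  have w: "scaled_window B j a b = window (j ^ (3 * B)) (a / N) (b / N)"
    by (simp add: scaled_window_def N_def)
  have "(b - a) / N \<le> 1" using ab N by (simp add: N_def)
  then have le: "a / N \<le> b / N" "b / N \<le> a / N + 1"
    using ab N by (auto simp: divide_right_mono diff_divide_distrib)
  have H: "real (j ^ (3 * B)) = N ^ 3" "j ^ (3 * B) > 0"
    using j by (auto simp: N_def power_mult[symmetric] mult.commute)
  have HN: "N ^ 3 * (r / N)\<^sup>2 = N * r\<^sup>2" for r using N by (simp add: power2_eq_square power3_eq_cube)
  show "scaled_window B j a b t \<ge> 0" "scaled_window B j a b t \<le> 1" "continuous_on UNIV (scaled_window B j a b)"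
    unfolding w using le by (auto simp: window_nonneg window_le_1 continuous_on_window)
  show "scaled_window B j a b t \<le> 2 * real (j ^ B) ^ 3 * exp (- (real (j ^ B) * r\<^sup>2))"
    if X: "\<bar>a\<bar> \<le> X" "\<bar>b\<bar> \<le> X" and r: "r > 0" and t: "\<not> near_int ((X + r) / real (j ^ B)) t"
  proof -
    have "window (j ^ (3 * B)) (a / N) (b / N) t \<le> 2 * real (j ^ (3 * B)) * exp (- (real (j ^ (3 * B)) * (r / N)\<^sup>2))"
    proof (rule window_far[OF H(2) _ le])
      fix z and n :: int assume z: "z \<in> {a / N..b / N}"
      have "\<bar>z\<bar> \<le> X / N"
      proof -
        have "- (X / N) \<le> a / N" using X N by (simp add: field_simps)
        moreover have "b / N \<le> X / N" using X N by (simp add: divide_right_mono)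
        ultimately show ?thesis using z by auto
      qed
      moreover have "(X + r) / N < \<bar>t - of_int n\<bar>" using t by (auto simp: near_int_def N_def not_le)
      ultimately show "r / N \<le> \<bar>t - z - of_int n\<bar>" by (simp add: add_divide_distrib)
    qed (use r N in auto)
    then show ?thesis unfolding w H HN by (simp add: N_def)
  qed
  show "1 - 2 * real (j ^ B) ^ 3 * exp (- (real (j ^ B) * r\<^sup>2)) \<le> scaled_window B j a b t"
    if r: "r > 0" and t: "(a + r) / real (j ^ B) \<le> t - of_int n" "t - of_int n \<le> (b - r) / real (j ^ B)"
  proof -
    have "1 - 2 * real (j ^ (3 * B)) * exp (- (real (j ^ (3 * B)) * (r / N)\<^sup>2)) \<le> window (j ^ (3 * B)) (a / N) (b / N) t"
      using t r N by (intro window_near[OF H(2) _ le, of "r / N" t n]) (auto simp: N_def add_divide_distrib diff_divide_distrib)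
    then show ?thesis unfolding w H HN by (simp add: N_def)
  qed
qed

text \<open>Each entry loses a proportion \<open>1 / j ^ 2\<close> to the indices below the block
  and at most \<open>m / N\<close> to distinctness; Bernoulli's inequality adds these losses
  up.\<close>

lemma card_inj_tuples_block_lower:
  assumes B: "B \<ge> 2" and j: "j \<ge> 1" and big: "(1 + real m) \<le> real j ^ 2"
  shows "1 - real (card (inj_tuples m (block B j))) / real (j ^ B) ^ m \<le> real m * (1 + real m) / real j ^ 2"
proof -
  define N where "N = real (j ^ B)"
  have N: "N > 0" using j by (simp add: N_def)
  have Nj: "real j ^ 2 \<le> N" unfolding N_def of_nat_power using B j by (intro power_increasing) auto
  have Bj: "real (j ^ (B - 2)) = N / real j ^ 2"
    unfolding N_def of_nat_power using B j by (intro power_diff) auto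
  have le: "j ^ (B - 2) \<le> j ^ B" using j by (intro power_increasing) auto
  have cb: "real (card (block B j)) = N - N / real j ^ 2"
    using le Bj by (simp add: block_def N_def of_nat_diff)
  have "card (inj_tuples m (block B j)) = (\<Prod>i=0..<m. card (block B j) - i)"
    using card_inj_on_subset_funcset[of "{..<m}" "block B j" "{..<m}"] by (simp add: inj_tuples_def block_def)
  then have "real (card (inj_tuples m (block B j))) / N ^ m = (\<Prod>i=0..<m. real (card (block B j) - i) / N)"
    by (simp add: prod_dividef)
  also have "\<dots> \<ge> (\<Prod>i=0..<m. 1 + - ((1 + real m) / real j ^ 2))"
  proof (intro prod_mono conjI)
    fix i assume i: "i \<in> {0..<m}"
    show "0 \<le> 1 + - ((1 + real m) / real j ^ 2)" using big j by (simp add: divide_le_eq)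
    have "N - N / real j ^ 2 - real m \<le> real (card (block B j) - i)" using cb i by auto
    then have "(N - N / real j ^ 2 - real m) / N \<le> real (card (block B j) - i) / N"
      using N by (intro divide_right_mono) auto
    moreover have "(N - N / real j ^ 2 - real m) / N = 1 - 1 / real j ^ 2 - real m / N"
      using N by (simp add: field_simps)
    moreover have "real m / N \<le> real m / real j ^ 2" using Nj N j by (intro divide_left_mono mult_pos_pos) auto
    ultimately show "1 + - ((1 + real m) / real j ^ 2) \<le> real (card (block B j) - i) / N"
      by (simp add: add_divide_distrib)
  qed
  finally have "(1 + - ((1 + real m) / real j ^ 2)) ^ m \<le> real (card (inj_tuples m (block B j))) / N ^ m" by simp
  moreover have "1 + real m * (- ((1 + real m) / real j ^ 2)) \<le> (1 + - ((1 + real m) / real j ^ 2)) ^ m"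
    using big j by (intro Bernoulli_inequality) (simp add: divide_le_eq)
  ultimately show ?thesis by (simp add: N_def)
qed

text \<open>Assumption \<open>AB\<close> is the exponent count of
  \<open>oscillation_error_bound\<close> for \<open>k = 2 * M\<close> and target
  \<open>N ^ 2 / j ^ 2\<close>, the most demanding of the mean values that occur. All error terms
  then share the order \<open>1 / j ^ 2\<close>, which is summable.\<close>

lemma second_moment_decay:
  assumes m: "2 \<le> m" "m \<le> M" and B: "B \<ge> 3" and A: "A \<ge> 0" and ab: "a < b"
    and AB: "real B * (4 * real M ^ 2 - 4 * real M) + 2 * real M * (2 * real M + 3) \<le> real B * (A + 1) - 2 * A"
  shows "\<exists>C. \<forall>\<^sub>F j in sequentially. integral {A..A + 1 / B}
    (\<lambda>\<alpha>. (correlation_sum (scaled_window B j a b) m (block B j) \<alpha> / real (j ^ B) - (b - a) ^ (m - 1))\<^sup>2) \<le> C / real j ^ 2"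
proof -
  define X where "X = max \<bar>a\<bar> \<bar>b\<bar>"
  \<comment> \<open>The wide window has to cover \<open>3 * (X + 1) / N\<close>, three times the
    reach of the original window with margin 1, and needs a margin 1 of its own.\<close>
  define Y where "Y = 3 * (X + 1) + 1"
  have X: "\<bar>a\<bar> \<le> X" "\<bar>b\<bar> \<le> X" "X \<ge> 0" by (auto simp: X_def)
  have Y: "Y > 0" using X by (simp add: Y_def)
  have kM: "real k * (real k + 3) \<le> 2 * real M * (2 * real M + 3)" if "k \<le> 2 * M" for k
  proof -
    have "real k \<le> 2 * real M" using that by linarith
    then show ?thesis by (intro mult_mono) auto
  qed
  \<comment> \<open>Target for the disjoint pairs and for the first moment with
    \<open>2 * m - 1\<close> points: both are divided by \<open>N ^ 2\<close> in
    \<open>second_moment_bound\<close>.\<close>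
  have osc2: "\<exists>C\<ge>0. \<forall>j\<ge>3. oscillation_error B A k c j \<le> C * real j powr (2 * real B - 2)"
    if "c > 0" "2 \<le> k" "k \<le> 2 * M" for k c
  proof (rule oscillation_error_bound)
    have "real k * (real k - 2) \<le> 2 * real M * (2 * real M - 2)" using that by (intro mult_mono) auto
    then have "real B * (real k * (real k - 2)) \<le> real B * (4 * real M ^ 2 - 4 * real M)"
      by (intro mult_left_mono) (auto simp: algebra_simps power2_eq_square)
    then show "real k * (1 + k + B * k) - ((real B - 2) * A + B) \<le> real k * (2 * real B - 2)"
      using AB kM[OF that(3)] by (simp add: algebra_simps)
  qed (use that B in auto)
  \<comment> \<open>Target for the cross term, which is divided by \<open>N\<close> only. One fewer
    point is allowed in exchange, and \<open>m \<le> 2 * M - 1\<close> holds amply.\<close>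
  have osc1: "\<exists>C\<ge>0. \<forall>j\<ge>3. oscillation_error B A k c j \<le> C * real j powr (real B - 2)"
    if "c > 0" "2 \<le> k" "k \<le> 2 * M - 1" for k c
  proof (rule oscillation_error_bound)
    have k2: "real k \<le> 2 * real M - 1" "k \<le> 2 * M" using that by linarith+
    then have "real k * (real k - 1) \<le> 2 * real M * (2 * real M - 2)" using that by (intro mult_mono) auto
    then have "real B * (real k * (real k - 1)) \<le> real B * (4 * real M ^ 2 - 4 * real M)"
      by (intro mult_left_mono) (auto simp: algebra_simps power2_eq_square)
    then show "real k * (1 + k + B * k) - ((real B - 2) * A + B) \<le> real k * (real B - 2)"
      using AB kM[OF k2(2)] by (simp add: algebra_simps)
  qed (use that B in auto)
  obtain C1 where C1: "C1 \<ge> 0" "\<And>j. j \<ge> 3 \<Longrightarrow> oscillation_error B A (2 * m) (b - a) j \<le> C1 * real j powr (2 * real B - 2)"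
    using osc2[of "b - a" "2 * m"] ab m by auto
  obtain C2 where C2: "C2 \<ge> 0" "\<And>j. j \<ge> 3 \<Longrightarrow> oscillation_error B A m (b - a) j \<le> C2 * real j powr (real B - 2)"
  proof -
    have "m \<le> 2 * M - 1" using m by linarith
    then show ?thesis using osc1[of "b - a" m] ab m that by auto
  qed
  obtain C3 where C3: "C3 \<ge> 0" "\<And>j. j \<ge> 3 \<Longrightarrow> oscillation_error B A (2 * m - 1) (Y - - Y) j \<le> C3 * real j powr (2 * real B - 2)"
  proof -
    have "2 \<le> 2 * m - 1" "2 * m - 1 \<le> 2 * M" using m by linarith+
    then show ?thesis using osc2[of "Y - - Y" "2 * m - 1"] Y that by auto
  qed
  define \<mu> where "\<mu> = (b - a) ^ (m - 1)"
  have mu0: "\<mu> \<ge> 0" using ab by (simp add: \<mu>_def)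
  define K where "K = real m ^ 2 * (4 * real m) ^ (2 * m)"
  have K0: "K \<ge> 0" by (simp add: K_def)
  define C where "C = 2 * \<mu>\<^sup>2 * (real m * (1 + real m)) + C1 + 2 * \<mu> * C2 + 2 * fact (2 * m + 4) +
    K * (1 + 2 ^ (2 * m) * ((2 * Y) ^ (2 * m - 2) + C3))"
  have bound: "integral {A..A + 1 / B}
    (\<lambda>\<alpha>. (correlation_sum (scaled_window B j a b) m (block B j) \<alpha> / real (j ^ B) - (b - a) ^ (m - 1))\<^sup>2) \<le> C / real j ^ 2"
    if j: "j \<ge> 3" and jb: "real j \<ge> 1 + real m + (b - a) + 2 * Y + 4 * fact (2 * m + 4)" for j
  proof -
    define N where "N = real (j ^ B)"
    have j1: "real j \<ge> 1" "real j > 0" using j by auto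
    have Nj2: "real j ^ 2 \<le> N" unfolding N_def of_nat_power using B j by (intro power_increasing) auto
    have jj: "real j \<le> real j ^ 2" using j1 by (simp add: power2_eq_square)
    have jN: "real j \<le> N" using Nj2 jj by linarith
    have N: "N > 0" using jN j1 by linarith
    have invN: "1 / N \<le> 1 / real j ^ 2" using Nj2 j1 N by (intro divide_left_mono mult_pos_pos) auto
    have f4: "4 * fact (2 * m + 4) \<le> N" "b - a \<le> N" "Y - - Y \<le> N" "1 + real m \<le> real j ^ 2"
      using jb jN jj Y ab fact_ge_zero[of "2 * m + 4", where 'a = real] by linarith+
    define \<eta> where "\<eta> = 2 * N ^ 3 * exp (- N)"
    have eta0: "\<eta> \<ge> 0" using N by (simp add: \<eta>_def)
    have eta_N: "\<eta> * N ^ (2 * m) \<le> 2 * fact (2 * m + 4) / N"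
    proof -
      have "\<eta> * N ^ (2 * m) = 2 * N ^ (2 * m + 3) * exp (- N)" by (simp add: \<eta>_def power_add)
      also have "\<dots> \<le> 2 * N ^ (2 * m + 3) * (fact (2 * m + 4) / N ^ (2 * m + 4))"
        using N by (intro mult_left_mono exp_minus_le_fact) auto
      also have "N ^ (2 * m + 4) = N ^ (2 * m + 3) * N"
      proof -
        have "2 * m + 4 = Suc (2 * m + 3)" by simp
        then show ?thesis by (simp only: power_Suc2)
      qed
      finally show ?thesis using N by simp
    qed
    \<comment> \<open>The tail must be at most \<open>1 / 2\<close> for the wide window to be at
      least \<open>1 / 2\<close> where \<open>second_moment_bound\<close> demands it; the factorial
      in the lower bound on \<open>j\<close> is there for this.\<close>
    have eta_half: "\<eta> \<le> 1 / 2"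
    proof -
      have "\<eta> * 1 \<le> \<eta> * N ^ (2 * m)" using eta0 jN j1 by (intro mult_left_mono one_le_power) auto
      also have "\<dots> \<le> 2 * fact (2 * m + 4) / N" by (rule eta_N)
      also have "\<dots> \<le> 1 / 2" using f4(1) N by (simp add: divide_le_eq)
      finally show ?thesis by simp
    qed
    have jp: "j \<ge> 1" using j by simp
    have fab: "b - a \<le> real (j ^ B)" "- Y < Y" "Y - - Y \<le> real (j ^ B)" using f4 Y by (auto simp: N_def)
    have "integral {A..A + 1 / B} (\<lambda>\<alpha>. (correlation_sum (scaled_window B j a b) m (block B j) \<alpha> / real (j ^ B) -
        (real (j ^ B) * ((b - a) / N)) ^ (m - 1))\<^sup>2) \<le>
      2 * ((real (j ^ B) * ((b - a) / N)) ^ (m - 1))\<^sup>2 * (1 - card (inj_tuples m (block B j)) / real (j ^ B) ^ m) +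
      oscillation_error B A (2 * m) (b - a) j / real (j ^ B) ^ 2 +
      2 * (real (j ^ B) * ((b - a) / N)) ^ (m - 1) * oscillation_error B A m (b - a) j / real (j ^ B) + \<eta> * real (j ^ B) ^ (2 * m) +
      real m ^ 2 * (4 * real m) ^ (2 * m) * (real (j ^ B) + 2 ^ (2 * m) * (real (j ^ B) ^ (2 * m - 1) * ((Y - - Y) / N) ^ (2 * m - 2) +
        oscillation_error B A (2 * m - 1) (Y - - Y) j)) / real (j ^ B) ^ 2"
    proof (rule second_moment_bound[where \<epsilon> = "(X + 1) / N" and W = "scaled_window B j (- Y) Y"])
      show "block B j \<subseteq> {1..j ^ B}" by (auto simp: block_def)
      show "scaled_window B j a b t \<le> \<eta>" if "\<not> near_int ((X + 1) / N) t" for t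
        using scaled_window_props(4)[OF ab fab(1) jp X(1,2), of 1 t] that by (simp add: N_def \<eta>_def)
      show "1 / 2 \<le> scaled_window B j (- Y) Y t" if "near_int (3 * ((X + 1) / N)) t" for t
      proof -
        obtain n :: int where n: "\<bar>t - of_int n\<bar> \<le> 3 * ((X + 1) / N)" using \<open>near_int _ t\<close> by (auto simp: near_int_def)
        have r: "3 * ((X + 1) / N) = (Y - 1) / N" "(- Y + 1) / N = - ((Y - 1) / N)"
          by (auto simp: Y_def minus_divide_left)
        have "(- Y + 1) / N \<le> t - of_int n" "t - of_int n \<le> (Y - 1) / N"
          using n unfolding r by linarith+
        then have "1 - 2 * real (j ^ B) ^ 3 * exp (- (real (j ^ B) * 1\<^sup>2)) \<le> scaled_window B j (- Y) Y t"
          unfolding N_def by (intro scaled_window_props(5)[OF fab(2,3) jp, of 1 t n]) auto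
        then show ?thesis using eta_half by (simp add: \<eta>_def N_def)
      qed
      show "(\<Sum>z\<in>inj_tuples (2 * m) (block B j). \<bar>integral {A..A + 1 / B} (pair_prod (scaled_window B j a b) m z) -
        (A + 1 / B - A) * ((b - a) / N) ^ (2 * m - 2)\<bar>) \<le> oscillation_error B A (2 * m) (b - a) j"
      proof -
        have "card ({1..<m} \<union> {m+1..<2*m}) = 2 * m - 2" by (subst card_Un_disjoint) auto
        then have c: "2 * m - 2 = card ({1..<m} \<union> {m+1..<2*m})" by simp
        show ?thesis unfolding N_def c
        proof (rule sum_oscillation_error)
          fix i assume "i \<in> {1..<m} \<union> {m+1..<2*m}"
          then show "pair_par m i < 2 * m \<and> pair_par m i \<notin> {1..<m} \<union> {m+1..<2*m}"
            using m by (auto simp: pair_par_def)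
        qed (use m B j A ab fab in auto)
      qed
      show "(\<Sum>x\<in>inj_tuples m (block B j). \<bar>integral {A..A + 1 / B} (star_prod (scaled_window B j a b) m x) -
        (A + 1 / B - A) * ((b - a) / N) ^ (m - 1)\<bar>) \<le> oscillation_error B A m (b - a) j"
      proof -
        have c: "m - 1 = card {1..<m}" by simp
        show ?thesis unfolding N_def c by (rule sum_oscillation_error) (use m B j A ab fab in auto)
      qed
      show "(\<Sum>x\<in>inj_tuples (2 * m - 1) (block B j). \<bar>integral {A..A + 1 / B} (forest_prod (scaled_window B j (- Y) Y) {1..<2 * m - 1} (\<lambda>_. 0) x) -
        (A + 1 / B - A) * ((Y - - Y) / N) ^ (2 * m - 2)\<bar>) \<le> oscillation_error B A (2 * m - 1) (Y - - Y) j"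
      proof -
        have c: "2 * m - 2 = card {1..<2 * m - 1}" by simp
        show ?thesis unfolding N_def c by (rule sum_oscillation_error) (use m B j A fab in auto)
      qed
    qed (use m scaled_window_props(1-3)[OF ab fab(1) jp] scaled_window_props(1-3)[OF fab(2,3) jp] X N eta0 B j ab Y in auto)
    also have "(real (j ^ B) * ((b - a) / N)) ^ (m - 1) = \<mu>"
    proof -
      have "N * ((b - a) / N) = b - a" using N by simp
      then show ?thesis unfolding \<mu>_def N_def by (rule arg_cong)
    qed
    also have "2 * \<mu>\<^sup>2 * (1 - card (inj_tuples m (block B j)) / real (j ^ B) ^ m) +
      oscillation_error B A (2 * m) (b - a) j / real (j ^ B) ^ 2 +
      2 * \<mu> * oscillation_error B A m (b - a) j / real (j ^ B) + \<eta> * real (j ^ B) ^ (2 * m) +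
      real m ^ 2 * (4 * real m) ^ (2 * m) * (real (j ^ B) + 2 ^ (2 * m) * (real (j ^ B) ^ (2 * m - 1) * ((Y - - Y) / N) ^ (2 * m - 2) +
        oscillation_error B A (2 * m - 1) (Y - - Y) j)) / real (j ^ B) ^ 2 \<le>
      2 * \<mu>\<^sup>2 * (real m * (1 + real m) / real j ^ 2) + C1 / real j ^ 2 + 2 * \<mu> * (C2 / real j ^ 2) + 2 * fact (2 * m + 4) / real j ^ 2 +
      K * (1 / real j ^ 2 + 2 ^ (2 * m) * ((2 * Y) ^ (2 * m - 2) / real j ^ 2 + C3 / real j ^ 2))"
    proof -
      have Npow: "N ^ 2 = real j powr (2 * real B)" "N = real j powr real B"
        using j1 by (auto simp: N_def powr_realpow[symmetric] powr_powr powr_add[symmetric] power2_eq_square)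
      have p2: "real j powr (2 * real B - 2) / N ^ 2 = 1 / real j ^ 2"
        unfolding Npow(1) using j1 by (simp add: powr_diff powr_realpow[symmetric] flip: powr_numeral)
      have p1: "real j powr (real B - 2) / N = 1 / real j ^ 2"
        using j1 by (subst Npow(2)) (simp add: powr_diff flip: powr_numeral)
      have t1: "2 * \<mu>\<^sup>2 * (1 - card (inj_tuples m (block B j)) / N ^ m) \<le> 2 * \<mu>\<^sup>2 * (real m * (1 + real m) / real j ^ 2)"
        unfolding N_def using B jp f4 by (intro mult_left_mono card_inj_tuples_block_lower) auto
      have t2: "oscillation_error B A (2 * m) (b - a) j / N ^ 2 \<le> C1 / real j ^ 2"
      proof -
        have "oscillation_error B A (2 * m) (b - a) j / N ^ 2 \<le> C1 * real j powr (2 * real B - 2) / N ^ 2"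
          by (intro divide_right_mono C1 j) auto
        also have "\<dots> = C1 * (real j powr (2 * real B - 2) / N ^ 2)" by simp
        finally show ?thesis unfolding p2 by simp
      qed
      have t3: "2 * \<mu> * oscillation_error B A m (b - a) j / N \<le> 2 * \<mu> * (C2 / real j ^ 2)"
      proof -
        have "2 * \<mu> * oscillation_error B A m (b - a) j / N \<le> 2 * \<mu> * (C2 * real j powr (real B - 2)) / N"
          using N mu0 by (intro divide_right_mono mult_left_mono C2 j) auto
        also have "\<dots> = 2 * \<mu> * (C2 * (real j powr (real B - 2) / N))" by simp
        finally show ?thesis unfolding p1 by simp
      qed
      have t4: "\<eta> * N ^ (2 * m) \<le> 2 * fact (2 * m + 4) / real j ^ 2"
      proof -
        have "2 * fact (2 * m + 4) * (1 / N) \<le> 2 * fact (2 * m + 4) * (1 / real j ^ 2)"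
          using invN by (intro mult_left_mono) auto
        then show ?thesis using eta_N by simp
      qed
      have t5: "K * (N + 2 ^ (2 * m) * (N ^ (2 * m - 1) * ((Y - - Y) / N) ^ (2 * m - 2) +
        oscillation_error B A (2 * m - 1) (Y - - Y) j)) / N ^ 2 \<le>
        K * (1 / real j ^ 2 + 2 ^ (2 * m) * ((2 * Y) ^ (2 * m - 2) / real j ^ 2 + C3 / real j ^ 2))"
      proof -
        have "2 * m - 1 = Suc (2 * m - 2)" using m by simp
        then have Y2: "N ^ (2 * m - 1) * ((Y - - Y) / N) ^ (2 * m - 2) = N * (2 * Y) ^ (2 * m - 2)"
          using N by (simp add: power_divide)
        have e3: "oscillation_error B A (2 * m - 1) (Y - - Y) j / N ^ 2 \<le> C3 / real j ^ 2"
        proof -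
          have "oscillation_error B A (2 * m - 1) (Y - - Y) j / N ^ 2 \<le> C3 * real j powr (2 * real B - 2) / N ^ 2"
            by (intro divide_right_mono C3 j) auto
          also have "\<dots> = C3 * (real j powr (2 * real B - 2) / N ^ 2)" by simp
          finally show ?thesis unfolding p2 by simp
        qed
        have "K * (N + 2 ^ (2 * m) * (N ^ (2 * m - 1) * ((Y - - Y) / N) ^ (2 * m - 2) +
          oscillation_error B A (2 * m - 1) (Y - - Y) j)) / N ^ 2 =
          K * (1 / N + 2 ^ (2 * m) * ((2 * Y) ^ (2 * m - 2) * (1 / N) + oscillation_error B A (2 * m - 1) (Y - - Y) j / N ^ 2))"
          unfolding Y2 using N by (simp add: field_simps power2_eq_square)
        also have "\<dots> \<le> K * (1 / real j ^ 2 + 2 ^ (2 * m) * ((2 * Y) ^ (2 * m - 2) * (1 / real j ^ 2) + C3 / real j ^ 2))"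
          using Y by (intro mult_left_mono add_mono invN e3 K0) auto
        finally show ?thesis by simp
      qed
      show ?thesis using add_mono[OF add_mono[OF add_mono[OF add_mono[OF t1 t2] t3] t4] t5]
        unfolding N_def K_def .
    qed
    also have "\<dots> = C / real j ^ 2" by (simp add: C_def add_divide_distrib distrib_left)
    finally show ?thesis by (simp add: \<mu>_def)
  qed
  have "\<forall>\<^sub>F j in sequentially. real j \<ge> 1 + real m + (b - a) + 2 * Y + 4 * fact (2 * m + 4)"
    using filterlim_real_sequentially by (rule filterlim_at_top[THEN iffD1, rule_format])
  then have "\<forall>\<^sub>F j in sequentially. integral {A..A + 1 / B}
    (\<lambda>\<alpha>. (correlation_sum (scaled_window B j a b) m (block B j) \<alpha> / real (j ^ B) - (b - a) ^ (m - 1))\<^sup>2) \<le> C / real j ^ 2"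
    using eventually_ge_at_top[of 3] by eventually_elim (rule bound)
  then show ?thesis by blast
qed

text \<open>The nonnegative series of the \<open>f j\<close>, started late enough, has finite
  integral, hence is finite almost everywhere on the interval, and the terms of a convergent series
  tend to 0.\<close>

lemma AE_tendsto_zero:
  fixes f :: "nat \<Rightarrow> real \<Rightarrow> real"
  assumes cont: "\<forall>\<^sub>F j in sequentially. continuous_on {a..b} (f j)" and nonneg: "\<And>j x. f j x \<ge> 0"
    and int: "\<forall>\<^sub>F j in sequentially. integral {a..b} (f j) \<le> C / real j ^ 2"
  shows "AE x in lebesgue. x \<in> {a..b} \<longrightarrow> (\<lambda>j. f j x) \<longlonglongrightarrow> 0"
proof -
  obtain j0 where j0: "\<And>j. j \<ge> j0 \<Longrightarrow> continuous_on {a..b} (f j) \<and> integral {a..b} (f j) \<le> C / real j ^ 2"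
    using eventually_conj[OF cont int] unfolding eventually_sequentially by blast
  define g where "g = (\<lambda>i x. ennreal (f (i + j0) x) * indicator {a..b} x)"
  have meas: "g i \<in> borel_measurable lborel" for i
  proof -
    have "(\<lambda>x. indicator {a..b} x *\<^sub>R f (i + j0) x) \<in> borel_measurable borel"
      using j0[of "i + j0"] by (intro borel_measurable_continuous_on_indicator) auto
    then have "(\<lambda>x. ennreal (indicator {a..b} x *\<^sub>R f (i + j0) x)) \<in> borel_measurable borel" by simp
    also have "(\<lambda>x. ennreal (indicator {a..b} x *\<^sub>R f (i + j0) x)) = g i"
      by (auto simp: g_def fun_eq_iff indicator_def)
    finally show ?thesis by simp
  qed
  have gi: "(\<integral>\<^sup>+x. g i x \<partial>lborel) \<le> ennreal (\<bar>C\<bar> / real (i + j0) ^ 2)" for i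
  proof -
    have "(f (i + j0) has_integral integral {a..b} (f (i + j0))) {a..b}"
      using j0[of "i + j0"] by (intro integrable_integral integrable_continuous_real) auto
    then have "(\<integral>\<^sup>+x. g i x \<partial>lborel) = ennreal (integral {a..b} (f (i + j0)))"
      unfolding g_def by (intro nn_integral_has_integral_lebesgue' nonneg)
    also have "\<dots> \<le> ennreal (\<bar>C\<bar> / real (i + j0) ^ 2)"
    proof (rule ennreal_leI)
      have "C / real (i + j0) ^ 2 \<le> \<bar>C\<bar> / real (i + j0) ^ 2" by (intro divide_right_mono) auto
      then show "integral {a..b} (f (i + j0)) \<le> \<bar>C\<bar> / real (i + j0) ^ 2" using j0[of "i + j0"] by simp
    qed
    finally show ?thesis .
  qed
  have sm: "summable (\<lambda>i. \<bar>C\<bar> / real (i + j0) ^ 2)"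
  proof -
    have "summable (\<lambda>i. \<bar>C\<bar> * (1 / real i ^ 2))"
      using inverse_power_summable[of 2, where 'a = real] by (intro summable_mult) (simp add: inverse_eq_divide)
    then have "summable (\<lambda>i. \<bar>C\<bar> / real i ^ 2)" by simp
    then show ?thesis by (subst summable_iff_shift)
  qed
  have "(\<integral>\<^sup>+x. (\<Sum>i. g i x) \<partial>lborel) = (\<Sum>i. \<integral>\<^sup>+x. g i x \<partial>lborel)"
    by (rule nn_integral_suminf[OF meas])
  also have "\<dots> \<le> (\<Sum>i. ennreal (\<bar>C\<bar> / real (i + j0) ^ 2))" by (intro suminf_le gi) auto
  also have "\<dots> = ennreal (\<Sum>i. \<bar>C\<bar> / real (i + j0) ^ 2)" using sm by (intro suminf_ennreal2) auto
  finally have "(\<integral>\<^sup>+x. (\<Sum>i. g i x) \<partial>lborel) \<noteq> \<infinity>" by (auto simp: top_unique)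
  then have "AE x in lborel. (\<Sum>i. g i x) \<noteq> \<infinity>"
    using meas by (intro nn_integral_PInf_AE) auto
  then have "AE x in lborel. x \<in> {a..b} \<longrightarrow> (\<lambda>j. f j x) \<longlonglongrightarrow> 0"
  proof eventually_elim
    case (elim x)
    show ?case
    proof
      assume "x \<in> {a..b}"
      then have "(\<Sum>i. ennreal (f (i + j0) x)) \<noteq> top" using elim by (simp add: g_def)
      then have "summable (\<lambda>i. f (i + j0) x)" using nonneg by (intro summable_suminf_not_top)
      then have "(\<lambda>i. f (i + j0) x) \<longlonglongrightarrow> 0" by (rule summable_LIMSEQ_zero)
      then show "(\<lambda>j. f j x) \<longlonglongrightarrow> 0" by (rule LIMSEQ_offset)
    qed
  qed
  then show ?thesis by (rule AE_completion)
qed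

lemma continuous_on_correlation_sum:
  assumes "continuous_on UNIV w" "0 \<notin> S" "m \<ge> 1"
  shows "continuous_on T (correlation_sum w m S)"
  unfolding correlation_sum_def
proof (intro continuous_on_sum continuous_on_forest_prod assms(1))
  fix x i assume "x \<in> inj_tuples m S" "i \<in> {1..<m}"
  then have "x i \<in> S" "x 0 \<in> S" by (auto simp: inj_tuples_def PiE_iff)
  then show "x i > 0 \<and> x 0 > 0" using assms(2) by (metis gr0I)
qed

lemma AE_correlation_tendsto:
  assumes m: "2 \<le> m" "m \<le> M" and B: "B \<ge> 3" and A: "A \<ge> 0" and ab: "a < b"
    and AB: "real B * (4 * real M ^ 2 - 4 * real M) + 2 * real M * (2 * real M + 3) \<le> real B * (A + 1) - 2 * A"
  shows "AE \<alpha> in lebesgue. \<alpha> \<in> {A..A + 1 / B} \<longrightarrow>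
    (\<lambda>j. correlation_sum (scaled_window B j a b) m (block B j) \<alpha> / real (j ^ B)) \<longlonglongrightarrow> (b - a) ^ (m - 1)"
proof -
  let ?P = "\<lambda>j \<alpha>. correlation_sum (scaled_window B j a b) m (block B j) \<alpha> / real (j ^ B)"
  obtain C where C: "\<forall>\<^sub>F j in sequentially. integral {A..A + 1 / B} (\<lambda>\<alpha>. (?P j \<alpha> - (b - a) ^ (m - 1))\<^sup>2) \<le> C / real j ^ 2"
    using second_moment_decay[OF assms] by blast
  have "AE \<alpha> in lebesgue. \<alpha> \<in> {A..A + 1 / B} \<longrightarrow> (\<lambda>j. (?P j \<alpha> - (b - a) ^ (m - 1))\<^sup>2) \<longlonglongrightarrow> 0"
  proof (rule AE_tendsto_zero[OF _ _ C])
    show "\<forall>\<^sub>F j in sequentially. continuous_on {A..A + 1 / B} (\<lambda>\<alpha>. (?P j \<alpha> - (b - a) ^ (m - 1))\<^sup>2)"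
      using eventually_ge_at_top[of 1]
    proof eventually_elim
      case (elim j)
      have "continuous_on UNIV (scaled_window B j a b)"
        unfolding scaled_window_def by (rule continuous_on_window)
      then have "continuous_on {A..A + 1 / B} (correlation_sum (scaled_window B j a b) m (block B j))"
        using m by (intro continuous_on_correlation_sum) (auto simp: block_def)
      then show ?case using elim by (intro continuous_intros) auto
    qed
  qed auto
  then show ?thesis
  proof eventually_elim
    case (elim \<alpha>)
    show ?case
    proof
      assume "\<alpha> \<in> {A..A + 1 / B}"
      then have "(\<lambda>j. (?P j \<alpha> - (b - a) ^ (m - 1))\<^sup>2) \<longlonglongrightarrow> 0" using elim by blast
      then have "(\<lambda>j. \<bar>?P j \<alpha> - (b - a) ^ (m - 1)\<bar>) \<longlonglongrightarrow> 0"
        using tendsto_real_sqrt[of _ 0] by fastforce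
      then show "(\<lambda>j. ?P j \<alpha>) \<longlonglongrightarrow> (b - a) ^ (m - 1)"
        by (rule LIM_zero_cancel[OF tendsto_rabs_zero_cancel])
    qed
  qed
qed

section \<open>Gaps and close tuples\<close>

text \<open>\<open>frac\<close> of a difference is the distance walked forward on the circle, so
  neighbours may lie beyond the point 0.\<close>

definition neighbour_set :: "(nat \<Rightarrow> real) \<Rightarrow> nat set \<Rightarrow> real \<Rightarrow> nat \<Rightarrow> nat set" where
  "neighbour_set \<theta> S s p = {q \<in> S - {p}. frac (\<theta> q - \<theta> p) \<le> s}"

definition close_tuples :: "(nat \<Rightarrow> real) \<Rightarrow> nat \<Rightarrow> nat set \<Rightarrow> real \<Rightarrow> (nat \<Rightarrow> nat) set" where
  "close_tuples \<theta> m S s = {x \<in> inj_tuples m S. \<forall>i\<in>{1..<m}. frac (\<theta> (x i) - \<theta> (x 0)) \<le> s}"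

lemma falling_prod_eq: "(\<Prod>i=0..<k. n - i) = fact k * (n choose k)"
proof (induction k)
  case (Suc k)
  have "(\<Prod>i=0..<Suc k. n - i) = fact k * ((n - k) * (n choose k))" using Suc by simp
  also have "(n - k) * (n choose k) = Suc k * (n choose Suc k)"
    using binomial_absorb_comp[of n k] binomial_absorption[of k n] by (metis mult.commute)
  finally show ?case by (simp add: algebra_simps)
qed simp

text \<open>Group the tuples by their root; the other entries are \<open>k\<close> neighbours of it
  in any of \<open>fact k\<close> orders.\<close>

lemma card_close_tuples:
  assumes "finite S"
  shows "card (close_tuples \<theta> (Suc k) S s) = (\<Sum>p\<in>S. fact k * (card (neighbour_set \<theta> S s p) choose k))"
proof -
  let ?Z = "\<lambda>p. {z \<in> inj_tuples (Suc k) S. z 0 = p \<and> (\<forall>i\<in>{1..<Suc k}. z i \<in> neighbour_set \<theta> S s p)}"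
  have eq: "close_tuples \<theta> (Suc k) S s = (\<Union>p\<in>S. ?Z p)"
  proof (intro set_eqI iffI)
    fix x assume x: "x \<in> close_tuples \<theta> (Suc k) S s"
    then have inj: "inj_on x {..<Suc k}" and mem: "\<And>i. i < Suc k \<Longrightarrow> x i \<in> S"
      by (auto simp: close_tuples_def inj_tuples_def PiE_iff)
    have "x i \<noteq> x 0" if "i \<in> {1..<Suc k}" for i
      using inj_onD[OF inj, of i 0] that by auto
    then have "x \<in> ?Z (x 0)" using x mem by (auto simp: close_tuples_def neighbour_set_def)
    then show "x \<in> (\<Union>p\<in>S. ?Z p)" using mem[of 0] by auto
  qed (auto simp: close_tuples_def neighbour_set_def)
  have "card (close_tuples \<theta> (Suc k) S s) = (\<Sum>p\<in>S. card (?Z p))"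
    unfolding eq using assms by (intro card_UN_disjoint) auto
  also have "\<dots> = (\<Sum>p\<in>S. fact k * (card (neighbour_set \<theta> S s p) choose k))"
    using assms unfolding falling_prod_eq[symmetric]
    by (intro sum.cong refl card_inj_tuples_root) (auto simp: neighbour_set_def)
  finally show ?thesis .
qed

definition has_neighbour :: "(nat \<Rightarrow> real) \<Rightarrow> nat set \<Rightarrow> real \<Rightarrow> nat set" where
  "has_neighbour \<theta> S s = {p \<in> S. neighbour_set \<theta> S s p \<noteq> {}}"

text \<open>The remainder is a single term whose sign depends on the parity of \<open>R\<close>;
  this is Bonferroni's inequality in exact form.\<close>

lemma alternating_binomial_partial_sum:
  assumes "n \<ge> 1"
  shows "(\<Sum>k=1..R. (-1) ^ (k + 1) * real (n choose k)) = 1 - (-1) ^ R * real ((n - 1) choose R)"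
proof -
  have "(\<Sum>k\<le>R. (real n gchoose k) * (-1) ^ k) = (-1) ^ R * (real n - 1 gchoose R)"
    by (rule gbinomial_sum_lower_neg)
  then have "(\<Sum>k\<le>R. (-1) ^ k * real (n choose k)) = (-1) ^ R * real ((n - 1) choose R)"
    using assms by (simp add: binomial_gbinomial of_nat_diff mult.commute)
  moreover have "(\<Sum>k\<le>R. (-1) ^ k * real (n choose k)) = 1 + (\<Sum>k=1..R. (-1) ^ k * real (n choose k))"
    by (simp add: atMost_atLeast0 sum.atLeast_Suc_atMost)
  ultimately show ?thesis by (simp add: sum_negf)
qed

text \<open>Point by point, the indicator of having a neighbour is compared with the alternating
  binomial sum in the number of neighbours. Both vanish at points without neighbours.\<close>

lemma bonferroni_neighbours:
  assumes S: "finite S"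
  shows "odd R \<Longrightarrow> real (card (has_neighbour \<theta> S s)) \<le>
      (\<Sum>k=1..R. (-1) ^ (k + 1) * (real (card (close_tuples \<theta> (Suc k) S s)) / fact k))"
    and "even R \<Longrightarrow> (\<Sum>k=1..R. (-1) ^ (k + 1) * (real (card (close_tuples \<theta> (Suc k) S s)) / fact k)) \<le>
      real (card (has_neighbour \<theta> S s))"
proof -
  let ?n = "\<lambda>p. card (neighbour_set \<theta> S s p)"
  have fn: "finite (neighbour_set \<theta> S s p)" for p using S by (simp add: neighbour_set_def)
  have sum_eq: "(\<Sum>k=1..R. (-1) ^ (k + 1) * (real (card (close_tuples \<theta> (Suc k) S s)) / fact k)) =
    (\<Sum>p\<in>S. \<Sum>k=1..R. (-1) ^ (k + 1) * real (?n p choose k))"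
    unfolding card_close_tuples[OF S] by (subst sum.swap) (simp add: sum_distrib_left sum_divide_distrib)
  have card_eq: "real (card (has_neighbour \<theta> S s)) = (\<Sum>p\<in>S. if neighbour_set \<theta> S s p \<noteq> {} then 1 else 0)"
    using S by (simp add: has_neighbour_def sum.If_cases Int_def)
  have zero: "(\<Sum>k=1..R. (-1) ^ (k + 1) * real (0 choose k)) = 0"
    by (intro sum.neutral) auto
  {
    assume R: "odd R"
    show "real (card (has_neighbour \<theta> S s)) \<le>
      (\<Sum>k=1..R. (-1) ^ (k + 1) * (real (card (close_tuples \<theta> (Suc k) S s)) / fact k))"
      unfolding sum_eq card_eq
    proof (rule sum_mono)
      fix p
      show "(if neighbour_set \<theta> S s p \<noteq> {} then 1 else 0) \<le> (\<Sum>k=1..R. (-1) ^ (k + 1) * real (?n p choose k))"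
      proof (cases "neighbour_set \<theta> S s p = {}")
        case False
        then have "?n p \<ge> 1" using fn[of p] by (simp add: Suc_le_eq card_gt_0_iff)
        then show ?thesis using False R by (simp only: alternating_binomial_partial_sum) simp
      qed (use zero in simp)
    qed
  next
    assume R: "even R"
    show "(\<Sum>k=1..R. (-1) ^ (k + 1) * (real (card (close_tuples \<theta> (Suc k) S s)) / fact k)) \<le>
      real (card (has_neighbour \<theta> S s))"
      unfolding sum_eq card_eq
    proof (rule sum_mono)
      fix p
      show "(\<Sum>k=1..R. (-1) ^ (k + 1) * real (?n p choose k)) \<le> (if neighbour_set \<theta> S s p \<noteq> {} then 1 else 0)"
      proof (cases "neighbour_set \<theta> S s p = {}")
        case False
        then have "?n p \<ge> 1" using fn[of p] by (simp add: Suc_le_eq card_gt_0_iff)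
        then show ?thesis using False R by (simp only: alternating_binomial_partial_sum) simp
      qed (use zero in simp)
    qed
  }
qed

section \<open>Successors within the unit interval and the gaps of the ordered sequence\<close>

text \<open>The version of \<open>has_neighbour\<close> without wrap-around, since the gap from the
  largest point back to the smallest is not among the \<open>N\<close> gaps counted.\<close>

definition has_successor :: "(nat \<Rightarrow> real) \<Rightarrow> nat set \<Rightarrow> real \<Rightarrow> nat set" where
  "has_successor \<theta> S s = {p \<in> S. \<exists>q\<in>S. frac (\<theta> p) < frac (\<theta> q) \<and> frac (\<theta> q) \<le> frac (\<theta> p) + s}"

lemma frac_diff_cases:
  fixes u v :: real
  shows "frac (v - u) = (if frac u \<le> frac v then frac v - frac u else frac v - frac u + 1)"
proof -
  have b: "frac v < 1" "frac u < 1" "0 \<le> frac u" "0 \<le> frac v" by (auto simp: frac_lt_1)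
  have e: "v - u - (frac v - frac u) = of_int (\<lfloor>v\<rfloor> - \<lfloor>u\<rfloor>)"
    "v - u - (frac v - frac u + 1) = of_int (\<lfloor>v\<rfloor> - \<lfloor>u\<rfloor> - 1)" by (simp_all add: frac_def)
  have i: "v - u - (frac v - frac u) \<in> \<int>" "v - u - (frac v - frac u + 1) \<in> \<int>"
    unfolding e by (rule Ints_of_int)+
  show ?thesis
  proof (cases "frac u \<le> frac v")
    case True
    have "frac (v - u) = frac v - frac u"
      unfolding frac_unique_iff using i(1) True b by (intro conjI) linarith+
    then show ?thesis using True by simp
  next
    case False
    have "frac (v - u) = frac v - frac u + 1"
      unfolding frac_unique_iff using i(2) False b by (intro conjI) linarith+
    then show ?thesis using False by simp
  qed
qed

lemma has_successor_subset_has_neighbour: "has_successor \<theta> S s \<subseteq> has_neighbour \<theta> S s"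
proof
  fix p assume "p \<in> has_successor \<theta> S s"
  then obtain q where q: "p \<in> S" "q \<in> S" "frac (\<theta> p) < frac (\<theta> q)" "frac (\<theta> q) \<le> frac (\<theta> p) + s"
    by (auto simp: has_successor_def)
  then have "q \<in> neighbour_set \<theta> S s p" by (auto simp: neighbour_set_def frac_diff_cases)
  then show "p \<in> has_neighbour \<theta> S s" using q by (auto simp: has_neighbour_def)
qed

text \<open>A neighbour that is not a successor lies behind the end of the unit interval, which happens
  for the largest point only.\<close>

lemma card_has_neighbour_le:
  assumes S: "finite S" and inj: "inj_on (\<lambda>n. frac (\<theta> n)) S" and s: "s < 1"
  shows "card (has_neighbour \<theta> S s) \<le> card (has_successor \<theta> S s) + 1"
proof -
  have one: "p = p'" if p: "p \<in> has_neighbour \<theta> S s - has_successor \<theta> S s"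
    and p': "p' \<in> has_neighbour \<theta> S s - has_successor \<theta> S s" for p p'
  proof -
    have max: "frac (\<theta> q) \<le> frac (\<theta> p)"
      if p: "p \<in> has_neighbour \<theta> S s - has_successor \<theta> S s" and "q \<in> S" for p q
    proof (rule ccontr)
      assume q: "\<not> frac (\<theta> q) \<le> frac (\<theta> p)"
      obtain r where r: "p \<in> S" "r \<in> S" "r \<noteq> p" "frac (\<theta> r - \<theta> p) \<le> s"
        using p by (auto simp: has_neighbour_def neighbour_set_def)
      have "frac (\<theta> r) \<noteq> frac (\<theta> p)" using inj r by (auto dest: inj_onD)
      then have "frac (\<theta> r) < frac (\<theta> p)"
        using p r by (auto simp: has_successor_def frac_diff_cases split: if_splits)
      then have "frac (\<theta> r) - frac (\<theta> p) + 1 \<le> s" using r(4) by (auto simp: frac_diff_cases)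
      then have "1 - frac (\<theta> p) \<le> s" using frac_ge_0[of "\<theta> r"] by linarith
      then have "frac (\<theta> q) \<le> frac (\<theta> p) + s" using frac_lt_1[of "\<theta> q"] by linarith
      then show False using p q \<open>q \<in> S\<close> r(1) by (auto simp: has_successor_def)
    qed
    have "p \<in> S" "p' \<in> S" using p p' by (auto simp: has_neighbour_def)
    then have "frac (\<theta> p) = frac (\<theta> p')" using max[OF p] max[OF p'] by (meson antisym)
    then show ?thesis using inj \<open>p \<in> S\<close> \<open>p' \<in> S\<close> by (auto dest: inj_onD)
  qed
  have fN: "finite (has_neighbour \<theta> S s)" using S by (simp add: has_neighbour_def)
  have "card (has_neighbour \<theta> S s - has_successor \<theta> S s) \<le> 1"
  proof (cases "has_neighbour \<theta> S s - has_successor \<theta> S s = {}")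
    case False
    then obtain p where "p \<in> has_neighbour \<theta> S s - has_successor \<theta> S s" by blast
    then have "has_neighbour \<theta> S s - has_successor \<theta> S s = {p}" using one by blast
    then show ?thesis by simp
  next
    case True
    then show ?thesis by (simp only: card.empty)
  qed
  moreover have "card (has_neighbour \<theta> S s) = card (has_successor \<theta> S s) + card (has_neighbour \<theta> S s - has_successor \<theta> S s)"
    using has_successor_subset_has_neighbour[of \<theta> S s] fN
    by (metis card_Diff_subset card_mono finite_subset le_add_diff_inverse)
  ultimately show ?thesis by simp
qed

lemma has_successor_mono: "S \<subseteq> S' \<Longrightarrow> s \<le> s' \<Longrightarrow> has_successor \<theta> S s \<subseteq> has_successor \<theta> S' s'"
  by (force simp: has_successor_def)

lemma has_neighbour_mono: "s \<le> s' \<Longrightarrow> has_neighbour \<theta> S s \<subseteq> has_neighbour \<theta> S s'"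
  by (force simp: has_neighbour_def neighbour_set_def)

text \<open>Besides \<open>r\<close> itself, a point can join only if \<open>r\<close> is its sole
  successor within \<open>s\<close>. Two such points are impossible, as the upper one would already
  be a successor of the lower one.\<close>

lemma card_has_successor_insert:
  assumes S: "finite S" and inj: "inj_on (\<lambda>n. frac (\<theta> n)) (insert r S)"
  shows "card (has_successor \<theta> (insert r S) s) \<le> card (has_successor \<theta> S s) + 2"
proof (cases "r \<in> S")
  case False
  define D where "D = has_successor \<theta> (insert r S) s - has_successor \<theta> S s - {r}"
  have one: "p = p'" if p: "p \<in> D" and p': "p' \<in> D" for p p'
  proof -
    have nl: "\<not> frac (\<theta> p) < frac (\<theta> p')" if p: "p \<in> D" and p': "p' \<in> D" for p p'
      using that by (fastforce simp: D_def has_successor_def)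
    have "p \<in> S" "p' \<in> S" using p p' by (auto simp: D_def has_successor_def)
    moreover have "frac (\<theta> p) = frac (\<theta> p')" using nl[OF p p'] nl[OF p' p] by simp
    ultimately show ?thesis using inj by (auto dest: inj_onD)
  qed
  have "card D \<le> 1"
  proof (cases "D = {}")
    case False
    then obtain p where "p \<in> D" by blast
    then have "D = {p}" using one by blast
    then show ?thesis by simp
  qed simp
  moreover have "card (has_successor \<theta> (insert r S) s) \<le> card (has_successor \<theta> S s \<union> (D \<union> {r}))"
    using S by (intro card_mono) (auto simp: D_def has_successor_def)
  moreover have "card (has_successor \<theta> S s \<union> (D \<union> {r})) \<le> card (has_successor \<theta> S s) + (card D + card {r})"
    by (meson add_left_mono card_Un_le order_trans)
  ultimately show ?thesis by simp
qed (simp add: insert_absorb)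

lemma card_has_successor_union:
  assumes "finite T" "finite S" "inj_on (\<lambda>n. frac (\<theta> n)) (T \<union> S)"
  shows "card (has_successor \<theta> (T \<union> S) s) \<le> card (has_successor \<theta> S s) + 2 * card T"
  using assms(1,3)
proof (induction T)
  case (insert r T)
  have "inj_on (\<lambda>n. frac (\<theta> n)) (T \<union> S)"
    using insert.prems by (rule inj_on_subset) auto
  then have "card (has_successor \<theta> (T \<union> S) s) \<le> card (has_successor \<theta> S s) + 2 * card T"
    by (rule insert.IH)
  moreover have "card (has_successor \<theta> (insert r (T \<union> S)) s) \<le> card (has_successor \<theta> (T \<union> S) s) + 2"
    using insert assms by (intro card_has_successor_insert) auto
  ultimately show ?case using insert by simp
qed simp

text \<open>With distinct values, a short gap after a point means that some larger point is close,
  because the next one is the closest. The largest of the \<open>N + 1\<close> points has no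
  successor, in accordance with the \<open>N\<close> gaps.\<close>

lemma gap_distribution_eq:
  assumes N: "N \<ge> 1" and inj: "inj_on (\<lambda>n. frac (\<theta> n)) {1..N + 1}"
  shows "gap_distribution x \<theta> N = real (card (has_successor \<theta> {1..N + 1} (x / N))) / N"
proof -
  define f where "f = (\<lambda>n. frac (\<theta> n))"
  define L where "L = sort (map f [1..<N + 2])"
  have "{1..<N + 2} = {1..N + 1}" by auto
  then have setL: "set L = f ` {1..N + 1}" and dL: "distinct L"
    using inj by (auto simp add: L_def distinct_map f_def simp del: upt_Suc)
  have sL: "sorted L" by (simp add: L_def)
  have lenL: "length L = N + 1" by (simp add: L_def)
  have lt: "L ! i < L ! k" if "i < k" "k < N + 1" for i k
    using sorted_nth_mono[OF sL, of i k] nth_eq_iff_index_eq[OF dL, of i k] that lenL by fastforce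
  have le: "L ! i \<le> L ! k" if "i \<le> k" "k < N + 1" for i k
    using sorted_nth_mono[OF sL, of i k] that lenL by simp
  \<comment> \<open>Lists count from 0, so gap number \<open>n\<close> starts at the entry
    \<open>L ! (n - 1)\<close>.\<close>
  have "{v \<in> set L. \<exists>v'\<in>set L. v < v' \<and> v' \<le> v + x / N} = (\<lambda>n. L ! (n - 1)) ` {n \<in> {1..N}. real N * (L ! n - L ! (n - 1)) \<le> x}"
  proof (intro set_eqI iffI)
    fix v assume "v \<in> {v \<in> set L. \<exists>v'\<in>set L. v < v' \<and> v' \<le> v + x / N}"
    then obtain i k where ik: "i < N + 1" "k < N + 1" "v = L ! i" "L ! i < L ! k" "L ! k \<le> L ! i + x / N"
      using lenL by (auto simp: in_set_conv_nth)
    have "i < k" using le[of k i] ik by (meson not_less leD)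
    then have "L ! (i + 1) \<le> L ! k" using ik by (intro le) auto
    then have "L ! (i + 1) - L ! i \<le> x / N" using ik by linarith
    then have "real N * (L ! (i + 1) - L ! i) \<le> x" using N by (simp add: field_simps)
    then show "v \<in> (\<lambda>n. L ! (n - 1)) ` {n \<in> {1..N}. real N * (L ! n - L ! (n - 1)) \<le> x}"
      using ik \<open>i < k\<close> by (intro image_eqI[of _ _ "i + 1"]) auto
  next
    fix v assume "v \<in> (\<lambda>n. L ! (n - 1)) ` {n \<in> {1..N}. real N * (L ! n - L ! (n - 1)) \<le> x}"
    then obtain n where n: "1 \<le> n" "n \<le> N" "v = L ! (n - 1)" "real N * (L ! n - L ! (n - 1)) \<le> x" by auto
    have "L ! (n - 1) < L ! n" using n by (intro lt) auto
    moreover have "L ! n \<le> L ! (n - 1) + x / N" using n N by (simp add: field_simps)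
    ultimately show "v \<in> {v \<in> set L. \<exists>v'\<in>set L. v < v' \<and> v' \<le> v + x / N}"
      using n lenL by auto
  qed
  moreover have "inj_on (\<lambda>n. L ! (n - 1)) {n \<in> {1..N}. real N * (L ! n - L ! (n - 1)) \<le> x}"
    using dL lenL by (intro inj_onI) (auto simp: nth_eq_iff_index_eq)
  ultimately have "card {n \<in> {1..N}. real N * (L ! n - L ! (n - 1)) \<le> x} =
    card {v \<in> set L. \<exists>v'\<in>set L. v < v' \<and> v' \<le> v + x / N}"
    by (simp add: card_image)
  also have "{v \<in> set L. \<exists>v'\<in>set L. v < v' \<and> v' \<le> v + x / N} = f ` has_successor \<theta> {1..N + 1} (x / N)"
    unfolding setL has_successor_def f_def by auto
  also have "card \<dots> = card (has_successor \<theta> {1..N + 1} (x / N))"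
    using inj by (intro card_image) (auto simp: f_def has_successor_def inj_on_def)
  finally show ?thesis
    by (simp add: gap_distribution_def frac_order_stat_def L_def f_def)
qed

section \<open>The gap distribution\<close>

lemma filterlim_real_power_at_top: "B \<ge> 1 \<Longrightarrow> filterlim (\<lambda>j. real (j ^ B)) at_top sequentially"
  unfolding of_nat_power by (intro filterlim_pow_at_top filterlim_real_sequentially) auto

lemma power_mult_exp_tendsto_0:
  assumes "B \<ge> 1" "c > 0"
  shows "(\<lambda>j. real (j ^ B) ^ p * exp (- (real (j ^ B) * c))) \<longlonglongrightarrow> 0"
proof -
  have "filterlim (\<lambda>j. real (j ^ B) * c) at_top sequentially"
    using filterlim_real_power_at_top[OF assms(1)] assms(2)
    by (intro filterlim_at_top_mult_tendsto_pos[OF tendsto_const]) (auto simp: mult.commute)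
  then have "(\<lambda>j. (real (j ^ B) * c) ^ p / exp (real (j ^ B) * c)) \<longlonglongrightarrow> 0"
    by (rule filterlim_compose[OF tendsto_power_div_exp_0])
  then have "(\<lambda>j. (1 / c ^ p) * ((real (j ^ B) * c) ^ p / exp (real (j ^ B) * c))) \<longlonglongrightarrow> 0"
    by (rule tendsto_mult_right_zero)
  then show ?thesis using assms(2) by (simp add: power_mult_distrib exp_minus divide_inverse mult_ac)
qed

text \<open>Outside the target the fractional part lies strictly between \<open>x / N\<close> and 1.
  It must keep its distance from the arc on both sides: from the right end by
  \<open>b \<le> x - r\<close>, and across the point 1, identified with 0, by
  \<open>r \<le> a\<close>.\<close>

lemma scaled_window_outside:
  assumes ab: "a < b" "b - a \<le> real (j ^ B)" and j: "j \<ge> 1" and r: "0 < r" "r \<le> a" "b \<le> x - r"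
    and t: "x / real (j ^ B) < frac t"
  shows "scaled_window B j a b t \<le> 2 * real (j ^ B) ^ 3 * exp (- (real (j ^ B) * r\<^sup>2))"
proof -
  define N where "N = real (j ^ B)"
  have N: "N > 0" using j by (simp add: N_def)
  have "(b - a) / N \<le> 1" using ab N by (simp add: N_def)
  then have le: "a / N \<le> b / N" "b / N \<le> a / N + 1"
    using ab N by (auto simp: divide_right_mono diff_divide_distrib)
  have H: "real (j ^ (3 * B)) = N ^ 3" "j ^ (3 * B) > 0"
    using j by (auto simp: N_def power_mult[symmetric] mult.commute)
  have HN: "N ^ 3 * (r / N)\<^sup>2 = N * r\<^sup>2" using N by (simp add: power2_eq_square power3_eq_cube)
  have "window (j ^ (3 * B)) (a / N) (b / N) t \<le> 2 * real (j ^ (3 * B)) * exp (- (real (j ^ (3 * B)) * (r / N)\<^sup>2))"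
  proof (rule window_far[OF H(2) _ le])
    fix z and n :: int assume z: "z \<in> {a / N..b / N}"
    have "r / N \<le> a / N" "b / N \<le> x / N - r / N"
      using r N by (auto simp: divide_right_mono simp flip: diff_divide_distrib)
    then have f: "r / N \<le> frac t - z" "frac t - z < 1 - r / N"
      using z t frac_lt_1[of t] by (auto simp: N_def)
    have eq: "t - z - of_int n = frac t - z + of_int (\<lfloor>t\<rfloor> - n)" by (simp add: frac_def)
    show "r / N \<le> \<bar>t - z - of_int n\<bar>"
    proof (cases "\<lfloor>t\<rfloor> - n \<ge> 0")
      case True
      then have "real_of_int (\<lfloor>t\<rfloor> - n) \<ge> 0" by linarith
      then show ?thesis unfolding eq using f by linarith
    next
      case False
      then have "real_of_int (\<lfloor>t\<rfloor> - n) \<le> - 1" by linarith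
      then show ?thesis unfolding eq using f by linarith
    qed
  qed (use r N in auto)
  then show ?thesis unfolding scaled_window_def N_def[symmetric] H HN .
qed

text \<open>The window over \<open>- r\<close> to \<open>b\<close> is at least
  \<open>1 - \<kappa>\<close> on the whole target, including differences just above an integer;
  hence the margin to the left of 0.\<close>

lemma close_tuples_upper:
  assumes j: "j \<ge> 1" and r: "r > 0" and x: "x \<ge> 0" "x + r \<le> b" and N: "b + r \<le> real (j ^ B)"
    and \<kappa>: "\<kappa> = 2 * real (j ^ B) ^ 3 * exp (- (real (j ^ B) * r\<^sup>2))" "\<kappa> < 1" and fS: "finite S"
  shows "real (card (close_tuples (\<lambda>n. real n powr \<alpha>) m S (x / real (j ^ B)))) * (1 - \<kappa>) ^ (m - 1) \<le>
    correlation_sum (scaled_window B j (- r) b) m S \<alpha>"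
proof -
  let ?T = "close_tuples (\<lambda>n. real n powr \<alpha>) m S (x / real (j ^ B))"
  have ab: "- r < b" "b - - r \<le> real (j ^ B)" using x r N by auto
  note w = scaled_window_props[OF ab j]
  have "real (card ?T) * (1 - \<kappa>) ^ (m - 1) = (\<Sum>z\<in>?T. (1 - \<kappa>) ^ (m - 1))" by simp
  also have "\<dots> \<le> (\<Sum>z\<in>?T. forest_prod (scaled_window B j (- r) b) {1..<m} (\<lambda>_. 0) z \<alpha>)"
  proof (rule sum_mono)
    fix z assume z: "z \<in> ?T"
    have "(1 - \<kappa>) ^ (m - 1) = (\<Prod>i\<in>{1..<m}. 1 - \<kappa>)" by simp
    also have "\<dots> \<le> forest_prod (scaled_window B j (- r) b) {1..<m} (\<lambda>_. 0) z \<alpha>"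
      unfolding forest_prod_def
    proof (intro prod_mono conjI)
      fix i assume i: "i \<in> {1..<m}"
      let ?d = "real (z i) powr \<alpha> - real (z 0) powr \<alpha>"
      have "frac ?d \<le> x / real (j ^ B)" using z i by (auto simp: close_tuples_def)
      also have "\<dots> \<le> (b - r) / real (j ^ B)" using x by (intro divide_right_mono) auto
      finally have "?d - of_int \<lfloor>?d\<rfloor> \<le> (b - r) / real (j ^ B)" by (simp add: frac_def)
      moreover have "(- r + r) / real (j ^ B) \<le> ?d - of_int \<lfloor>?d\<rfloor>" by simp
      ultimately show "1 - \<kappa> \<le> scaled_window B j (- r) b ?d"
        unfolding \<kappa>(1) using w(5)[OF r] by blast
    qed (use \<kappa>(2) in auto)
    finally show "(1 - \<kappa>) ^ (m - 1) \<le> forest_prod (scaled_window B j (- r) b) {1..<m} (\<lambda>_. 0) z \<alpha>" .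
  qed
  also have "\<dots> \<le> correlation_sum (scaled_window B j (- r) b) m S \<alpha>"
    unfolding correlation_sum_def using fS w(1)
    by (intro sum_mono2) (auto simp: close_tuples_def intro!: forest_prod_nonneg)
  finally show ?thesis .
qed

text \<open>The narrowed window is at most 1 everywhere and at most \<open>\<kappa>\<close> as soon
  as one difference leaves the target. That error is multiplied by the number of tuples, at most
  \<open>N ^ m\<close>.\<close>

lemma close_tuples_lower:
  assumes j: "j \<ge> 1" and r: "r > 0" and x: "r < b" "b \<le> x - r" and N: "b - r \<le> real (j ^ B)"
    and \<kappa>: "\<kappa> = 2 * real (j ^ B) ^ 3 * exp (- (real (j ^ B) * r\<^sup>2))" and S: "S \<subseteq> {1..j ^ B}"
  shows "correlation_sum (scaled_window B j r b) m S \<alpha> \<le>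
    real (card (close_tuples (\<lambda>n. real n powr \<alpha>) m S (x / real (j ^ B)))) + \<kappa> * real (j ^ B) ^ m"
proof -
  have fS: "finite S" using S finite_subset by blast
  have cS: "card S \<le> j ^ B" using card_mono[OF _ S] by simp
  let ?T = "close_tuples (\<lambda>n. real n powr \<alpha>) m S (x / real (j ^ B))"
  note w = scaled_window_props[OF x(1) N j]
  have \<kappa>0: "\<kappa> \<ge> 0" by (simp add: \<kappa>)
  have "correlation_sum (scaled_window B j r b) m S \<alpha> \<le> (\<Sum>z\<in>inj_tuples m S. (if z \<in> ?T then 1 else 0) + \<kappa>)"
    unfolding correlation_sum_def
  proof (rule sum_mono)
    fix z assume z: "z \<in> inj_tuples m S"
    show "star_prod (scaled_window B j r b) m z \<alpha> \<le> (if z \<in> ?T then 1 else 0) + \<kappa>"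
    proof (cases "z \<in> ?T")
      case True
      then show ?thesis using forest_prod_le_1[of "scaled_window B j r b" "{1..<m}" "\<lambda>_. 0" z \<alpha>] w(1,2) \<kappa>0
        by (simp add: add_increasing2)
    next
      case False
      then obtain i where i: "i \<in> {1..<m}" "x / real (j ^ B) < frac (real (z i) powr \<alpha> - real (z 0) powr \<alpha>)"
        using z by (auto simp: close_tuples_def not_le)
      have "star_prod (scaled_window B j r b) m z \<alpha> \<le>
        scaled_window B j r b (real (z i) powr \<alpha> - real (z 0) powr \<alpha>)"
        using i(1) w(1,2) by (intro forest_prod_le_member) auto
      also have "\<dots> \<le> \<kappa>" unfolding \<kappa> using x r i by (intro scaled_window_outside N j) auto
      finally show ?thesis using False by simp
    qed
  qed
  also have "\<dots> = real (card ?T) + \<kappa> * card (inj_tuples m S)"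
  proof -
    have "inj_tuples m S \<inter> ?T = ?T" by (auto simp: close_tuples_def)
    then show ?thesis using fS by (simp add: sum.distrib sum.If_cases)
  qed
  also have "\<dots> \<le> real (card ?T) + \<kappa> * real (j ^ B) ^ m"
  proof (intro add_left_mono mult_left_mono \<kappa>0)
    have "card (inj_tuples m S) \<le> (j ^ B) ^ m"
      using card_inj_tuples_le[OF fS, of m] power_mono[OF cS, of m] by linarith
    then show "real (card (inj_tuples m S)) \<le> real (j ^ B) ^ m"
      by (metis of_nat_le_iff of_nat_power)
  qed
  finally show ?thesis .
qed

text \<open>Sandwich between a widened and a narrowed window. Limits are assumed for rational
  endpoints only, as an almost sure statement reaches only countably many windows at once; density
  of the rationals recovers every real \<open>x\<close>.\<close>

lemma close_tuples_tendsto: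
  assumes m: "m \<ge> 1" and B: "B \<ge> 1" and x: "x > 0"
    and lim: "\<And>a b::rat. a < b \<Longrightarrow>
      (\<lambda>j. correlation_sum (scaled_window B j (of_rat a) (of_rat b)) m (block B j) \<alpha> / real (j ^ B))
        \<longlonglongrightarrow> (of_rat b - of_rat a) ^ (m - 1)"
  shows "(\<lambda>j. real (card (close_tuples (\<lambda>n. real n powr \<alpha>) m (block B j) (x / real (j ^ B)))) / real (j ^ B))
    \<longlonglongrightarrow> x ^ (m - 1)"
proof -
  define N where "N = (\<lambda>j. real (j ^ B))"
  define T where "T = (\<lambda>j. real (card (close_tuples (\<lambda>n. real n powr \<alpha>) m (block B j) (x / real (j ^ B)))))"
  define \<kappa> where "\<kappa> = (\<lambda>r j. 2 * N j ^ 3 * exp (- (N j * r\<^sup>2)))"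
  have ev: "\<forall>\<^sub>F j in sequentially. 1 \<le> j \<and> c \<le> N j" for c
    unfolding N_def using eventually_ge_at_top[of 1] filterlim_real_power_at_top[OF B]
    by (auto simp: filterlim_at_top intro: eventually_conj)
  have \<kappa>_lim: "(\<lambda>j. \<kappa> r j * N j ^ p) \<longlonglongrightarrow> 0" if "r > 0" for r p
  proof -
    have "(\<lambda>j. 2 * (N j ^ (p + 3) * exp (- (N j * r\<^sup>2)))) \<longlonglongrightarrow> 2 * 0"
      unfolding N_def using that by (intro tendsto_mult_left power_mult_exp_tendsto_0 B) auto
    then show ?thesis by (simp add: \<kappa>_def power_add mult_ac)
  qed
  have fb: "finite (block B j)" "block B j \<subseteq> {1..j ^ B}" for j by (auto simp: block_def)
  have cont: "((\<lambda>r. (x + c * r) ^ (m - 1)) \<longlongrightarrow> x ^ (m - 1)) (at_right 0)" for c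
  proof -
    have "((\<lambda>r. (x + c * r) ^ (m - 1)) \<longlongrightarrow> (x + c * 0) ^ (m - 1)) (at_right 0)"
      by (intro tendsto_intros)
    then show ?thesis by simp
  qed
  \<comment> \<open>The condition \<open>q * 4 < x\<close> keeps \<open>x - 3 * q\<close> positive,
    so that the narrowed window is nonempty.\<close>
  have pick: "\<exists>q. 0 < (of_rat q :: real) \<and> of_rat q < \<delta> \<and> of_rat q * 4 < x" if "\<delta> > 0" for \<delta> :: real
  proof -
    have "0 < min \<delta> (x / 4)" using that x by simp
    then obtain q where "0 < (of_rat q :: real)" "of_rat q < min \<delta> (x / 4)"
      using of_rat_dense[of 0 "min \<delta> (x / 4)"] by auto
    then show ?thesis by (intro exI[of _ q]) auto
  qed
  have "(\<lambda>j. T j / N j) \<longlonglongrightarrow> x ^ (m - 1)"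
  proof (rule order_tendstoI)
    fix u assume u: "x ^ (m - 1) < u"
    have "\<forall>\<^sub>F r in at_right 0. (x + 3 * r) ^ (m - 1) < u" by (rule order_tendstoD(2)[OF cont u])
    then obtain \<delta> where \<delta>: "\<delta> > 0" "\<And>r. 0 < r \<Longrightarrow> r < \<delta> \<Longrightarrow> (x + 3 * r) ^ (m - 1) < u"
      unfolding eventually_at_right_field by auto
    obtain q where q: "0 < (of_rat q :: real)" "of_rat q < \<delta>" using pick[OF \<delta>(1)] by blast
    define r where "r = (of_rat q :: real)"
    \<comment> \<open>The rational endpoint is kept below \<open>x + 2 * r\<close>, so the widened
      window has length \<open>b + r\<close> below \<open>x + 3 * r\<close>.\<close>
    obtain b' where b': "x + r < of_rat b'" "of_rat b' < x + 2 * r"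
      using of_rat_dense[of "x + r" "x + 2 * r"] q by (auto simp: r_def)
    define b where "b = (of_rat b' :: real)"
    have r: "r > 0" using q by (simp add: r_def)
    have qb: "- q < b'"
    proof -
      have "of_rat (- q) < (of_rat b' :: real)" using b' r x by (simp add: r_def of_rat_minus)
      then show ?thesis by (simp only: of_rat_less)
    qed
    have "(b + r) ^ (m - 1) \<le> (x + 3 * r) ^ (m - 1)"
      using b' r x by (intro power_mono) (auto simp: b_def)
    also have "\<dots> < u" using \<delta>(2)[of r] q by (simp add: r_def)
    finally have bu: "(b + r) ^ (m - 1) < u" .
    have "(\<lambda>j. correlation_sum (scaled_window B j (- r) b) m (block B j) \<alpha> / N j) \<longlonglongrightarrow> (b + r) ^ (m - 1)"
      using lim[OF qb] by (simp add: N_def r_def b_def of_rat_minus)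
    moreover have "(\<lambda>j. (1 - \<kappa> r j * N j ^ 0) ^ (m - 1)) \<longlonglongrightarrow> (1 - 0) ^ (m - 1)"
      by (intro tendsto_intros \<kappa>_lim r)
    ultimately have "(\<lambda>j. correlation_sum (scaled_window B j (- r) b) m (block B j) \<alpha> / N j / (1 - \<kappa> r j * N j ^ 0) ^ (m - 1))
      \<longlonglongrightarrow> (b + r) ^ (m - 1) / (1 - 0) ^ (m - 1)"
      by (intro tendsto_divide) auto
    then have "\<forall>\<^sub>F j in sequentially. correlation_sum (scaled_window B j (- r) b) m (block B j) \<alpha> / N j / (1 - \<kappa> r j * N j ^ 0) ^ (m - 1) < u"
      using bu by (intro order_tendstoD) auto
    moreover have "\<forall>\<^sub>F j in sequentially. \<kappa> r j * N j ^ 0 < 1"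
      by (rule order_tendstoD[OF \<kappa>_lim[OF r]]) simp
    ultimately show "\<forall>\<^sub>F j in sequentially. T j / N j < u"
      using ev[of "b + r"]
    proof eventually_elim
      case (elim j)
      have Nj: "N j > 0" using elim by (simp add: N_def)
      have pos: "(1 - \<kappa> r j) ^ (m - 1) > 0" using elim by simp
      have "T j * (1 - \<kappa> r j) ^ (m - 1) \<le> correlation_sum (scaled_window B j (- r) b) m (block B j) \<alpha>"
        unfolding T_def using elim r x b' by (intro close_tuples_upper fb) (auto simp: b_def \<kappa>_def N_def)
      then have "T j \<le> correlation_sum (scaled_window B j (- r) b) m (block B j) \<alpha> / (1 - \<kappa> r j) ^ (m - 1)"
        using pos by (simp add: pos_le_divide_eq)
      then have "T j / N j \<le> correlation_sum (scaled_window B j (- r) b) m (block B j) \<alpha> / (1 - \<kappa> r j) ^ (m - 1) / N j"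
        using Nj by (intro divide_right_mono) auto
      also have "\<dots> = correlation_sum (scaled_window B j (- r) b) m (block B j) \<alpha> / N j / (1 - \<kappa> r j * N j ^ 0) ^ (m - 1)"
        by (simp add: mult.commute)
      also have "\<dots> < u" using elim by simp
      finally show ?case .
    qed
  next
    fix l assume l: "l < x ^ (m - 1)"
    have "\<forall>\<^sub>F r in at_right 0. (x + (- 3) * r) ^ (m - 1) > l" by (rule order_tendstoD(1)[OF cont l])
    then obtain \<delta> where \<delta>: "\<delta> > 0" "\<And>r. 0 < r \<Longrightarrow> r < \<delta> \<Longrightarrow> (x + (- 3) * r) ^ (m - 1) > l"
      unfolding eventually_at_right_field by auto
    obtain q where q: "0 < (of_rat q :: real)" "of_rat q < \<delta>" "of_rat q * 4 < x" using pick[OF \<delta>(1)] by blast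
    define r where "r = (of_rat q :: real)"
    obtain b' where b': "x - 2 * r < of_rat b'" "of_rat b' < x - r"
      using of_rat_dense[of "x - 2 * r" "x - r"] q by (auto simp: r_def)
    define b where "b = (of_rat b' :: real)"
    have r: "r > 0" using q by (simp add: r_def)
    have rb: "r < b" using b' q by (simp add: r_def b_def)
    then have qb: "q < b'" unfolding r_def b_def by (simp only: of_rat_less)
    have "l < (x + (- 3) * r) ^ (m - 1)" using \<delta>(2)[of r] q by (simp add: r_def)
    also have "\<dots> \<le> (b - r) ^ (m - 1)"
      using b' q by (intro power_mono) (auto simp: b_def r_def)
    finally have bu: "l < (b - r) ^ (m - 1)" .
    have "(\<lambda>j. correlation_sum (scaled_window B j r b) m (block B j) \<alpha> / N j - \<kappa> r j * N j ^ (m - 1)) \<longlonglongrightarrow> (b - r) ^ (m - 1) - 0"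
      using lim[OF qb] by (intro tendsto_diff \<kappa>_lim r) (simp add: N_def r_def b_def)
    then have "\<forall>\<^sub>F j in sequentially. correlation_sum (scaled_window B j r b) m (block B j) \<alpha> / N j - \<kappa> r j * N j ^ (m - 1) > l"
      using bu by (intro order_tendstoD) auto
    then show "\<forall>\<^sub>F j in sequentially. T j / N j > l"
      using ev[of "b - r"]
    proof eventually_elim
      case (elim j)
      have Nj: "N j > 0" using elim by (simp add: N_def)
      have "correlation_sum (scaled_window B j r b) m (block B j) \<alpha> \<le> T j + \<kappa> r j * N j ^ m"
        unfolding T_def N_def using elim r x b' rb by (intro close_tuples_lower fb) (auto simp: b_def \<kappa>_def N_def)
      then have "correlation_sum (scaled_window B j r b) m (block B j) \<alpha> / N j \<le> (T j + \<kappa> r j * N j ^ m) / N j"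
        using Nj by (intro divide_right_mono) auto
      also have "\<dots> = T j / N j + \<kappa> r j * N j ^ (m - 1)"
        using Nj m by (simp add: add_divide_distrib power_eq_if[of _ m])
      finally show ?case using elim by linarith
    qed
  qed
  then show ?thesis by (simp add: T_def N_def)
qed

text \<open>The Taylor polynomial of \<open>1 - exp (- x)\<close>, the gap distribution of a Poisson
  process.\<close>

definition poisson_partial_sum :: "nat \<Rightarrow> real \<Rightarrow> real" where
  "poisson_partial_sum R x = (\<Sum>k=1..R. (-1) ^ (k + 1) * (x ^ k / fact k))"

lemma isCont_poisson_partial_sum: "isCont (poisson_partial_sum R) x"
  unfolding poisson_partial_sum_def by (intro continuous_intros) auto

lemma bonferroni_sum_tendsto:
  assumes "\<And>k. 1 \<le> k \<Longrightarrow> k \<le> R \<Longrightarrow> (\<lambda>j. real (card (close_tuples \<theta> (Suc k) (S j) (s j))) / N j) \<longlonglongrightarrow> x ^ k"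
  shows "(\<lambda>j. (\<Sum>k=1..R. (-1) ^ (k + 1) * (real (card (close_tuples \<theta> (Suc k) (S j) (s j))) / fact k)) / N j)
    \<longlonglongrightarrow> poisson_partial_sum R x"
proof -
  have "(\<lambda>j. (\<Sum>k=1..R. (-1) ^ (k + 1) * ((real (card (close_tuples \<theta> (Suc k) (S j) (s j))) / N j) / fact k)))
    \<longlonglongrightarrow> poisson_partial_sum R x"
    unfolding poisson_partial_sum_def by (intro tendsto_intros assms) auto
  then show ?thesis by (simp add: sum_divide_distrib mult.commute)
qed

section \<open>From the blocks to all \<open>N\<close>\<close>

lemma power_block_exists:
  fixes N :: nat
  assumes "B \<ge> 1" "j0 ^ B \<le> N"
  shows "\<exists>j\<ge>j0. j ^ B \<le> N \<and> N < (j + 1) ^ B"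
proof -
  have "N < (N + 1) ^ B" using assms(1) self_le_power[of "N + 1" B] by simp
  then have ex: "\<exists>j. N < (j + 1) ^ B" by blast
  define j where "j = (LEAST j. N < (j + 1) ^ B)"
  have j: "N < (j + 1) ^ B" unfolding j_def using ex by (rule LeastI_ex)
  have "j ^ B \<le> N"
  proof (cases j)
    case 0
    then show ?thesis using assms by (simp add: power_0_left)
  next
    case (Suc i)
    then have "\<not> N < (i + 1) ^ B" unfolding j_def by (intro not_less_Least) simp
    then show ?thesis using Suc by simp
  qed
  moreover have "j0 ^ B < (j + 1) ^ B" using j assms by linarith
  then have "j0 < j + 1" by (rule power_less_imp_less_base) simp
  ultimately show ?thesis using j by (intro exI[of _ j]) auto
qed

lemma power_Suc_ratio_tendsto: "(\<lambda>j. real ((j + 1) ^ B) / real (j ^ B)) \<longlonglongrightarrow> 1"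
proof -
  have "(\<lambda>j. (1 + 1 / real j) ^ B) \<longlonglongrightarrow> (1 + 0) ^ B"
    by (intro tendsto_intros lim_1_over_n)
  moreover have "\<forall>\<^sub>F j in sequentially. (1 + 1 / real j) ^ B = real ((j + 1) ^ B) / real (j ^ B)"
    using eventually_ge_at_top[of 1]
  proof eventually_elim
    case (elim j)
    then have "1 + 1 / real j = real (j + 1) / real j" by (simp add: field_simps)
    then show ?case by (simp add: power_divide)
  qed
  ultimately show ?thesis by (auto intro: Lim_transform_eventually)
qed

text \<open>Bounds, relative to \<open>j ^ B\<close>, the number of indices in
  \<open>{1..N + 1}\<close> outside the block, uniformly for
  \<open>j ^ B \<le> N < (j + 1) ^ B\<close>.\<close>

definition block_defect :: "nat \<Rightarrow> nat \<Rightarrow> real" where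
  "block_defect B j = (real ((j + 1) ^ B) + 1 - real (card (block B j))) / real (j ^ B)"

lemma block_defect_tendsto: assumes "B \<ge> 2" shows "block_defect B \<longlonglongrightarrow> 0"
proof -
  have "(\<lambda>j. real ((j + 1) ^ B) / real (j ^ B) + 1 / real (j ^ B) - 1 + (1 / real j) ^ 2) \<longlonglongrightarrow> 1 + 0 - 1 + 0 ^ 2"
    using assms by (intro tendsto_intros power_Suc_ratio_tendsto lim_1_over_n
        tendsto_divide_0[OF tendsto_const filterlim_at_top_imp_at_infinity[OF filterlim_real_power_at_top]]) auto
  moreover have "\<forall>\<^sub>F j in sequentially. real ((j + 1) ^ B) / real (j ^ B) + 1 / real (j ^ B) - 1 + (1 / real j) ^ 2 = block_defect B j"
    using eventually_ge_at_top[of 1]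
  proof eventually_elim
    case (elim j)
    have le: "j ^ (B - 2) \<le> j ^ B" using elim by (intro power_increasing) auto
    have "real (j ^ (B - 2)) = real (j ^ B) / real j ^ 2"
      unfolding of_nat_power using assms elim by (intro power_diff) auto
    then have c: "real (card (block B j)) = real (j ^ B) - real (j ^ B) / real j ^ 2"
      using le by (simp add: block_def of_nat_diff)
    show ?case unfolding block_defect_def c using elim
      by (simp add: diff_divide_distrib add_divide_distrib power_divide)
  qed
  ultimately show ?thesis by (auto intro: Lim_transform_eventually)
qed

text \<open>For the upper bound each index outside the block costs 2, and the scale
  \<open>x / N\<close> only grows to \<open>x / j ^ B\<close>. For the lower bound extra indices are
  harmless, as successors persist in larger sets; but the scale shrinks, which the smaller
  \<open>y\<close> absorbs, and wrap-around costs one point.\<close>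

lemma gap_distribution_block_bounds:
  assumes j: "j \<ge> 1" and N: "j ^ B \<le> N" "N < (j + 1) ^ B" and x: "0 \<le> x"
    and inj: "inj_on (\<lambda>n. frac (\<theta> n)) {1..}"
  shows "gap_distribution x \<theta> N \<le> real (card (has_neighbour \<theta> (block B j) (x / real (j ^ B)))) / real (j ^ B) + 2 * block_defect B j"
    and "y * real ((j + 1) ^ B) \<le> x * real (j ^ B) \<Longrightarrow> y \<ge> 0 \<Longrightarrow> y < real (j ^ B) \<Longrightarrow>
      real (card (has_neighbour \<theta> (block B j) (y / real (j ^ B)))) / real (j ^ B) - block_defect B j - 1 / real (j ^ B)
        \<le> gap_distribution x \<theta> N"
proof -
  define Nj where "Nj = real (j ^ B)"
  have jB: "j ^ B \<ge> 1" using j by simp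
  have Nj: "Nj \<ge> 1" "Nj \<le> real N" "real N \<le> real ((j + 1) ^ B)"
    using jB N by (auto simp: Nj_def simp flip: of_nat_power)
  have N1: "N \<ge> 1" using jB N by linarith
  let ?S = "block B j"
  have S: "finite ?S" "?S \<subseteq> {1..N + 1}" using N by (auto simp: block_def)
  have injN: "inj_on (\<lambda>n. frac (\<theta> n)) {1..N + 1}" using inj by (rule inj_on_subset) auto
  have injS: "inj_on (\<lambda>n. frac (\<theta> n)) ?S" using injN S(2) by (rule inj_on_subset)
  have g: "gap_distribution x \<theta> N = real (card (has_successor \<theta> {1..N + 1} (x / N))) / N"
    by (rule gap_distribution_eq[OF N1 injN])
  have cS: "card ?S \<le> j ^ B" by (simp add: block_def)
  have dfct: "(real N + 1 - real (card ?S)) / Nj \<le> block_defect B j"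
    unfolding block_defect_def Nj_def[symmetric] using Nj by (intro divide_right_mono) auto
  have fin: "finite (has_successor \<theta> {1..N + 1} s)" for s by (simp add: has_successor_def)
  show "gap_distribution x \<theta> N \<le> real (card (has_neighbour \<theta> ?S (x / real (j ^ B)))) / real (j ^ B) + 2 * block_defect B j"
  proof -
    let ?D = "{1..N + 1} - ?S"
    have D: "?D \<union> ?S = {1..N + 1}" "card ?D = N + 1 - card ?S" using S by (auto simp: card_Diff_subset)
    have "card ?S \<le> N + 1" using cS N by linarith
    then have cD: "real (card ?D) = real N + 1 - real (card ?S)" using D(2) by (simp add: of_nat_diff)
    have "x / real N \<le> x / Nj" using x Nj by (intro divide_left_mono) auto
    then have "card (has_successor \<theta> {1..N + 1} (x / N)) \<le> card (has_successor \<theta> {1..N + 1} (x / Nj))"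
      by (intro card_mono fin has_successor_mono) auto
    also have "\<dots> \<le> card (has_successor \<theta> ?S (x / Nj)) + 2 * card ?D"
      using card_has_successor_union[of ?D ?S \<theta> "x / Nj"] S injN D(1) by simp
    finally have "card (has_successor \<theta> {1..N + 1} (x / N)) \<le> card (has_successor \<theta> ?S (x / Nj)) + 2 * card ?D" .
    moreover have "card (has_successor \<theta> ?S (x / Nj)) \<le> card (has_neighbour \<theta> ?S (x / Nj))"
      using S by (intro card_mono has_successor_subset_has_neighbour) (simp add: has_neighbour_def)
    ultimately have "real (card (has_successor \<theta> {1..N + 1} (x / N))) \<le>
      real (card (has_neighbour \<theta> ?S (x / Nj))) + 2 * real (card ?D)" by linarith
    then have "real (card (has_successor \<theta> {1..N + 1} (x / N))) \<le>
      real (card (has_neighbour \<theta> ?S (x / Nj))) + 2 * (real N + 1 - real (card ?S))"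
      unfolding cD .
    then have "gap_distribution x \<theta> N \<le> (real (card (has_neighbour \<theta> ?S (x / Nj))) + 2 * (real N + 1 - real (card ?S))) / real N"
      unfolding g by (intro divide_right_mono) auto
    also have "\<dots> \<le> (real (card (has_neighbour \<theta> ?S (x / Nj))) + 2 * (real N + 1 - real (card ?S))) / Nj"
      using Nj cD by (intro divide_left_mono add_nonneg_nonneg mult_pos_pos) auto
    also have "\<dots> = real (card (has_neighbour \<theta> ?S (x / Nj))) / Nj + 2 * ((real N + 1 - real (card ?S)) / Nj)"
      by (simp add: add_divide_distrib)
    also have "\<dots> \<le> real (card (has_neighbour \<theta> ?S (x / Nj))) / Nj + 2 * block_defect B j"
      using dfct by linarith
    finally show ?thesis by (simp add: Nj_def)
  qed
  show "real (card (has_neighbour \<theta> ?S (y / real (j ^ B)))) / real (j ^ B) - block_defect B j - 1 / real (j ^ B)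
        \<le> gap_distribution x \<theta> N"
    if y: "y * real ((j + 1) ^ B) \<le> x * real (j ^ B)" "y \<ge> 0" "y < real (j ^ B)"
  proof -
    let ?h = "real (card (has_neighbour \<theta> ?S (y / Nj)))"
    have "y * real N \<le> y * real ((j + 1) ^ B)" using Nj y by (intro mult_left_mono) auto
    also have "\<dots> \<le> x * Nj" using y(1) by (simp add: Nj_def)
    finally have yN: "y * real N \<le> x * Nj" .
    have "0 < Nj" "0 < real N" using Nj by auto
    then have "y / Nj \<le> x / real N" using yN by (simp add: field_simps)
    have "card (has_neighbour \<theta> ?S (y / Nj)) \<le> card (has_successor \<theta> ?S (y / Nj)) + 1"
    proof (rule card_has_neighbour_le[OF S(1) injS])
      show "y / Nj < 1" using y(3) \<open>0 < Nj\<close> unfolding Nj_def[symmetric] by (simp add: divide_less_eq)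
    qed
    also have "card (has_successor \<theta> ?S (y / Nj)) \<le> card (has_successor \<theta> {1..N + 1} (x / N))"
      using \<open>y / Nj \<le> x / real N\<close> S by (intro card_mono fin has_successor_mono) auto
    finally have "?h - 1 \<le> real (card (has_successor \<theta> {1..N + 1} (x / N)))" by linarith
    then have "(?h - 1) / real N \<le> gap_distribution x \<theta> N"
      unfolding g by (intro divide_right_mono) auto
    \<comment> \<open>Changing the denominator from \<open>j ^ B\<close> to \<open>N\<close> costs
      at most \<open>(N - j ^ B) / j ^ B\<close>, and this is within the defect because the block
      has at most \<open>j ^ B\<close> elements.\<close>
    moreover have "?h / Nj - block_defect B j - 1 / Nj \<le> (?h - 1) / real N"
    proof -
      have "card (has_neighbour \<theta> ?S (y / Nj)) \<le> card ?S"
        using S by (intro card_mono) (auto simp: has_neighbour_def)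
      then have hNj: "?h \<le> real (card ?S)" "real (card ?S) \<le> Nj" using cS by (auto simp: Nj_def simp del: of_nat_power)
      have "?h / Nj - ?h / real N = (?h / Nj) * ((real N - Nj) / real N)" using Nj by (simp add: field_simps)
      also have "\<dots> \<le> 1 * ((real N - Nj) / Nj)"
        using hNj Nj by (intro mult_mono divide_left_mono mult_pos_pos) auto
      also have "\<dots> \<le> (real N + 1 - real (card ?S)) / Nj"
        using hNj Nj by (simp add: divide_right_mono)
      also have "\<dots> \<le> block_defect B j" by (rule dfct)
      finally have "?h / Nj - ?h / real N \<le> block_defect B j" .
      moreover have "1 / real N \<le> 1 / Nj" using Nj by (intro divide_left_mono) auto
      ultimately show ?thesis by (simp add: diff_divide_distrib)
    qed
    ultimately show ?thesis by (simp add: Nj_def)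
  qed
qed

lemma eventually_block_transfer:
  assumes B: "B \<ge> 1" and ev: "\<forall>\<^sub>F j in sequentially. \<forall>N. j ^ B \<le> N \<longrightarrow> N < (j + 1) ^ B \<longrightarrow> P N"
  shows "\<forall>\<^sub>F N in sequentially. P N"
proof -
  obtain j0 where j0: "\<And>j N. j \<ge> j0 \<Longrightarrow> j ^ B \<le> N \<Longrightarrow> N < (j + 1) ^ B \<Longrightarrow> P N"
    using ev unfolding eventually_sequentially by blast
  show ?thesis unfolding eventually_sequentially
  proof (intro exI allI impI)
    fix N assume "j0 ^ B \<le> N"
    then show "P N" using power_block_exists[OF B] j0 by blast
  qed
qed

lemma gap_distribution_limsup_le:
  assumes B: "B \<ge> 2" and x: "x \<ge> 0" and inj: "inj_on (\<lambda>n. frac (\<theta> n)) {1..}" and R: "odd R"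
    and lim: "\<And>k x. 1 \<le> k \<Longrightarrow> k \<le> R \<Longrightarrow> x > 0 \<Longrightarrow>
      (\<lambda>j. real (card (close_tuples \<theta> (Suc k) (block B j) (x / real (j ^ B)))) / real (j ^ B)) \<longlonglongrightarrow> x ^ k"
  shows "limsup (\<lambda>N. ereal (gap_distribution x \<theta> N)) \<le> ereal (poisson_partial_sum R x)"
proof (rule ereal_le_epsilon2)
  fix e :: real assume e: "e > 0"
  \<comment> \<open>Moving to some \<open>y > x\<close> covers \<open>x = 0\<close> as well, where
    no limit of tuple counts is assumed.\<close>
  have "(poisson_partial_sum R \<longlongrightarrow> poisson_partial_sum R x) (at_right x)"
    using isCont_poisson_partial_sum[where R = R and x = x] by (auto simp: isCont_def intro: tendsto_mono[OF at_le])
  then have "\<forall>\<^sub>F y in at_right x. poisson_partial_sum R y < poisson_partial_sum R x + e"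
    using e by (intro order_tendstoD) auto
  then obtain y where y: "y > x" "poisson_partial_sum R y < poisson_partial_sum R x + e"
    unfolding eventually_at_right_field by (meson dense)
  let ?Q = "\<lambda>j. (\<Sum>k=1..R. (-1) ^ (k + 1) * (real (card (close_tuples \<theta> (Suc k) (block B j) (y / real (j ^ B)))) / fact k)) / real (j ^ B)"
  have "(\<lambda>j. ?Q j + 2 * block_defect B j) \<longlonglongrightarrow> poisson_partial_sum R y + 2 * 0"
    using y x by (intro tendsto_intros bonferroni_sum_tendsto lim block_defect_tendsto B) auto
  then have "\<forall>\<^sub>F j in sequentially. ?Q j + 2 * block_defect B j < poisson_partial_sum R x + e"
    using y by (intro order_tendstoD) auto
  then have "\<forall>\<^sub>F j in sequentially. \<forall>N. j ^ B \<le> N \<longrightarrow> N < (j + 1) ^ B \<longrightarrow> gap_distribution x \<theta> N \<le> poisson_partial_sum R x + e"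
    using eventually_ge_at_top[of 1]
  proof eventually_elim
    case (elim j)
    show ?case
    proof (intro allI impI)
      fix N assume N: "j ^ B \<le> N" "N < (j + 1) ^ B"
      have fb: "finite (block B j)" by (simp add: block_def)
      have "card (has_neighbour \<theta> (block B j) (x / real (j ^ B))) \<le> card (has_neighbour \<theta> (block B j) (y / real (j ^ B)))"
        using y fb by (intro card_mono has_neighbour_mono divide_right_mono) (auto simp: has_neighbour_def)
      then have "real (card (has_neighbour \<theta> (block B j) (x / real (j ^ B)))) \<le>
        (\<Sum>k=1..R. (-1) ^ (k + 1) * (real (card (close_tuples \<theta> (Suc k) (block B j) (y / real (j ^ B)))) / fact k))"
        using bonferroni_neighbours(1)[OF fb R, of \<theta> "y / real (j ^ B)"] by linarith
      then have "real (card (has_neighbour \<theta> (block B j) (x / real (j ^ B)))) / real (j ^ B) \<le> ?Q j"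
        by (intro divide_right_mono) auto
      then show "gap_distribution x \<theta> N \<le> poisson_partial_sum R x + e"
        using gap_distribution_block_bounds(1)[OF elim(2) N x inj] elim(1) by linarith
    qed
  qed
  then have "\<forall>\<^sub>F N in sequentially. gap_distribution x \<theta> N \<le> poisson_partial_sum R x + e"
    by (rule eventually_block_transfer[rotated]) (use B in simp)
  then show "limsup (\<lambda>N. ereal (gap_distribution x \<theta> N)) \<le> ereal (poisson_partial_sum R x) + ereal e"
    by (intro Limsup_bounded) simp
qed

lemma gap_distribution_le_liminf:
  assumes B: "B \<ge> 2" and x: "x \<ge> 0" and inj: "inj_on (\<lambda>n. frac (\<theta> n)) {1..}" and R: "even R"
    and lim: "\<And>k x. 1 \<le> k \<Longrightarrow> k \<le> R \<Longrightarrow> x > 0 \<Longrightarrow>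
      (\<lambda>j. real (card (close_tuples \<theta> (Suc k) (block B j) (x / real (j ^ B)))) / real (j ^ B)) \<longlonglongrightarrow> x ^ k"
  shows "ereal (poisson_partial_sum R x) \<le> liminf (\<lambda>N. ereal (gap_distribution x \<theta> N))"
proof (cases "x = 0")
  \<comment> \<open>Below \<open>x = 0\<close> there is no positive \<open>y\<close> to move to;
    here the polynomial vanishes and nonnegativity suffices.\<close>
  case True
  have "poisson_partial_sum R x = 0" unfolding poisson_partial_sum_def True by (intro sum.neutral) auto
  then show ?thesis by (auto intro!: Liminf_bounded always_eventually simp: gap_distribution_def)
next
  case False
  then have x0: "x > 0" using x by simp
  show ?thesis
  proof (rule ereal_le_epsilon2)
    fix e :: real assume e: "e > 0"
    have "(poisson_partial_sum R \<longlongrightarrow> poisson_partial_sum R x) (at_left x)"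
      using isCont_poisson_partial_sum[where R = R and x = x] by (auto simp: isCont_def intro: tendsto_mono[OF at_le])
    then have "\<forall>\<^sub>F y in at_left x. poisson_partial_sum R y > poisson_partial_sum R x - e"
      using e by (intro order_tendstoD) auto
    then obtain c where c: "c < x" "\<And>y. c < y \<Longrightarrow> y < x \<Longrightarrow> poisson_partial_sum R y > poisson_partial_sum R x - e"
      unfolding eventually_at_left_field by auto
    \<comment> \<open>The slack between \<open>y\<close> and \<open>x\<close> absorbs the change of
      scale within one block, whose ratio tends to 1.\<close>
    obtain y where y: "max c 0 < y" "y < x" using dense[of "max c 0" x] c x0 by auto
    then have y2: "poisson_partial_sum R y > poisson_partial_sum R x - e" "y > 0" using c by auto
    let ?Q = "\<lambda>j. (\<Sum>k=1..R. (-1) ^ (k + 1) * (real (card (close_tuples \<theta> (Suc k) (block B j) (y / real (j ^ B)))) / fact k)) / real (j ^ B)"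
    have inv: "(\<lambda>j. 1 / real (j ^ B)) \<longlonglongrightarrow> 0"
      using B by (intro tendsto_divide_0[OF tendsto_const] filterlim_at_top_imp_at_infinity filterlim_real_power_at_top) auto
    have "(\<lambda>j. ?Q j - block_defect B j - 1 / real (j ^ B)) \<longlonglongrightarrow> poisson_partial_sum R y - 0 - 0"
      using y2 by (intro tendsto_diff bonferroni_sum_tendsto lim block_defect_tendsto B inv) auto
    then have "\<forall>\<^sub>F j in sequentially. ?Q j - block_defect B j - 1 / real (j ^ B) > poisson_partial_sum R x - e"
      using y2 by (intro order_tendstoD) auto
    moreover have "\<forall>\<^sub>F j in sequentially. real ((j + 1) ^ B) / real (j ^ B) < x / y"
      using y y2 by (intro order_tendstoD(2)[OF power_Suc_ratio_tendsto]) simp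
    moreover have "\<forall>\<^sub>F j in sequentially. real (j ^ B) > y"
      using filterlim_real_power_at_top[of B] B unfolding filterlim_at_top_dense by auto
    ultimately have "\<forall>\<^sub>F j in sequentially. \<forall>N. j ^ B \<le> N \<longrightarrow> N < (j + 1) ^ B \<longrightarrow> poisson_partial_sum R x - e \<le> gap_distribution x \<theta> N"
      using eventually_ge_at_top[of 1]
    proof eventually_elim
      case (elim j)
      show ?case
      proof (intro allI impI)
        fix N assume N: "j ^ B \<le> N" "N < (j + 1) ^ B"
        have fb: "finite (block B j)" by (simp add: block_def)
        have "?Q j \<le> real (card (has_neighbour \<theta> (block B j) (y / real (j ^ B)))) / real (j ^ B)"
          by (intro divide_right_mono bonferroni_neighbours(2)[OF fb R]) auto
        moreover have "y * real ((j + 1) ^ B) \<le> x * real (j ^ B)"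
        proof -
          have "real (j ^ B) > 0" using elim by simp
          then have "real ((j + 1) ^ B) < x / y * real (j ^ B)" using elim(2) by (simp only: pos_divide_less_eq)
          then have "y * real ((j + 1) ^ B) < y * (x / y * real (j ^ B))" using y2 by (intro mult_strict_left_mono)
          then show ?thesis using y2 by simp
        qed
        ultimately show "poisson_partial_sum R x - e \<le> gap_distribution x \<theta> N"
          using gap_distribution_block_bounds(2)[OF elim(4) N x inj, of y] elim(1,3) y2 by linarith
      qed
    qed
    then have "\<forall>\<^sub>F N in sequentially. poisson_partial_sum R x - e \<le> gap_distribution x \<theta> N"
      by (rule eventually_block_transfer[rotated]) (use B in simp)
    then have "ereal (poisson_partial_sum R x - e) \<le> liminf (\<lambda>N. ereal (gap_distribution x \<theta> N))"
      by (intro Liminf_bounded) simp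
    then show "ereal (poisson_partial_sum R x) \<le> liminf (\<lambda>N. ereal (gap_distribution x \<theta> N)) + ereal e"
      by (cases "liminf (\<lambda>N. ereal (gap_distribution x \<theta> N))") auto
  qed
qed

section \<open>Distinctness of the fractional parts for almost all exponents\<close>

lemma powr_diff_strict_mono:
  assumes "1 \<le> m" "m < n" "0 < \<alpha>" "\<alpha> < \<beta>"
  shows "real n powr \<alpha> - real m powr \<alpha> < real n powr \<beta> - real m powr \<beta>"
proof -
  have lt: "real m powr \<alpha> < real n powr \<alpha>" using assms by (intro powr_less_mono2) auto
  have c: "1 < real n powr (\<beta> - \<alpha>)" using assms by simp
  have "real m powr \<beta> = real m powr \<alpha> * real m powr (\<beta> - \<alpha>)" by (simp add: powr_add[symmetric])
  also have "\<dots> \<le> real m powr \<alpha> * real n powr (\<beta> - \<alpha>)"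
    using assms by (intro mult_left_mono powr_mono2) auto
  finally have 1: "real m powr \<beta> \<le> real m powr \<alpha> * real n powr (\<beta> - \<alpha>)" .
  have "1 * (real n powr \<alpha> - real m powr \<alpha>) < real n powr (\<beta> - \<alpha>) * (real n powr \<alpha> - real m powr \<alpha>)"
    using lt c by (intro mult_strict_right_mono) auto
  also have "\<dots> = real n powr \<beta> - real m powr \<alpha> * real n powr (\<beta> - \<alpha>)"
    by (simp add: algebra_simps powr_add[symmetric])
  also have "\<dots> \<le> real n powr \<beta> - real m powr \<beta>" using 1 by (rule diff_left_mono)
  finally show ?thesis by simp
qed

text \<open>A coincidence means that \<open>n powr \<alpha> - m powr \<alpha>\<close> is an integer.
  This difference is strictly increasing in \<alpha>, so each triple of two indices and an integer
  excludes at most one exponent, and the exceptional set is countable.\<close>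

lemma AE_inj_frac_powr: "AE \<alpha> in lebesgue. \<alpha> > 0 \<longrightarrow> inj_on (\<lambda>n. frac (real n powr \<alpha>)) {1..}"
proof -
  define Z where "Z = (\<lambda>(n::nat, m::nat, i::int). {\<alpha>::real. 0 < \<alpha> \<and> 1 \<le> m \<and> m < n \<and> real n powr \<alpha> - real m powr \<alpha> = of_int i})"
  have "countable (Z t)" for t
  proof -
    obtain n m i where t: "t = (n, m, i)" by (cases t)
    have "\<alpha> = \<beta>" if "\<alpha> \<in> Z t" "\<beta> \<in> Z t" for \<alpha> \<beta>
      using that powr_diff_strict_mono[of m n \<alpha> \<beta>] powr_diff_strict_mono[of m n \<beta> \<alpha>]
      by (cases \<alpha> \<beta> rule: linorder_cases) (auto simp: Z_def t)
    then have "Z t \<subseteq> {SOME \<alpha>. \<alpha> \<in> Z t}" by (metis insertI1 someI subsetI)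
    then show ?thesis by (rule countable_subset) simp
  qed
  then have "countable (\<Union>t. Z t)" by simp
  then have "(\<Union>t. Z t) \<in> null_sets lborel" by (rule countable_imp_null_set_lborel)
  then have "AE \<alpha> in lborel. \<alpha> \<notin> (\<Union>t. Z t)" by (rule AE_not_in)
  then have "AE \<alpha> in lborel. \<alpha> > 0 \<longrightarrow> inj_on (\<lambda>n. frac (real n powr \<alpha>)) {1..}"
  proof eventually_elim
    case (elim \<alpha>)
    show ?case
    proof
      assume \<alpha>: "\<alpha> > 0"
      have ne: False if "1 \<le> m" "m < n" "frac (real n powr \<alpha>) = frac (real m powr \<alpha>)" for m n :: nat
      proof -
        have "real n powr \<alpha> - real m powr \<alpha> = of_int (\<lfloor>real n powr \<alpha>\<rfloor> - \<lfloor>real m powr \<alpha>\<rfloor>)"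
          using that(3) by (simp add: frac_def)
        then have "\<alpha> \<in> Z (n, m, \<lfloor>real n powr \<alpha>\<rfloor> - \<lfloor>real m powr \<alpha>\<rfloor>)" using that \<alpha> by (simp add: Z_def)
        then show False using elim by blast
      qed
      show "inj_on (\<lambda>n. frac (real n powr \<alpha>)) {1..}"
      proof (rule inj_onI)
        fix n m :: nat assume "n \<in> {1..}" "m \<in> {1..}" "frac (real n powr \<alpha>) = frac (real m powr \<alpha>)"
        then show "n = m" using ne[of n m] ne[of m n] by (cases n m rule: linorder_cases) auto
      qed
    qed
  qed
  then show ?thesis by (rule AE_completion)
qed

theorem corollary1p6:
  fixes K :: nat
  assumes "K \<ge> 1"
  shows "AE \<alpha> in lebesgue. \<alpha> > 16 * (real K)^2 + 8 * real K - 1 \<longrightarrow>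
    (\<forall>x::real. x \<ge> 0 \<longrightarrow>
      ereal (\<Sum>k=1..2*K. (-1)^(k+1) * (x^k / fact k))
        \<le> liminf (\<lambda>N. ereal (gap_distribution x (\<lambda>n. real n powr \<alpha>) N)) \<and>
      liminf (\<lambda>N. ereal (gap_distribution x (\<lambda>n. real n powr \<alpha>) N))
        \<le> limsup (\<lambda>N. ereal (gap_distribution x (\<lambda>n. real n powr \<alpha>) N)) \<and>
      limsup (\<lambda>N. ereal (gap_distribution x (\<lambda>n. real n powr \<alpha>) N))
        \<le> ereal (\<Sum>k=1..2*K-1. (-1)^(k+1) * (x^k / fact k)))"
proof -
  define M where "M = 2 * K + 1"
  define \<tau> where "\<tau> = 16 * (real K)^2 + 8 * real K - 1"
  have "1 \<le> (real K)^2" using assms by simp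
  moreover have "1 \<le> real K" using assms by simp
  ultimately have \<tau>0: "\<tau> > 0" unfolding \<tau>_def by linarith
  have \<tau>M: "4 * real M ^ 2 - 4 * real M = \<tau> + 1"
    by (simp add: \<tau>_def M_def power2_eq_square algebra_simps)
  \<comment> \<open>For \<open>A = \<tau> + d\<close> the exponent condition of
    \<open>AE_correlation_tendsto\<close> simplifies to \<open>c \<le> (B - 2) * d\<close>; this
    determines \<open>c\<close>.\<close>
  define c where "c = 2 * \<tau> + 2 * real M * (2 * real M + 3)"
  have c0: "c \<ge> 0" using \<tau>0 by (simp add: c_def)
  \<comment> \<open>The starting points exceed \<tau> by at least \<open>1 / (p + 1)\<close>, so
    \<open>B - 2 \<ge> (p + 1) * c\<close> is enough.\<close>
  define B where "B = (\<lambda>p::nat. 3 + nat \<lceil>real (p + 1) * c\<rceil>)"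
  \<comment> \<open>For fixed \<open>p\<close> the intervals of length \<open>1 / B p\<close>
    starting at these points cover everything from \<open>\<tau> + 1 / (p + 1)\<close> on; letting
    \<open>p\<close> grow exhausts all exponents above \<tau>.\<close>
  define A where "A = (\<lambda>p i::nat. \<tau> + 1 / real (p + 1) + real i / real (B p))"
  have B3: "B p \<ge> 3" for p by (simp add: B_def)
  have A0: "A p i \<ge> 0" for p i using \<tau>0 by (simp add: A_def)
  have cond: "real (B p) * (4 * real M ^ 2 - 4 * real M) + 2 * real M * (2 * real M + 3) \<le>
    real (B p) * (A p i + 1) - 2 * A p i" for p i
  proof -
    define d where "d = A p i - \<tau>"
    have d: "d \<ge> 1 / real (p + 1)" by (simp add: d_def A_def)
    have "real (p + 1) * c \<le> real (B p) - 2" using c0 by (simp add: B_def) linarith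
    then have "(real (p + 1) * c) * (1 / real (p + 1)) \<le> (real (B p) - 2) * d"
      using d c0 B3[of p] by (intro mult_mono) auto
    then have "c \<le> (real (B p) - 2) * d" by simp
    moreover have "A p i = \<tau> + d" by (simp add: d_def)
    ultimately show ?thesis unfolding \<tau>M by (simp add: c_def algebra_simps)
  qed
  \<comment> \<open>All quantified parameters range over countable sets, so one null set serves them
    all, and it does not depend on the real \<open>x\<close>.\<close>
  have "AE \<alpha> in lebesgue. \<forall>p i m. \<forall>a b::rat. 2 \<le> m \<and> m \<le> M \<and> a < b \<and> \<alpha> \<in> {A p i..A p i + 1 / B p} \<longrightarrow>
    (\<lambda>j. correlation_sum (scaled_window (B p) j (of_rat a) (of_rat b)) m (block (B p) j) \<alpha> / real (j ^ B p))
      \<longlonglongrightarrow> (of_rat b - of_rat a) ^ (m - 1)"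
  proof (unfold AE_all_countable, intro allI)
    fix p i m and a b :: rat
    show "AE \<alpha> in lebesgue. 2 \<le> m \<and> m \<le> M \<and> a < b \<and> \<alpha> \<in> {A p i..A p i + 1 / B p} \<longrightarrow>
      (\<lambda>j. correlation_sum (scaled_window (B p) j (of_rat a) (of_rat b)) m (block (B p) j) \<alpha> / real (j ^ B p))
        \<longlonglongrightarrow> (of_rat b - of_rat a) ^ (m - 1)"
    proof (cases "2 \<le> m \<and> m \<le> M \<and> a < b")
      case True
      then have "AE \<alpha> in lebesgue. \<alpha> \<in> {A p i..A p i + 1 / B p} \<longrightarrow>
        (\<lambda>j. correlation_sum (scaled_window (B p) j (of_rat a) (of_rat b)) m (block (B p) j) \<alpha> / real (j ^ B p))
          \<longlonglongrightarrow> (of_rat b - of_rat a) ^ (m - 1)"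
        by (intro AE_correlation_tendsto[of m M] B3 A0 cond) (auto simp: of_rat_less)
      then show ?thesis by (rule AE_mp) (intro AE_I2 impI, blast)
    qed auto
  qed
  then show ?thesis
    using AE_inj_frac_powr
  proof eventually_elim
    case (elim \<alpha>)
    show ?case
    proof (intro impI allI)
      fix x :: real
      assume \<alpha>: "\<alpha> > 16 * (real K)^2 + 8 * real K - 1" and x: "x \<ge> 0"
      have \<alpha>\<tau>: "\<alpha> > \<tau>" using \<alpha> by (simp add: \<tau>_def)
      then obtain p where p: "1 / real (p + 1) < \<alpha> - \<tau>"
        using reals_Archimedean[of "\<alpha> - \<tau>"] by (auto simp: inverse_eq_divide)
      define t where "t = (\<alpha> - \<tau> - 1 / real (p + 1)) * real (B p)"
      define i where "i = nat \<lfloor>t\<rfloor>"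
      have Bp: "real (B p) > 0" using B3[of p] by simp
      have t: "real i \<le> t" "t < real i + 1" using p Bp by (auto simp: t_def i_def)
      have "\<alpha> = \<tau> + 1 / real (p + 1) + t / real (B p)" using Bp by (simp add: t_def)
      moreover have "real i / real (B p) \<le> t / real (B p)" "t / real (B p) \<le> real i / real (B p) + 1 / real (B p)"
        using t Bp by (auto simp: divide_right_mono simp flip: add_divide_distrib)
      ultimately have mem: "\<alpha> \<in> {A p i..A p i + 1 / B p}" by (simp add: A_def)
      have inj: "inj_on (\<lambda>n. frac (real n powr \<alpha>)) {1..}" using elim(2) \<alpha>\<tau> \<tau>0 by simp
      have lim: "(\<lambda>j. real (card (close_tuples (\<lambda>n. real n powr \<alpha>) (Suc k) (block (B p) j) (x / real (j ^ B p)))) / real (j ^ B p)) \<longlonglongrightarrow> x ^ k"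
        if "1 \<le> k" "k \<le> 2 * K" "x > 0" for k x
      proof -
        have "(\<lambda>j. real (card (close_tuples (\<lambda>n. real n powr \<alpha>) (Suc k) (block (B p) j) (x / real (j ^ B p)))) / real (j ^ B p))
          \<longlonglongrightarrow> x ^ (Suc k - 1)"
        proof (rule close_tuples_tendsto)
          fix a b :: rat assume "a < b"
          then have "2 \<le> Suc k \<and> Suc k \<le> M \<and> a < b \<and> \<alpha> \<in> {A p i..A p i + 1 / B p}"
            using mem that by (simp add: M_def)
          then show "(\<lambda>j. correlation_sum (scaled_window (B p) j (of_rat a) (of_rat b)) (Suc k) (block (B p) j) \<alpha> / real (j ^ B p))
            \<longlonglongrightarrow> (of_rat b - of_rat a) ^ (Suc k - 1)"
            using elim(1) by blast
        qed (use that B3[of p] in auto)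
        then show ?thesis by simp
      qed
      have B2: "B p \<ge> 2" using B3[of p] by simp
      have "ereal (poisson_partial_sum (2 * K) x) \<le> liminf (\<lambda>N. ereal (gap_distribution x (\<lambda>n. real n powr \<alpha>) N))"
      proof (rule gap_distribution_le_liminf[OF B2 x inj])
        fix k and y :: real
        assume "1 \<le> k" "k \<le> 2 * K" "y > 0"
        then show "(\<lambda>j. real (card (close_tuples (\<lambda>n. real n powr \<alpha>) (Suc k) (block (B p) j) (y / real (j ^ B p)))) / real (j ^ B p)) \<longlonglongrightarrow> y ^ k"
          by (rule lim)
      qed simp
      moreover have "limsup (\<lambda>N. ereal (gap_distribution x (\<lambda>n. real n powr \<alpha>) N)) \<le> ereal (poisson_partial_sum (2 * K - 1) x)"
      proof (rule gap_distribution_limsup_le[OF B2 x inj])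
        fix k and y :: real
        assume "1 \<le> k" "k \<le> 2 * K - 1" "y > 0"
        then show "(\<lambda>j. real (card (close_tuples (\<lambda>n. real n powr \<alpha>) (Suc k) (block (B p) j) (y / real (j ^ B p)))) / real (j ^ B p)) \<longlonglongrightarrow> y ^ k"
          by (intro lim) auto
      qed (use assms in simp)
      moreover have "liminf (\<lambda>N. ereal (gap_distribution x (\<lambda>n. real n powr \<alpha>) N)) \<le>
        limsup (\<lambda>N. ereal (gap_distribution x (\<lambda>n. real n powr \<alpha>) N))"
        by (rule Liminf_le_Limsup) simp
      ultimately show "ereal (\<Sum>k=1..2*K. (-1)^(k+1) * (x^k / fact k))
        \<le> liminf (\<lambda>N. ereal (gap_distribution x (\<lambda>n. real n powr \<alpha>) N)) \<and>
      liminf (\<lambda>N. ereal (gap_distribution x (\<lambda>n. real n powr \<alpha>) N))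
        \<le> limsup (\<lambda>N. ereal (gap_distribution x (\<lambda>n. real n powr \<alpha>) N)) \<and>
      limsup (\<lambda>N. ereal (gap_distribution x (\<lambda>n. real n powr \<alpha>) N))
        \<le> ereal (\<Sum>k=1..2*K-1. (-1)^(k+1) * (x^k / fact k))"
        unfolding poisson_partial_sum_def by blast
    qed
  qed
qed

end
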